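(* Let $X$ be a locally finite simplicial complex of dimension $n$, all of whose links are connected and each of whose simplices is contained in an $n$-simplex, and let $\Gamma$ be a locally compact, unimodular group of automorphisms of $X$ acting properly discontinuously on $X$. Let $1\le k<n$. Suppose there are an integer $l$ with $k<l\le n$ and $\varepsilon>0$ such that for every $\gamma\in\Sigma(l,\Gamma)$ one has, for real $\lambda$, $$p_k^l(\lambda-S_\sigma)=0\ \Longrightarrow\ \lambda\ge\varepsilon ,$$ where $p_k^l(\lambda-S_\sigma)$ is the polynomial in $\lambda$ obtained from the polynomial $p_k^l$ associated with $\gamma$ by substituting $x_\sigma=\lambda-S_\sigma$ for every $k$-dimensional ordered face $\sigma\sqsubset\gamma$. Then $L^2H^k(X,\rho)=0$ for every unitary representation $\rho$ of $\Gamma$.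
   Context: Simplices. $\Sigma(j)$ is the set of ordered $j$-simplices of $X$ ($(j+1)$-tuples of distinct vertices spanning a simplex), and $\Sigma(j,\Gamma)\subseteq\Sigma(j)$ is a chosen set of representatives of $\Gamma$-orbits. For $\tau=(w_0,\dots,w_i)$ and $\sigma=(v_0,\dots,v_j)$ with $i\le j$, write $\tau\sqsubset\sigma$ if $\tau$ is obtained from $\sigma$ by deleting entries, keeping the order. $m(\sigma)$ is the number of unordered $n$-simplices containing $\sigma$. $\Gamma_\sigma$ is the stabilizer of the ordered simplex $\sigma$ and $|\Gamma_\sigma|$ its Haar measure. The action is properly discontinuous: continuous and simplicial, with compact (and open) stabilizers of simplices. Links. For $\tau\in\Sigma(j)$, the link $X_\tau$ is the finite $(n-j-1)$-dimensional complex of simplices $\eta$ disjoint from $\tau$ such that $\tau\eta$ (concatenation) is a simplex of $X$. "All links are connected" means that $X_\tau$ is connected for every simplex $\tau$ of dimension at most $n-2$. $L^2$-cohomology. For a (continuous) unitary representation $\rho$ of $\Gamma$ on a complex Hilbert space $H$, $C^j(X,\rho)$ is the space of alternating maps $\phi:\Sigma(j)\to H$ with $\phi(\gamma\sigma)=\rho(\gamma)\phi(\sigma)$ for all $\gamma\in\Gamma$, $\sigma\in\Sigma(j)$; $L^j(X,\rho)$ is the subspace of those with $\|\phi\|^2=\sum_{\sigma\in\Sigma(j,\Gamma)}\frac{m(\sigma)}{(j+1)!|\Gamma_\sigma|}|\phi(\sigma)|^2<\infty$. The differential is $d\phi(\sigma)=\sum_{i=0}^{j+1}(-1)^i\phi(\sigma_i)$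 for $\sigma\in\Sigma(j+1)$, $\sigma_i$ being $\sigma$ with its $i$-th vertex deleted; it is bounded $L^j(X,\rho)\to L^{j+1}(X,\rho)$. Then $L^2H^k(X,\rho)=\ker(d\mid L^k(X,\rho))/\mathrm{im}(d\mid L^{k-1}(X,\rho))$. Eigenvalues. For $\tau\in\Sigma(k-1)$, let $\Delta_\tau^+$ be the Laplacian on real functions on the vertices of $X_\tau$: $\Delta^+_\tau f(v)=(n-k)f(v)-\sum_{u}\frac{m(\tau uv)}{m(\tau v)}f(u)$, the sum being over vertices $u$ of $X_\tau$ adjacent to $v$ in $X_\tau$. Let $\lambda_\tau$ be its smallest positive eigenvalue and $\overline{\lambda_\tau}=\lambda_\tau-\frac{k(n-k)}{k+1}$. For $\sigma\in\Sigma(k)$ put $S_\sigma=\sum_{\tau\in\Sigma(k-1),\,\tau\sqsubset\sigma}\overline{\lambda_\tau}$. The polynomial $p_k^l$. For an ordered $l$-simplex $\gamma$ let $F=\{\sigma\sqsubset\gamma:\dim\sigma=k\}$ and $F'=\{\nu\sqsubset\gamma:\dim\nu=k+1\}$. If $\nu=(v_0,\dots,v_{k+1})$ and $\sigma=(v_0,\dots,\hat v_i,\dots,v_{k+1})$, put $[\nu:\sigma]=(-1)^i$. Let $M_k^l$ be the matrix indexed by $F\cup F'$ with entries: $x_\alpha$ if $\alpha=\beta\in F$; $[\beta:\alpha]$ if $\alpha\in F$, $\beta\in F'$, $\alpha\sqsubset\beta$; $[\alpha:\beta]$ if $\beta\in F$, $\alpha\in F'$, $\beta\sqsubset\alpha$;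 and $0$ otherwise, in position $(\alpha,\beta)$. Here $(x_\sigma)_{\sigma\in F}$ are variables and $p_k^l(x_\sigma)=\det(M_k^l)$. *)

theory Defs
  imports
    "HOL-Analysis.Analysis"
    "HOL-Algebra.Group_Action"
    "HOL-Algebra.Elementary_Groups"
    "HOL-Combinatorics.Permutations"
    "HOL-Computational_Algebra.Polynomial"
    "HOL-Library.Sublist"
begin

section \<open>Simplicial complexes\<close>

text \<open>A complex is given by its set of (unordered, nonempty) simplices; its vertex set is the union.
  A simplex with \<open>j + 1\<close> vertices has dimension \<open>j\<close>.\<close>

definition abstract_complex :: "'v set set \<Rightarrow> bool" where
  "abstract_complex X \<longleftrightarrow>
     (\<forall>s\<in>X. finite s \<and> s \<noteq> {} \<and> (\<forall>t. t \<noteq> {} \<and> t \<subseteq> s \<longrightarrow> t \<in> X))"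

definition locally_finite_complex :: "'v set set \<Rightarrow> bool" where
  "locally_finite_complex X \<longleftrightarrow> (\<forall>v\<in>\<Union>X. finite {s\<in>X. v \<in> s})"

definition has_dimension :: "'v set set \<Rightarrow> nat \<Rightarrow> bool" where
  "has_dimension X n \<longleftrightarrow> (\<exists>s\<in>X. card s = n + 1) \<and> (\<forall>s\<in>X. card s \<le> n + 1)"

definition ordered_simplices :: "'v set set \<Rightarrow> nat \<Rightarrow> 'v list set" where
  "ordered_simplices X j = {\<sigma>. length \<sigma> = j + 1 \<and> distinct \<sigma> \<and> set \<sigma> \<in> X}"

text \<open>The relation of being obtained by deleting entries is \<^const>\<open>subseq\<close>.\<close>

definition delete_nth :: "nat \<Rightarrow> 'v list \<Rightarrow> 'v list" where
  "delete_nth i \<sigma> = take i \<sigma> @ drop (Suc i) \<sigma>"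

definition top_count :: "'v set set \<Rightarrow> nat \<Rightarrow> 'v list \<Rightarrow> nat" where
  "top_count X n \<sigma> = card {s\<in>X. card s = n + 1 \<and> set \<sigma> \<subseteq> s}"

definition link :: "'v set set \<Rightarrow> 'v list \<Rightarrow> 'v set set" where
  "link X \<tau> = {\<eta>\<in>X. \<eta> \<inter> set \<tau> = {} \<and> set \<tau> \<union> \<eta> \<in> X}"

text \<open>Nonempty, and any two vertices are joined by an edge path.\<close>

definition connected_complex :: "'v set set \<Rightarrow> bool" where
  "connected_complex Y \<longleftrightarrow>
     Y \<noteq> {} \<and> (\<forall>u\<in>\<Union>Y. \<forall>v\<in>\<Union>Y. (u, v) \<in> {(x, y). {x, y} \<in> Y}\<^sup>*)"

definition links_connected :: "'v set set \<Rightarrow> nat \<Rightarrow> bool" where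
  "links_connected X n \<longleftrightarrow>
     (\<forall>j. j + 2 \<le> n \<longrightarrow> (\<forall>\<tau>\<in>ordered_simplices X j. connected_complex (link X \<tau>)))"


section \<open>Locally compact groups and their actions\<close>

definition locally_compact_group :: "('g, 'm) monoid_scheme \<Rightarrow> 'g topology \<Rightarrow> bool" where
  "locally_compact_group G T \<longleftrightarrow>
     group G \<and> topspace T = carrier G \<and>
     continuous_map (prod_topology T T) T (\<lambda>(g, h). g \<otimes>\<^bsub>G\<^esub> h) \<and>
     continuous_map T T (\<lambda>g. inv\<^bsub>G\<^esub> g) \<and>
     Hausdorff_space T \<and> locally_compact_space T"

text \<open>Left Haar measures: nonzero left-invariant Radon measures on the Borel sets of the group.\<close>

definition left_haar_measure ::
  "('g, 'm) monoid_scheme \<Rightarrow> 'g topology \<Rightarrow> 'g measure \<Rightarrow> bool" where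
  "left_haar_measure G T \<mu> \<longleftrightarrow>
     sets \<mu> = sigma_sets (topspace T) {U. openin T U} \<and>
     emeasure \<mu> (topspace T) \<noteq> 0 \<and>
     (\<forall>K. compactin T K \<longrightarrow> emeasure \<mu> K < \<infinity>) \<and>
     (\<forall>A\<in>sets \<mu>. emeasure \<mu> A = (INF U\<in>{U. openin T U \<and> A \<subseteq> U}. emeasure \<mu> U)) \<and>
     (\<forall>U. openin T U \<longrightarrow>
        emeasure \<mu> U = (SUP K\<in>{K. compactin T K \<and> K \<subseteq> U}. emeasure \<mu> K)) \<and>
     (\<forall>g\<in>carrier G. \<forall>A\<in>sets \<mu>. emeasure \<mu> (g <#\<^bsub>G\<^esub> A) = emeasure \<mu> A)"

definition unimodular :: "('g, 'm) monoid_scheme \<Rightarrow> 'g topology \<Rightarrow> bool" where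
  "unimodular G T \<longleftrightarrow>
     (\<forall>\<mu>. left_haar_measure G T \<mu> \<longrightarrow>
        (\<forall>g\<in>carrier G. \<forall>A\<in>sets \<mu>. emeasure \<mu> (A #>\<^bsub>G\<^esub> g) = emeasure \<mu> A))"

text \<open>The action is given on vertices, \<open>a g\<close> being the bijection of the vertex set induced by \<open>g\<close>;
  it acts on ordered simplices entrywise.\<close>

definition simplex_stabilizer ::
  "('g, 'm) monoid_scheme \<Rightarrow> ('g \<Rightarrow> 'v \<Rightarrow> 'v) \<Rightarrow> 'v list \<Rightarrow> 'g set" where
  "simplex_stabilizer G a \<sigma> = {g\<in>carrier G. map (a g) \<sigma> = \<sigma>}"

text \<open>A simplicial action on a locally finite complex is continuous iff it is continuous on the
  (discrete) set of vertices. Simplices being mapped to simplices by every group element,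
  also by its inverse, each \<open>a g\<close> is an automorphism of the complex.\<close>

definition properly_discontinuous_action ::
  "('g, 'm) monoid_scheme \<Rightarrow> 'g topology \<Rightarrow> 'v set set \<Rightarrow> ('g \<Rightarrow> 'v \<Rightarrow> 'v) \<Rightarrow> bool" where
  "properly_discontinuous_action G T X a \<longleftrightarrow>
     group_action G (\<Union>X) a \<and>
     (\<forall>g\<in>carrier G. \<forall>s\<in>X. a g ` s \<in> X) \<and>
     continuous_map (prod_topology T (discrete_topology (\<Union>X))) (discrete_topology (\<Union>X))
       (\<lambda>(g, v). a g v) \<and>
     (\<forall>j. \<forall>\<sigma>\<in>ordered_simplices X j.
        compactin T (simplex_stabilizer G a \<sigma>) \<and> openin T (simplex_stabilizer G a \<sigma>))"

definition orbit_representatives ::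
  "('g, 'm) monoid_scheme \<Rightarrow> 'v set set \<Rightarrow> ('g \<Rightarrow> 'v \<Rightarrow> 'v) \<Rightarrow> nat \<Rightarrow> 'v list set \<Rightarrow> bool" where
  "orbit_representatives G X a j R \<longleftrightarrow>
     R \<subseteq> ordered_simplices X j \<and>
     (\<forall>\<sigma>\<in>ordered_simplices X j. \<exists>!\<tau>. \<tau> \<in> R \<and> (\<exists>g\<in>carrier G. map (a g) \<tau> = \<sigma>))"


section \<open>Unitary representations on complex Hilbert spaces\<close>

text \<open>The inner product is linear in the first argument; its positive definiteness is
  contained in \<open>cinner_self\<close>.\<close>

class complex_hilbert = banach +
  fixes scaleC :: "complex \<Rightarrow> 'a \<Rightarrow> 'a"
    and cinner :: "'a \<Rightarrow> 'a \<Rightarrow> complex"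
  assumes scaleC_add_right: "scaleC c (x + y) = scaleC c x + scaleC c y"
    and scaleC_add_left: "scaleC (c + d) x = scaleC c x + scaleC d x"
    and scaleC_scaleC: "scaleC c (scaleC d x) = scaleC (c * d) x"
    and scaleC_of_real: "scaleC (complex_of_real r) x = scaleR r x"
    and cinner_commute: "cinner x y = cnj (cinner y x)"
    and cinner_add_left: "cinner (x + y) z = cinner x z + cinner y z"
    and cinner_scaleC_left: "cinner (scaleC c x) y = c * cinner x y"
    and cinner_self: "cinner x x = complex_of_real ((norm x)\<^sup>2)"

definition unitary_operator :: "('h::complex_hilbert \<Rightarrow> 'h) \<Rightarrow> bool" where
  "unitary_operator U \<longleftrightarrow>
     (\<forall>x y. U (x + y) = U x + U y) \<and> (\<forall>c x. U (scaleC c x) = scaleC c (U x)) \<and>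
     (\<forall>x y. cinner (U x) (U y) = cinner x y) \<and> surj U"

definition unitary_representation ::
  "('g, 'm) monoid_scheme \<Rightarrow> 'g topology \<Rightarrow> ('g \<Rightarrow> 'h::complex_hilbert \<Rightarrow> 'h) \<Rightarrow> bool" where
  "unitary_representation G T \<rho> \<longleftrightarrow>
     (\<forall>g\<in>carrier G. unitary_operator (\<rho> g)) \<and>
     (\<forall>g\<in>carrier G. \<forall>h\<in>carrier G. \<rho> (g \<otimes>\<^bsub>G\<^esub> h) = \<rho> g \<circ> \<rho> h) \<and>
     (\<forall>x. continuous_map T euclidean (\<lambda>g. \<rho> g x))"


section \<open>L2-cohomology\<close>

text \<open>Maps defined on the ordered \<open>j\<close>-simplices are extended by zero to all lists.\<close>

definition cochains ::
  "('g, 'm) monoid_scheme \<Rightarrow> 'v set set \<Rightarrow> ('g \<Rightarrow> 'v \<Rightarrow> 'v) \<Rightarrow> ('g \<Rightarrow> 'h::complex_hilbert \<Rightarrow> 'h)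
     \<Rightarrow> nat \<Rightarrow> ('v list \<Rightarrow> 'h) set" where
  "cochains G X a \<rho> j =
     {\<phi>. (\<forall>\<sigma>. \<sigma> \<notin> ordered_simplices X j \<longrightarrow> \<phi> \<sigma> = 0) \<and>
         (\<forall>\<sigma>\<in>ordered_simplices X j. \<forall>\<pi>. \<pi> permutes {..<length \<sigma>} \<longrightarrow>
            \<phi> (permute_list \<pi> \<sigma>) = of_int (sign \<pi>) *\<^sub>R \<phi> \<sigma>) \<and>
         (\<forall>g\<in>carrier G. \<forall>\<sigma>\<in>ordered_simplices X j. \<phi> (map (a g) \<sigma>) = \<rho> g (\<phi> \<sigma>))}"

text \<open>\<open>R j\<close> is the chosen set of orbit representatives of ordered \<open>j\<close>-simplices.\<close>

definition L2_cochains ::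
  "('g, 'm) monoid_scheme \<Rightarrow> 'g measure \<Rightarrow> 'v set set \<Rightarrow> nat \<Rightarrow> ('g \<Rightarrow> 'v \<Rightarrow> 'v)
     \<Rightarrow> (nat \<Rightarrow> 'v list set) \<Rightarrow> ('g \<Rightarrow> 'h::complex_hilbert \<Rightarrow> 'h) \<Rightarrow> nat \<Rightarrow> ('v list \<Rightarrow> 'h) set" where
  "L2_cochains G \<mu> X n a R \<rho> j =
     {\<phi>\<in>cochains G X a \<rho> j.
        (\<lambda>\<sigma>. real (top_count X n \<sigma>) / (fact (j + 1) * measure \<mu> (simplex_stabilizer G a \<sigma>))
              * (norm (\<phi> \<sigma>))\<^sup>2) summable_on R j}"

definition coboundary ::
  "'v set set \<Rightarrow> nat \<Rightarrow> ('v list \<Rightarrow> 'h::real_vector) \<Rightarrow> 'v list \<Rightarrow> 'h" where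
  "coboundary X j \<phi> \<sigma> =
     (if \<sigma> \<in> ordered_simplices X (j + 1)
      then \<Sum>i = 0..j + 1. (-1) ^ i *\<^sub>R \<phi> (delete_nth i \<sigma>) else 0)"

text \<open>The quotient of cocycles by coboundaries, formed as a quotient of additive groups
  (used for \<open>k \<ge> 1\<close>).\<close>

definition L2_cohomology ::
  "('g, 'm) monoid_scheme \<Rightarrow> 'g measure \<Rightarrow> 'v set set \<Rightarrow> nat \<Rightarrow> ('g \<Rightarrow> 'v \<Rightarrow> 'v)
     \<Rightarrow> (nat \<Rightarrow> 'v list set) \<Rightarrow> ('g \<Rightarrow> 'h::complex_hilbert \<Rightarrow> 'h) \<Rightarrow> nat
     \<Rightarrow> ('v list \<Rightarrow> 'h) set monoid" where
  "L2_cohomology G \<mu> X n a R \<rho> k =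
     \<lparr>carrier = {\<phi>\<in>L2_cochains G \<mu> X n a R \<rho> k. coboundary X k \<phi> = (\<lambda>\<sigma>. 0)},
      mult = (\<lambda>\<phi> \<psi> \<sigma>. \<phi> \<sigma> + \<psi> \<sigma>),
      one = (\<lambda>\<sigma>. 0)\<rparr>
     Mod (coboundary X (k - 1) ` L2_cochains G \<mu> X n a R \<rho> (k - 1))"


section \<open>Eigenvalues of the links\<close>

definition link_laplacian ::
  "'v set set \<Rightarrow> nat \<Rightarrow> nat \<Rightarrow> 'v list \<Rightarrow> ('v \<Rightarrow> real) \<Rightarrow> 'v \<Rightarrow> real" where
  "link_laplacian X n k \<tau> f v =
     (real n - real k) * f v -
     (\<Sum>u | u \<noteq> v \<and> {u, v} \<in> link X \<tau>.
        real (top_count X n (\<tau> @ [u, v])) / real (top_count X n (\<tau> @ [v])) * f u)"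

text \<open>Only the values on the vertices of the link matter: \<^const>\<open>link_laplacian\<close> does not
  involve the others when \<open>v\<close> is a vertex of the link.\<close>

definition link_eigenvalue :: "'v set set \<Rightarrow> nat \<Rightarrow> nat \<Rightarrow> 'v list \<Rightarrow> real \<Rightarrow> bool" where
  "link_eigenvalue X n k \<tau> c \<longleftrightarrow>
     (\<exists>f. (\<exists>v\<in>\<Union>(link X \<tau>). f v \<noteq> 0) \<and>
          (\<forall>v\<in>\<Union>(link X \<tau>). link_laplacian X n k \<tau> f v = c * f v))"

definition lambda_min :: "'v set set \<Rightarrow> nat \<Rightarrow> nat \<Rightarrow> 'v list \<Rightarrow> real" where
  "lambda_min X n k \<tau> = (LEAST c. 0 < c \<and> link_eigenvalue X n k \<tau> c)"

definition lambda_bar :: "'v set set \<Rightarrow> nat \<Rightarrow> nat \<Rightarrow> 'v list \<Rightarrow> real" where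
  "lambda_bar X n k \<tau> =
     lambda_min X n k \<tau> - real k * (real n - real k) / (real k + 1)"

definition S_sum :: "'v set set \<Rightarrow> nat \<Rightarrow> nat \<Rightarrow> 'v list \<Rightarrow> real" where
  "S_sum X n k \<sigma> =
     (\<Sum>\<tau> | \<tau> \<in> ordered_simplices X (k - 1) \<and> subseq \<tau> \<sigma>. lambda_bar X n k \<tau>)"


section \<open>The polynomial of an ordered simplex\<close>

definition ordered_faces :: "nat \<Rightarrow> 'v list \<Rightarrow> 'v list set" where
  "ordered_faces j \<gamma> = {\<sigma>. subseq \<sigma> \<gamma> \<and> length \<sigma> = j + 1}"

definition incidence :: "'v list \<Rightarrow> 'v list \<Rightarrow> int" where
  "incidence \<nu> \<sigma> = (-1) ^ (THE i. i < length \<nu> \<and> \<sigma> = delete_nth i \<nu>)"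

definition face_matrix ::
  "nat \<Rightarrow> 'v list \<Rightarrow> ('v list \<Rightarrow> 'r::comm_ring_1) \<Rightarrow> 'v list \<Rightarrow> 'v list \<Rightarrow> 'r" where
  "face_matrix k \<gamma> x \<alpha> \<beta> =
     (if \<alpha> \<in> ordered_faces k \<gamma> \<and> \<alpha> = \<beta> then x \<alpha>
      else if \<alpha> \<in> ordered_faces k \<gamma> \<and> \<beta> \<in> ordered_faces (k + 1) \<gamma> \<and> subseq \<alpha> \<beta>
        then of_int (incidence \<beta> \<alpha>)
      else if \<beta> \<in> ordered_faces k \<gamma> \<and> \<alpha> \<in> ordered_faces (k + 1) \<gamma> \<and> subseq \<beta> \<alpha>
        then of_int (incidence \<alpha> \<beta>)
      else 0)"

text \<open>Determinant of a square matrix indexed by a finite set (Leibniz formula, as for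
  \<^const>\<open>det\<close>, where the index set is a whole type).\<close>

definition set_det :: "'i set \<Rightarrow> ('i \<Rightarrow> 'i \<Rightarrow> 'r::comm_ring_1) \<Rightarrow> 'r" where
  "set_det I A = (\<Sum>p | p permutes I. of_int (sign p) * (\<Prod>i\<in>I. A i (p i)))"

text \<open>The variables \<open>x\<close> range over an arbitrary commutative ring, so that
  polynomials in another variable may be substituted for them.\<close>

definition face_poly :: "nat \<Rightarrow> 'v list \<Rightarrow> ('v list \<Rightarrow> 'r::comm_ring_1) \<Rightarrow> 'r" where
  "face_poly k \<gamma> x =
     set_det (ordered_faces k \<gamma> \<union> ordered_faces (k + 1) \<gamma>) (face_matrix k \<gamma> x)"

end

theory Submission
  imports Defs
begin

text \<open>Write \<open>\<parallel>\<phi>\<parallel>\<close> for the norm of a square summable cochain and \<open>\<delta>\<close> for the adjoint of \<open>d\<close>. The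
  cohomology in degree \<open>k\<close> vanishes as soon as \<open>\<parallel>\<phi>\<parallel>\<^sup>2 \<le> const * \<parallel>\<delta> \<phi>\<parallel>\<^sup>2\<close> for all closed \<open>\<phi>\<close>: a gradient
  descent \<open>\<phi> \<mapsto> \<phi> - t d \<delta> \<phi>\<close> then contracts the closed cochains to \<open>0\<close>, and the sum of its steps
  exhibits \<open>\<phi>\<close> as a coboundary (\<open>closed_imp_exact\<close>).

  The estimate has two halves, which meet in the quantity
  \<open>Q = \<Sum>\<sigma>. m(\<sigma>) S\<^sub>\<sigma> |\<phi>(\<sigma>)|\<^sup>2 / |\<Gamma>\<^sub>\<sigma>|\<close>, a sum over orbits of \<open>k\<close>-simplices.

  First, \<open>Q \<le> const * \<parallel>\<delta> \<phi>\<parallel>\<^sup>2\<close> for closed \<open>\<phi>\<close> (\<open>garland_inequality\<close>). For a \<open>(k - 1)\<close>-simplex \<open>\<tau>\<close> the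
  function \<open>v \<mapsto> \<phi>(\<tau>v)\<close> lives on the vertices of the link of \<open>\<tau>\<close>, and its mean there is
  \<open>\<delta> \<phi>(\<tau>)\<close> up to a constant factor.
  As the link is connected, only constants have Laplacian zero, so the energy of this function
  is at least \<open>\<lambda>\<^sub>\<tau>\<close> times its squared distance from its mean (\<open>weighted_graph.energy_ge_gap\<close>).
  Summing over \<open>\<tau>\<close>, the energies add up to \<open>k (n - k) / (k + 1)\<close> times the sum of the squared norms,
  because \<open>d \<phi> = 0\<close> determines the sum of the cross terms \<open>\<langle>\<phi>(\<tau>u), \<phi>(\<tau>v)\<rangle>\<close> (\<open>closed_cross_term\<close>).
  This is the shift from \<open>\<lambda>\<^sub>\<tau>\<close> to the numbers that \<open>S\<^sub>\<sigma>\<close> is made of.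

  Second, \<open>\<epsilon> \<parallel>\<phi>\<parallel>\<^sup>2 \<le> const * Q\<close>. On a single \<open>l\<close>-simplex \<open>\<gamma>\<close>, let \<open>c\<close> be the minimum of
  \<open>\<Sum>\<sigma>. S\<^sub>\<sigma> x\<^sub>\<sigma>\<^sup>2\<close> over the closed cochains \<open>x\<close> of \<open>\<gamma>\<close> of norm one. Lagrange's rule turns a minimiser and
  its multipliers into a kernel vector of the face matrix with diagonal entries \<open>c - S\<^sub>\<sigma>\<close>, so that \<open>c\<close> is a root of the
  polynomial and hence at least \<open>\<epsilon>\<close> (\<open>closed_form_ge_of_face_poly_roots\<close>). Summing over the
  \<open>l\<close>-simplices counts all \<open>k\<close>-simplices with the same factor.

  Both local inequalities are proved for real functions and carried over to vectors by expanding
  in an orthonormal system. Sums over orbits in different dimensions are compared by pushing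
  forward along the maps that delete a vertex; this is where unimodularity enters
  (\<open>card_orbit_fibre\<close>).\<close>

section \<open>Singular matrices and constrained minima\<close>

text \<open>Multiplying the determinant by \<open>w j0\<close> amounts to multiplying column \<open>j0\<close> by it, and the kernel
  relation expresses this column through the others. Each of the resulting determinants has two
  equal columns, so its terms cancel in pairs.\<close>

lemma set_det_eq_0_if_kernel:
  fixes A :: "'i \<Rightarrow> 'i \<Rightarrow> real"
  assumes fin: "finite I" and j0: "j0 \<in> I" "w j0 \<noteq> 0"
    and ker: "\<And>i. i \<in> I \<Longrightarrow> (\<Sum>j\<in>I. A i j * w j) = 0"
  shows "set_det I A = 0"
proof -
  let ?P = "{p. p permutes I}"
  have finP: "finite ?P" using fin by (rule finite_permutations)
  \<comment> \<open>The term of \<open>p\<close> after the entry of column \<open>j0\<close> has been replaced by the one of column \<open>j\<close>.\<close>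
  define t where "t p j = of_int (sign p) * (A (inv_into UNIV p j0) j * w j) * (\<Prod>i\<in>I - {inv_into UNIV p j0}. A i (p i))" for p j
  have pinv: "inv_into UNIV p j0 \<in> I" "p (inv_into UNIV p j0) = j0" if "p permutes I" for p
    using that j0 by (metis permutes_inv permutes_in_image) (metis that permutes_inverses(1))
  have "(\<Sum>p\<in>?P. \<Sum>j\<in>I. t p j) = 0"
  proof (rule sum.neutral, rule ballI)
    fix p assume "p \<in> ?P"
    then have "inv_into UNIV p j0 \<in> I" using pinv by blast
    then show "(\<Sum>j\<in>I. t p j) = 0"
      using ker[of "inv_into UNIV p j0"] unfolding t_def
      by (simp flip: sum_distrib_left sum_distrib_right)
  qed
  moreover have "(\<Sum>p\<in>?P. \<Sum>j\<in>I. t p j) = (\<Sum>j\<in>I. \<Sum>p\<in>?P. t p j)"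
    by (rule sum.swap)
  moreover have "(\<Sum>p\<in>?P. t p j) = 0" if j: "j \<in> I" "j \<noteq> j0" for j
  proof -
    let ?s = "Transposition.transpose j0 j"
    have tr: "?s permutes I" using j j0 by (intro permutes_swap_id) auto
    have invol: "?s \<circ> (?s \<circ> p) = p" for p :: "'i \<Rightarrow> 'i"
      by (rule ext) simp
    have closed: "?s \<circ> p \<in> ?P" if "p \<in> ?P" for p
      using permutes_compose[OF _ tr, of p] that by simp
    have bij: "bij_betw (\<lambda>p. ?s \<circ> p) ?P ?P"
      by (rule bij_betw_byWitness[where f' = "\<lambda>p. ?s \<circ> p"]) (use invol closed in auto)
    have neg: "t (?s \<circ> p) j = - t p j" if "p \<in> ?P" for p
    proof -
      have p: "p permutes I" using that by simp
      have "sign (?s \<circ> p) = - sign p"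
        using j fin p tr by (subst sign_compose) (auto intro: permutes_imp_permutation simp: sign_swap_id)
      define i0 i1 where "i0 = inv_into UNIV p j0" and "i1 = inv_into UNIV p j"
      have i01: "i0 \<in> I" "p i0 = j0" "i1 \<in> I" "p i1 = j" "i0 \<noteq> i1"
        using p j j0 unfolding i0_def i1_def
        by (metis permutes_inv permutes_in_image permutes_inverses(1))+
      have "inv_into UNIV (?s \<circ> p) j0 = i1"
        using p i01 by (intro inv_f_eq inj_compose) (auto dest: permutes_inj)
      have split: "(\<Prod>i\<in>I - {x}. f i) = f y * (\<Prod>i\<in>I - {x, y}. f i)"
        if "x \<noteq> y" "y \<in> I" for x y and f :: "'i \<Rightarrow> real"
        using that fin by (subst prod.remove[of _ y]) (auto intro!: prod.cong)
      have same: "(\<Prod>i\<in>I - {i1, i0}. A i ((?s \<circ> p) i)) = (\<Prod>i\<in>I - {i0, i1}. A i (p i))"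
      proof (rule prod.cong)
        fix i assume "i \<in> I - {i0, i1}"
        then have "p i \<noteq> j0" "p i \<noteq> j"
          using p i01 by (auto dest: permutes_inj simp: inj_def)
        then show "A i ((?s \<circ> p) i) = A i (p i)" by (simp add: Transposition.transpose_def)
      qed auto
      show ?thesis
        unfolding t_def \<open>inv_into UNIV (?s \<circ> p) j0 = i1\<close> \<open>sign (?s \<circ> p) = - sign p\<close> i0_def[symmetric]
        using split[of i1 i0 "\<lambda>i. A i ((?s \<circ> p) i)"] split[of i0 i1 "\<lambda>i. A i (p i)"] same i01
        by simp
    qed
    have "(\<Sum>p\<in>?P. t p j) = (\<Sum>p\<in>?P. t (?s \<circ> p) j)"
      using sum.reindex_bij_betw[OF bij, of "\<lambda>p. t p j"] by simp
    also have "\<dots> = - (\<Sum>p\<in>?P. t p j)"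
      using neg by (simp add: sum_negf)
    finally show ?thesis by simp
  qed
  moreover have "(\<Sum>j\<in>I. \<Sum>p\<in>?P. t p j)
      = (\<Sum>p\<in>?P. t p j0) + (\<Sum>j\<in>I - {j0}. \<Sum>p\<in>?P. t p j)"
    using fin j0 by (intro sum.remove)
  ultimately have "0 = (\<Sum>p\<in>?P. t p j0)" by simp
  also have "\<dots> = (\<Sum>p\<in>?P. of_int (sign p) * (\<Prod>i\<in>I. A i (p i)) * w j0)"
  proof (rule sum.cong)
    fix p assume "p \<in> ?P"
    then show "t p j0 = of_int (sign p) * (\<Prod>i\<in>I. A i (p i)) * w j0"
      using pinv[of p] fin unfolding t_def by (subst (2) prod.remove[of _ "inv_into UNIV p j0"]) auto
  qed auto
  also have "\<dots> = set_det I A * w j0"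
    unfolding set_det_def by (simp add: sum_distrib_right)
  finally show ?thesis using j0 by simp
qed

text \<open>The algebraic half of Lagrange's multiplier rule, by induction on the set of constraints. If the
  new functional \<open>c m0\<close> does not vanish on the common kernel of the others, a multiple of it can be subtracted
  from \<open>s\<close> so that the difference vanishes there; otherwise it imposes no condition.\<close>

lemma annihilator_of_common_kernel:
  fixes c :: "'m \<Rightarrow> 'i \<Rightarrow> real" and s :: "'i \<Rightarrow> real"
  assumes "finite M" and "finite I"
    and "\<And>x. (\<And>m. m \<in> M \<Longrightarrow> (\<Sum>i\<in>I. c m i * x i) = 0) \<Longrightarrow> (\<Sum>i\<in>I. s i * x i) = 0"
  shows "\<exists>y. \<forall>i\<in>I. s i = (\<Sum>m\<in>M. y m * c m i)"
  using assms(1,3)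
proof (induction M arbitrary: s rule: finite_induct)
  case empty
  have "s i = 0" if "i \<in> I" for i
    using empty[of "\<lambda>j. if j = i then 1 else 0"] that \<open>finite I\<close> by (simp add: if_distrib cong: if_cong)
  then show ?case by simp
next
  case (insert m0 M)
  show ?case
  proof (cases "\<exists>x. (\<forall>m\<in>M. (\<Sum>i\<in>I. c m i * x i) = 0) \<and> (\<Sum>i\<in>I. c m0 i * x i) \<noteq> 0")
    case True
    then obtain x where x: "\<forall>m\<in>M. (\<Sum>i\<in>I. c m i * x i) = 0" "(\<Sum>i\<in>I. c m0 i * x i) \<noteq> 0"
      by blast
    define r where "r = (\<Sum>i\<in>I. c m0 i * x i)"
    define b where "b = (\<Sum>i\<in>I. s i * x i) / r"
    have "\<exists>y. \<forall>i\<in>I. s i - b * c m0 i = (\<Sum>m\<in>M. y m * c m i)"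
    proof (rule insert.IH)
      fix z assume z: "\<And>m. m \<in> M \<Longrightarrow> (\<Sum>i\<in>I. c m i * z i) = 0"
      define q where "q = (\<Sum>i\<in>I. c m0 i * z i)"
      have lin: "(\<Sum>i\<in>I. e i * (z i - q / r * x i)) = (\<Sum>i\<in>I. e i * z i) - q / r * (\<Sum>i\<in>I. e i * x i)"
        for e :: "'i \<Rightarrow> real"
        by (simp add: right_diff_distrib sum_subtractf sum_distrib_left mult.left_commute)
      have "(\<Sum>i\<in>I. s i * (z i - q / r * x i)) = 0"
      proof (rule insert.prems)
        fix m assume m: "m \<in> insert m0 M"
        have "(\<Sum>i\<in>I. c m0 i * z i) - q / r * (\<Sum>i\<in>I. c m0 i * x i) = 0"
          using x by (simp add: q_def r_def)
        then show "(\<Sum>i\<in>I. c m i * (z i - q / r * x i)) = 0"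
          unfolding lin using m x z by auto
      qed
      then have "(\<Sum>i\<in>I. s i * z i) = b * q"
        unfolding lin by (simp add: b_def)
      then show "(\<Sum>i\<in>I. (s i - b * c m0 i) * z i) = 0"
        by (simp add: left_diff_distrib sum_subtractf q_def sum_distrib_left mult.assoc)
    qed
    then obtain y where y: "\<forall>i\<in>I. s i - b * c m0 i = (\<Sum>m\<in>M. y m * c m i)" by blast
    have "s i = (\<Sum>m\<in>insert m0 M. (y(m0 := b)) m * c m i)" if "i \<in> I" for i
    proof -
      have "(\<Sum>m\<in>M. (y(m0 := b)) m * c m i) = (\<Sum>m\<in>M. y m * c m i)"
        using insert.hyps by (intro sum.cong) auto
      then show ?thesis using y that insert.hyps by (simp add: algebra_simps)
    qed
    then show ?thesis by blast
  next
    case False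
    then have "\<exists>y. \<forall>i\<in>I. s i = (\<Sum>m\<in>M. y m * c m i)"
      by (intro insert.IH insert.prems) auto
    then obtain y where y: "\<forall>i\<in>I. s i = (\<Sum>m\<in>M. y m * c m i)" by blast
    have "s i = (\<Sum>m\<in>insert m0 M. (y(m0 := 0)) m * c m i)" if "i \<in> I" for i
    proof -
      have "(\<Sum>m\<in>M. (y(m0 := 0)) m * c m i) = (\<Sum>m\<in>M. y m * c m i)"
        using insert.hyps by (intro sum.cong) auto
      then show ?thesis using y that insert.hyps by simp
    qed
    then show ?thesis by blast
  qed
qed

lemma quadratic_nonneg_imp_linear_zero:
  fixes b q :: real
  assumes "\<And>t. 0 \<le> 2 * t * b + t\<^sup>2 * q"
  shows "b = 0"
proof (rule ccontr)
  assume b: "b \<noteq> 0"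
  \<comment> \<open>A step against the linear term, short enough for the quadratic term not to compensate it.\<close>
  define t where "t = - b / (\<bar>q\<bar> + 1)"
  have "t\<^sup>2 * q \<le> t\<^sup>2 * (\<bar>q\<bar> + 1)" by (intro mult_left_mono) auto
  also have "\<dots> = - t * b" unfolding t_def by (simp add: power2_eq_square field_simps add_nonneg_eq_0_iff)
  finally have "0 \<le> t * b" using assms[of t] by simp
  then have "0 \<le> - (b * b) / (\<bar>q\<bar> + 1)" unfolding t_def by simp
  then have "b * b \<le> 0" by (auto simp: field_simps zero_le_divide_iff)
  then show False using b by (metis mult_eq_0_iff order_antisym zero_le_square)
qed

text \<open>A minimiser of a quadratic form over the vectors of norm one in a subspace exists by compactness,
  and the first variation vanishes in all directions of the subspace. The function space carries
  the product topology, in which a box is compact.\<close>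

lemma constrained_minimiser:
  fixes B :: "'i \<Rightarrow> 'i \<Rightarrow> real" and w :: "'i \<Rightarrow> real" and c :: "'m \<Rightarrow> 'i \<Rightarrow> real"
  assumes fin: "finite I" and w: "\<And>i. i \<in> I \<Longrightarrow> w i > 0"
    and sym: "\<And>i j. i \<in> I \<Longrightarrow> j \<in> I \<Longrightarrow> B i j = B j i"
    and z: "\<forall>m\<in>M. (\<Sum>i\<in>I. c m i * z i) = 0" "i0 \<in> I" "z i0 \<noteq> 0"
  obtains x e where "\<forall>m\<in>M. (\<Sum>i\<in>I. c m i * x i) = 0" and "(\<Sum>i\<in>I. w i * (x i)\<^sup>2) = 1"
    and "\<And>y. (\<forall>m\<in>M. (\<Sum>i\<in>I. c m i * y i) = 0) \<Longrightarrow>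
           (\<Sum>i\<in>I. \<Sum>j\<in>I. B i j * y i * y j) \<ge> e * (\<Sum>i\<in>I. w i * (y i)\<^sup>2)"
    and "\<And>y. (\<forall>m\<in>M. (\<Sum>i\<in>I. c m i * y i) = 0) \<Longrightarrow>
           (\<Sum>i\<in>I. (\<Sum>j\<in>I. B i j * x j) * y i) = e * (\<Sum>i\<in>I. w i * x i * y i)"
proof -
  define K where "K = {x :: 'i \<Rightarrow> real. \<forall>m\<in>M. (\<Sum>i\<in>I. c m i * x i) = 0}"
  define q where "q x = (\<Sum>i\<in>I. \<Sum>j\<in>I. B i j * x i * x j)" for x :: "'i \<Rightarrow> real"
  define N where "N x = (\<Sum>i\<in>I. w i * (x i)\<^sup>2)" for x :: "'i \<Rightarrow> real"
  define Q where "Q x y = (\<Sum>i\<in>I. (\<Sum>j\<in>I. B i j * x j) * y i)" for x y :: "'i \<Rightarrow> real"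
  define W where "W x y = (\<Sum>i\<in>I. w i * x i * y i)" for x y :: "'i \<Rightarrow> real"
  let ?box = "PiE UNIV (\<lambda>i. if i \<in> I then {- (1 + 1 / w i) .. 1 + 1 / w i} else {0})"
  have coord: "continuous_on A (\<lambda>x :: 'i \<Rightarrow> real. x i)" for i A
    by (rule continuous_on_subset[OF continuous_on_product_coordinates]) simp
  have box: "compact ?box"
  proof -
    have "compactin (product_topology (\<lambda>i. euclidean) UNIV) ?box"
      by (subst compactin_PiE) (auto)
    then show ?thesis by (simp add: euclidean_product_topology)
  qed
  have qc: "continuous_on A q" for A unfolding q_def by (intro continuous_intros coord)
  have closed: "closed {x \<in> K. N x = 1}"
  proof -
    have "closed ((\<Inter>m\<in>M. {x :: 'i \<Rightarrow> real. (\<Sum>i\<in>I. c m i * x i) = 0}) \<inter> {x. N x = 1})"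
      unfolding N_def by (intro closed_Int closed_INT ballI closed_Collect_eq continuous_intros coord)
    moreover have "(\<Inter>m\<in>M. {x :: 'i \<Rightarrow> real. (\<Sum>i\<in>I. c m i * x i) = 0}) \<inter> {x. N x = 1} = {x \<in> K. N x = 1}"
      unfolding K_def by auto
    ultimately show ?thesis by simp
  qed
  define S where "S = ?box \<inter> {x \<in> K. N x = 1}"
  have compS: "compact S" unfolding S_def by (intro compact_Int_closed box closed)
  have restrict: "(\<lambda>i. if i \<in> I then x i else 0) \<in> K" if "x \<in> K" for x
    using that unfolding K_def by simp
  have Nscale: "N (\<lambda>i. t * x i) = t\<^sup>2 * N x" for t x
    unfolding N_def by (simp add: power_mult_distrib sum_distrib_left mult_ac)
  have qscale: "q (\<lambda>i. t * x i) = t\<^sup>2 * q x" for t x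
    unfolding q_def by (simp add: power2_eq_square sum_distrib_left mult_ac)
  have Kscale: "(\<lambda>i. t * x i) \<in> K" if "x \<in> K" for t x
  proof -
    have "(\<Sum>i\<in>I. c m i * (t * x i)) = t * (\<Sum>i\<in>I. c m i * x i)" for m
      by (simp add: sum_distrib_left mult.left_commute)
    then show ?thesis using that by (simp add: K_def)
  qed
  have Kadd: "(\<lambda>i. x i + y i) \<in> K" if "x \<in> K" "y \<in> K" for x y
    using that unfolding K_def by (simp add: distrib_left sum.distrib)
  have Nnonneg: "N x \<ge> 0" for x
    unfolding N_def using w by (intro sum_nonneg) (simp add: less_imp_le)
  have Npos: "N x > 0" if "i \<in> I" "x i \<noteq> 0" for x i
    unfolding N_def using that w by (intro sum_pos2[OF fin, of i]) (auto simp: less_imp_le)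
  have norm1: "\<exists>x'\<in>S. N x > 0 \<and> q x = N x * q x'" if x: "x \<in> K" "N x > 0" for x
  proof -
    define x' where "x' = (\<lambda>i. if i \<in> I then (1 / sqrt (N x)) * x i else 0)"
    have "x' \<in> K" unfolding x'_def by (intro restrict Kscale x)
    moreover have N1: "N x' = 1"
    proof -
      have "N x' = N (\<lambda>i. (1 / sqrt (N x)) * x i)" unfolding N_def x'_def by simp
      then show ?thesis unfolding Nscale using x by (simp add: power_divide)
    qed
    moreover have "x' \<in> ?box"
    proof -
      have "\<bar>x' i\<bar> \<le> 1 + 1 / w i" if i: "i \<in> I" for i
      proof -
        have "w i * (x' i)\<^sup>2 \<le> N x'" unfolding N_def
          using i w fin by (intro member_le_sum) (auto simp: less_imp_le)
        then have "(x' i)\<^sup>2 \<le> 1 / w i" using N1 w[OF i] by (simp add: field_simps)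
        moreover have "u \<le> (1 + u)\<^sup>2" if "u > 0" for u :: real
          using that by (simp add: power2_eq_square algebra_simps)
        then have "1 / w i \<le> (1 + 1 / w i)\<^sup>2" using w[OF i] by simp
        ultimately have "(x' i)\<^sup>2 \<le> (1 + 1 / w i)\<^sup>2" by linarith
        then show ?thesis using w[OF i] by (simp add: abs_le_square_iff[symmetric])
      qed
      then have "x' i \<in> {- (1 + 1 / w i) .. 1 + 1 / w i}" if "i \<in> I" for i
        using that by (auto simp only: atLeastAtMost_iff abs_le_iff minus_le_iff)
      moreover have "x' i = 0" if "i \<notin> I" for i using that by (simp add: x'_def)
      ultimately show ?thesis by (simp add: PiE_iff)
    qed
    moreover have "q x = N x * q x'"
    proof -
      have "q x' = q (\<lambda>i. (1 / sqrt (N x)) * x i)" unfolding q_def x'_def by simp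
      then show ?thesis unfolding qscale using x by (simp add: power_divide)
    qed
    ultimately show ?thesis using x unfolding S_def by blast
  qed
  have "z \<in> K" using z by (simp add: K_def)
  moreover have "N z > 0" using Npos z by blast
  ultimately have "S \<noteq> {}" using norm1 by blast
  then obtain x where x: "x \<in> S" "\<And>y. y \<in> S \<Longrightarrow> q x \<le> q y"
    using continuous_attains_inf[OF compS _ qc] by blast
  define e where "e = q x"
  have xK: "x \<in> K" and xN: "N x = 1" using x unfolding S_def by auto
  have ge: "q y \<ge> e * N y" if y: "y \<in> K" for y
  proof (cases "N y > 0")
    case True
    then show ?thesis using norm1[OF y] x(2) unfolding e_def
      by (metis mult.commute mult_left_mono less_imp_le)
  next
    case False
    then have "N y = 0" using Nnonneg[of y] by simp
    then have "y i = 0" if "i \<in> I" for i using Npos[OF that, of y] by force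
    then have "q y = 0" unfolding q_def by simp
    then show ?thesis using \<open>N y = 0\<close> by simp
  qed
  have crit: "Q x y = e * W x y" if y: "y \<in> K" for y
  proof -
    have "0 \<le> 2 * t * (Q x y - e * W x y) + t\<^sup>2 * (q y - e * N y)" for t
    proof -
      have swap: "(\<Sum>i\<in>I. \<Sum>j\<in>I. B i j * x i * y j) = Q x y"
        unfolding Q_def sum_distrib_right
        by (subst sum.swap) (intro sum.cong refl, simp add: sym mult.assoc)
      have "q (\<lambda>i. x i + t * y i)
          = q x + t * (\<Sum>i\<in>I. \<Sum>j\<in>I. B i j * x i * y j) + t * Q x y + t\<^sup>2 * q y"
        unfolding q_def Q_def
        by (simp add: algebra_simps sum.distrib sum_distrib_left power2_eq_square)
      then have 1: "q (\<lambda>i. x i + t * y i) = q x + 2 * t * Q x y + t\<^sup>2 * q y" using swap by simp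
      have 2: "N (\<lambda>i. x i + t * y i) = N x + 2 * t * W x y + t\<^sup>2 * N y"
        unfolding N_def W_def
        by (simp add: power2_sum algebra_simps sum.distrib sum_distrib_left power2_eq_square)
      have "q (\<lambda>i. x i + t * y i) \<ge> e * N (\<lambda>i. x i + t * y i)"
        by (intro ge Kadd Kscale xK y)
      then show ?thesis unfolding 1 2 using xN by (simp add: e_def algebra_simps)
    qed
    from quadratic_nonneg_imp_linear_zero[OF this] show ?thesis by simp
  qed
  show ?thesis
    by (rule that[of x e]) (use xK xN ge crit in \<open>auto simp: K_def N_def q_def Q_def W_def\<close>)
qed

section \<open>The real inner product of a complex Hilbert space\<close>

text \<open>The real part suffices: all coefficients that occur are real, and the form is then symmetric.\<close>

definition ip :: "'h::complex_hilbert \<Rightarrow> 'h \<Rightarrow> real" where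
  "ip x y = Re (cinner x y)"

lemma ip_commute: "ip x y = ip y x"
  unfolding ip_def by (subst cinner_commute) simp

lemma ip_add_left: "ip (x + y) z = ip x z + ip y z"
  by (simp add: ip_def cinner_add_left)

lemma ip_scaleR_left: "ip (r *\<^sub>R x) y = r * ip x y"
proof -
  have "cinner (r *\<^sub>R x) y = complex_of_real r * cinner x y"
    by (metis cinner_scaleC_left scaleC_of_real)
  then show ?thesis by (simp add: ip_def)
qed

lemma ip_add_right: "ip z (x + y) = ip z x + ip z y"
  by (metis ip_commute ip_add_left)

lemma ip_scaleR_right: "ip y (r *\<^sub>R x) = r * ip y x"
  by (metis ip_commute ip_scaleR_left)

lemma ip_self: "ip x x = (norm x)\<^sup>2"
  by (simp add: ip_def cinner_self)

lemma ip_minus_left: "ip (- x) y = - ip x y"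
  using ip_scaleR_left[of "-1" x y] by simp

lemma ip_minus_right: "ip y (- x) = - ip y x"
  using ip_scaleR_right[of y "-1" x] by simp

lemma ip_diff_left: "ip (x - y) z = ip x z - ip y z"
  using ip_add_left[of x "- y" z] by (simp add: ip_minus_left)

lemma ip_diff_right: "ip z (x - y) = ip z x - ip z y"
  using ip_add_right[of z x "- y"] by (simp add: ip_minus_right)

lemma ip_zero_left [simp]: "ip 0 x = 0"
  using ip_scaleR_left[of 0 0 x] by simp

lemma ip_zero_right [simp]: "ip x 0 = 0"
  by (simp add: ip_commute[of x 0])

lemma ip_sum_left: "ip (\<Sum>i\<in>I. f i) x = (\<Sum>i\<in>I. ip (f i) x)"
  by (induction I rule: infinite_finite_induct) (auto simp: ip_add_left)

lemma ip_sum_right: "ip x (\<Sum>i\<in>I. f i) = (\<Sum>i\<in>I. ip x (f i))"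
  by (induction I rule: infinite_finite_induct) (auto simp: ip_add_right)

lemma norm_diff_square: "(norm (x - y))\<^sup>2 = (norm x)\<^sup>2 - 2 * ip x y + (norm (y :: 'h::complex_hilbert))\<^sup>2"
  unfolding ip_self[symmetric] by (simp add: ip_diff_left ip_diff_right ip_commute[of y x])

lemma abs_ip_le: "\<bar>ip x y\<bar> \<le> (norm x)\<^sup>2 + (norm y)\<^sup>2"
proof -
  have "0 \<le> (norm (x - y))\<^sup>2" "0 \<le> (norm (x - (- y)))\<^sup>2" by simp_all
  then have "2 * \<bar>ip x y\<bar> \<le> (norm x)\<^sup>2 + (norm y)\<^sup>2"
    unfolding norm_diff_square by (simp add: ip_minus_right)
  moreover have "0 \<le> (norm x)\<^sup>2 + (norm y)\<^sup>2" by simp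
  ultimately show ?thesis by linarith
qed

lemma norm_sum_weighted_square_le:
  fixes f :: "'i \<Rightarrow> 'h::real_normed_vector"
  assumes "\<And>i. i \<in> I \<Longrightarrow> w i \<ge> 0"
  shows "(norm (\<Sum>i\<in>I. w i *\<^sub>R f i))\<^sup>2 \<le> (\<Sum>i\<in>I. w i) * (\<Sum>i\<in>I. w i * (norm (f i))\<^sup>2)"
proof -
  have "norm (\<Sum>i\<in>I. w i *\<^sub>R f i) \<le> (\<Sum>i\<in>I. sqrt (w i) * (sqrt (w i) * norm (f i)))"
  proof (rule sum_norm_le)
    fix i assume "i \<in> I"
    then show "norm (w i *\<^sub>R f i) \<le> sqrt (w i) * (sqrt (w i) * norm (f i))"
      using assms by (simp flip: mult.assoc)
  qed
  then have "(norm (\<Sum>i\<in>I. w i *\<^sub>R f i))\<^sup>2 \<le> (\<Sum>i\<in>I. sqrt (w i) * (sqrt (w i) * norm (f i)))\<^sup>2"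
    by (intro power_mono) auto
  also have "\<dots> \<le> (\<Sum>i\<in>I. (sqrt (w i))\<^sup>2) * (\<Sum>i\<in>I. (sqrt (w i) * norm (f i))\<^sup>2)"
    by (rule Cauchy_Schwarz_ineq_sum)
  also have "\<dots> = (\<Sum>i\<in>I. w i) * (\<Sum>i\<in>I. w i * (norm (f i))\<^sup>2)"
    using assms by (simp add: power_mult_distrib)
  finally show ?thesis .
qed

text \<open>Gram--Schmidt: finitely many vectors are combinations of finitely many orthonormal ones.\<close>

lemma finite_orthonormal_expansion:
  fixes A :: "'h::complex_hilbert set"
  assumes "finite A"
  shows "\<exists>E. finite E \<and> (\<forall>e\<in>E. \<forall>e'\<in>E. ip e e' = (if e = e' then 1 else 0)) \<and>
           (\<forall>x\<in>A. x = (\<Sum>e\<in>E. ip x e *\<^sub>R e))"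
  using assms
proof (induction A rule: finite_induct)
  case empty
  show ?case by (intro exI[of _ "{}"]) simp
next
  case (insert h A)
  then obtain E where E: "finite E" "\<And>e e'. e \<in> E \<Longrightarrow> e' \<in> E \<Longrightarrow> ip e e' = (if e = e' then 1 else 0)"
    "\<And>x. x \<in> A \<Longrightarrow> x = (\<Sum>e\<in>E. ip x e *\<^sub>R e)" by blast
  define r where "r = h - (\<Sum>e\<in>E. ip h e *\<^sub>R e)"
  show ?case
  proof (cases "r = 0")
    case True
    then show ?thesis using E by (intro exI[of _ E]) (auto simp: r_def)
  next
    case False
    define u where "u = (1 / norm r) *\<^sub>R r"
    have re: "ip r e = 0" if "e \<in> E" for e
    proof -
      have "ip (\<Sum>e'\<in>E. ip h e' *\<^sub>R e') e = (\<Sum>e'\<in>E. if e' = e then ip h e' else 0)"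
        unfolding ip_sum_left using E(2) that by (intro sum.cong) (auto simp: ip_scaleR_left)
      then show ?thesis using that E(1) by (simp add: r_def ip_diff_left)
    qed
    have ue: "ip u e = 0" "ip e u = 0" if "e \<in> E" for e
      using re[OF that] by (simp_all add: u_def ip_scaleR_left ip_commute[of e])
    have uu: "ip u u = 1"
      using False by (simp add: u_def ip_scaleR_left ip_scaleR_right ip_self power2_eq_square)
    then have "u \<notin> E" using ue(1)[of u] by auto
    have xu: "ip x u = 0" if "x \<in> A" for x
    proof -
      have "ip (\<Sum>e\<in>E. ip x e *\<^sub>R e) u = 0"
        unfolding ip_sum_left using ue by (simp add: ip_scaleR_left)
      then show ?thesis using E(3)[OF that] by simp
    qed
    have "r = ip r u *\<^sub>R u"
      using False by (simp add: u_def ip_scaleR_right ip_self power2_eq_square)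
    moreover have "ip h u = ip r u"
    proof -
      have "ip (\<Sum>e\<in>E. ip h e *\<^sub>R e) u = 0"
        unfolding ip_sum_left using ue by (simp add: ip_scaleR_left)
      then show ?thesis by (simp add: r_def ip_diff_left)
    qed
    ultimately have h: "h = ip h u *\<^sub>R u + (\<Sum>e\<in>E. ip h e *\<^sub>R e)"
      by (simp add: r_def)
    show ?thesis
    proof (intro exI[of _ "insert u E"] conjI ballI)
      fix x assume "x \<in> insert h A"
      then show "x = (\<Sum>e\<in>insert u E. ip x e *\<^sub>R e)"
        using h E(1,3) xu \<open>u \<notin> E\<close> by auto
    qed (use E ue uu \<open>u \<notin> E\<close> in auto)
  qed
qed

text \<open>Reduces an inequality between quadratic expressions with real coefficients in finitely many
  vectors to the same inequality for their real coordinates.\<close>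

lemma finite_parseval:
  fixes h :: "'i \<Rightarrow> 'h::complex_hilbert"
  assumes "finite I"
  obtains E where "finite E"
    and "\<And>i j. i \<in> I \<Longrightarrow> j \<in> I \<Longrightarrow> ip (h i) (h j) = (\<Sum>e\<in>E. ip (h i) e * ip (h j) e)"
proof -
  obtain E where E: "finite E" "\<forall>x\<in>h ` I. x = (\<Sum>e\<in>E. ip x e *\<^sub>R e)"
    using finite_orthonormal_expansion[of "h ` I"] assms by blast
  have "ip (h i) (h j) = (\<Sum>e\<in>E. ip (h i) e * ip (h j) e)" if "i \<in> I" "j \<in> I" for i j
  proof -
    have "ip (\<Sum>e\<in>E. ip (h i) e *\<^sub>R e) (h j) = (\<Sum>e\<in>E. ip (h i) e * ip (h j) e)"
      by (simp add: ip_sum_left ip_scaleR_left ip_commute[of "h j"])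
    then show ?thesis using E(2) that by auto
  qed
  then show thesis using that E by blast
qed

lemma unitary_operator_ip: "unitary_operator U \<Longrightarrow> ip (U x) (U y) = ip x y"
  by (simp add: ip_def unitary_operator_def)

lemma unitary_operator_norm: "unitary_operator U \<Longrightarrow> norm (U x) = norm x"
  using unitary_operator_ip[of U x x] by (simp add: ip_self)

lemma unitary_operator_bounded_linear:
  assumes "unitary_operator U"
  shows "bounded_linear U"
proof (rule bounded_linear_intro[of _ 1])
  show "U (r *\<^sub>R x) = r *\<^sub>R U x" for r x
    using assms by (metis scaleC_of_real unitary_operator_def)
  show "U (x + y) = U x + U y" for x y
    using assms by (simp add: unitary_operator_def)
qed (simp add: unitary_operator_norm[OF assms])

section \<open>Alternating maps on lists\<close>

text \<open>Alternation, tested on adjacent entries only. Unlike invariance under all permutations, this is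
  easily checked for a coboundary.\<close>

definition swap_antisym :: "'v list set \<Rightarrow> ('v list \<Rightarrow> 'h::real_vector) \<Rightarrow> bool" where
  "swap_antisym D f \<longleftrightarrow>
     (\<forall>xs u v ys. xs @ u # v # ys \<in> D \<longrightarrow> f (xs @ v # u # ys) = - f (xs @ u # v # ys))"

lemma swap_antisym_move:
  assumes "swap_antisym D f" and perm: "\<And>xs ys. xs \<in> D \<Longrightarrow> mset ys = mset xs \<Longrightarrow> ys \<in> D"
    and "xs @ u # ys @ zs \<in> D"
  shows "f (xs @ u # ys @ zs) = (-1) ^ length ys *\<^sub>R f (xs @ ys @ u # zs)"
  using assms(3)
proof (induction ys arbitrary: xs)
  case (Cons y ys)
  have "(xs @ [y]) @ u # ys @ zs \<in> D"
    by (rule perm[OF Cons.prems]) simp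
  then have "f ((xs @ [y]) @ u # ys @ zs) = (-1) ^ length ys *\<^sub>R f ((xs @ [y]) @ ys @ u # zs)"
    by (rule Cons.IH)
  moreover have "f (xs @ y # u # ys @ zs) = - f (xs @ u # y # ys @ zs)"
    using assms(1) Cons.prems unfolding swap_antisym_def by simp
  ultimately have "- f (xs @ u # y # ys @ zs) = (-1) ^ length ys *\<^sub>R f (xs @ y # ys @ u # zs)"
    by simp
  from arg_cong[OF this, of uminus] show ?case by simp
qed simp

text \<open>Transpositions generate all permutations. To exchange two distant entries, move the first one next
  to the second, swap, and move the second one back; the signs of the two moves cancel.\<close>

lemma swap_antisym_permute:
  assumes f: "swap_antisym D f" and perm: "\<And>xs ys. xs \<in> D \<Longrightarrow> mset ys = mset xs \<Longrightarrow> ys \<in> D"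
    and xs: "xs \<in> D" and p: "p permutes {..<length xs}"
  shows "f (permute_list p xs) = of_int (sign p) *\<^sub>R f xs"
proof -
  have far: "f (permute_list (Transposition.transpose a b) ys) = - f ys"
    if ab: "a < b" "b < length ys" and ys: "ys \<in> D" for a b ys
  proof -
    define A B C where "A = take a ys" and "B = take (b - a - 1) (drop (Suc a) ys)"
      and "C = drop (Suc b) ys"
    have ys_eq: "ys = A @ ys ! a # B @ ys ! b # C"
    proof -
      have "ys = A @ ys ! a # drop (Suc a) ys"
        using ab by (simp add: A_def id_take_nth_drop[symmetric])
      moreover have "drop (Suc a) ys = B @ ys ! b # C"
        using ab id_take_nth_drop[of "b - a - 1" "drop (Suc a) ys"] by (simp add: B_def C_def)
      ultimately show ?thesis by simp
    qed
    have len: "length A = a" "length B = b - a - 1" using ab by (auto simp: A_def B_def)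
    have tr: "Transposition.transpose a b permutes {..<length ys}"
      using ab by (intro permutes_swap_id) auto
    have "permute_list (Transposition.transpose a b) ys = ys[a := ys ! b, b := ys ! a]"
      using ab permute_list_nth[OF tr]
      by (intro nth_equalityI) (auto simp: nth_list_update Transposition.transpose_def)
    also have "\<dots> = (A @ ys ! a # B @ ys ! b # C)[a := ys ! b, b := ys ! a]"
      by (subst ys_eq) (rule refl)
    also have "\<dots> = A @ ys ! b # B @ ys ! a # C"
    proof -
      have ab_len: "a = length A" "b = length A + Suc (length B)" using len ab by auto
      have "(A @ x # B @ y # C)[length A := y, length A + Suc (length B) := x] = A @ y # B @ x # C"
        for x y by (simp add: list_update_append)
      then show ?thesis unfolding ab_len .
    qed
    finally have "permute_list (Transposition.transpose a b) ys = A @ ys ! b # B @ ys ! a # C" .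
    moreover have "f (A @ ys ! b # B @ ys ! a # C) = - f (A @ ys ! a # B @ ys ! b # C)"
    proof -
      let ?u = "ys ! a" and ?v = "ys ! b"
      have D0: "A @ ?u # B @ ?v # C \<in> D" using ys ys_eq by simp
      have D1: "A @ B @ ?u # ?v # C \<in> D" and D2: "A @ ?v # B @ ?u # C \<in> D"
        using perm[OF D0] by simp_all
      have "f (A @ ?u # B @ ?v # C) = (-1) ^ length B *\<^sub>R f (A @ B @ ?u # ?v # C)"
        using swap_antisym_move[OF f perm D0] .
      moreover have "f (A @ ?v # B @ ?u # C) = (-1) ^ length B *\<^sub>R f (A @ B @ ?v # ?u # C)"
        using swap_antisym_move[OF f perm D2] .
      moreover have "f ((A @ B) @ ?v # ?u # C) = - f ((A @ B) @ ?u # ?v # C)"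
        using f[unfolded swap_antisym_def, rule_format, of "A @ B"] D1 by simp
      ultimately show ?thesis by simp
    qed
    ultimately show ?thesis using ys_eq by simp
  qed
  have fin: "finite {..<length xs}" by simp
  from fin p show ?thesis
  proof (induction p rule: permutes_rev_induct)
    case id
    then show ?case by simp
  next
    case (swap a b p)
    let ?t = "Transposition.transpose a b"
    have t: "?t permutes {..<length xs}" using swap by (intro permutes_swap_id) auto
    have D: "permute_list p xs \<in> D"
      using perm[OF xs] swap by simp
    have 1: "permute_list (p \<circ> ?t) xs = permute_list ?t (permute_list p xs)"
      using permute_list_compose[OF t] .
    have 2: "f (permute_list ?t (permute_list p xs)) = - f (permute_list p xs)"
    proof (cases "a < b")
      case True
      then show ?thesis using far[of a b "permute_list p xs"] D swap by simp
    next
      case False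
      then show ?thesis using far[of b a "permute_list p xs"] D swap
        by (simp add: transpose_commute)
    qed
    have 3: "sign (p \<circ> ?t) = - sign p"
      using swap by (subst sign_compose) (auto intro: permutes_imp_permutation simp: sign_swap_id permutation_swap_id)
    show ?case unfolding 1 2 3 using swap by simp
  qed
qed

lemma swap_antisym_if_alternating:
  assumes "\<And>\<sigma> \<pi>. \<sigma> \<in> D \<Longrightarrow> \<pi> permutes {..<length \<sigma>} \<Longrightarrow>
      f (permute_list \<pi> \<sigma>) = of_int (sign \<pi>) *\<^sub>R f \<sigma>"
  shows "swap_antisym D f"
  unfolding swap_antisym_def
proof (intro allI impI)
  fix xs u v ys assume D: "xs @ u # v # ys \<in> D"
  let ?\<sigma> = "xs @ u # v # ys" and ?a = "length xs"
  let ?t = "Transposition.transpose ?a (Suc ?a)"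
  have t: "?t permutes {..<length ?\<sigma>}" by (intro permutes_swap_id) auto
  have "permute_list ?t ?\<sigma> = xs @ v # u # ys"
  proof (rule nth_equalityI)
    fix i assume "i < length (permute_list ?t ?\<sigma>)"
    then have "permute_list ?t ?\<sigma> ! i = ?\<sigma> ! ?t i" using permute_list_nth[OF t] by simp
    also have "\<dots> = (xs @ v # u # ys) ! i"
      by (auto simp: Transposition.transpose_def nth_append nth_Cons')
    finally show "permute_list ?t ?\<sigma> ! i = (xs @ v # u # ys) ! i" .
  qed simp
  then show "f (xs @ v # u # ys) = - f (xs @ u # v # ys)"
    using assms[OF D t] by (simp add: sign_swap_id)
qed

section \<open>The spectral gap of a weighted graph\<close>

text \<open>The vertices and edges of a link, weighted by the number of top simplices that contain them. Then
  \<open>d * f v - (\<Sum>u. B u v / w v * f u)\<close> is the Laplacian, which is self-adjoint with respect to \<open>w\<close>.\<close>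

locale weighted_graph =
  fixes I :: "'i set" and w :: "'i \<Rightarrow> real" and B :: "'i \<Rightarrow> 'i \<Rightarrow> real" and d :: real
  assumes fin: "finite I" and w_pos: "v \<in> I \<Longrightarrow> w v > 0"
    and B_sym: "u \<in> I \<Longrightarrow> v \<in> I \<Longrightarrow> B u v = B v u"
    and B_nonneg: "u \<in> I \<Longrightarrow> v \<in> I \<Longrightarrow> B u v \<ge> 0"
    and degree: "v \<in> I \<Longrightarrow> (\<Sum>u\<in>I. B u v) = d * w v"
    and conn: "u \<in> I \<Longrightarrow> v \<in> I \<Longrightarrow> (u, v) \<in> {(x, y). x \<in> I \<and> y \<in> I \<and> B x y > 0}\<^sup>*"
    and two: "\<exists>u\<in>I. \<exists>v\<in>I. u \<noteq> v"
begin

definition mass :: "('i \<Rightarrow> real) \<Rightarrow> real" where "mass f = (\<Sum>v\<in>I. w v * (f v)\<^sup>2)"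
definition weighted_sum :: "('i \<Rightarrow> real) \<Rightarrow> real" where "weighted_sum f = (\<Sum>v\<in>I. w v * f v)"
definition energy :: "('i \<Rightarrow> real) \<Rightarrow> real" where
  "energy f = d * mass f - (\<Sum>u\<in>I. \<Sum>v\<in>I. B u v * f u * f v)"
definition total :: real where "total = (\<Sum>v\<in>I. w v)"
definition eigenvalue :: "real \<Rightarrow> bool" where
  "eigenvalue c \<longleftrightarrow> (\<exists>f. (\<exists>v\<in>I. f v \<noteq> 0) \<and> (\<forall>v\<in>I. d * f v - (\<Sum>u\<in>I. B u v / w v * f u) = c * f v))"
definition gap :: real where "gap = (LEAST c. 0 < c \<and> eigenvalue c)"

text \<open>The degree condition makes the quadratic form of the Laplacian a sum over the edges; it is the
  Dirichlet form.\<close>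

lemma energy_alt: "energy f = (\<Sum>u\<in>I. \<Sum>v\<in>I. B u v * (f u - f v)\<^sup>2) / 2"
proof -
  have 1: "(\<Sum>u\<in>I. \<Sum>v\<in>I. B u v * (f v)\<^sup>2) = d * mass f"
  proof -
    have "(\<Sum>u\<in>I. \<Sum>v\<in>I. B u v * (f v)\<^sup>2) = (\<Sum>v\<in>I. (\<Sum>u\<in>I. B u v) * (f v)\<^sup>2)"
      by (subst sum.swap) (simp add: sum_distrib_right)
    then show ?thesis by (simp add: degree mass_def sum_distrib_left mult.assoc)
  qed
  have 2: "(\<Sum>u\<in>I. \<Sum>v\<in>I. B u v * (f u)\<^sup>2) = d * mass f"
  proof -
    have "(\<Sum>u\<in>I. \<Sum>v\<in>I. B u v * (f u)\<^sup>2) = (\<Sum>v\<in>I. \<Sum>u\<in>I. B v u * (f u)\<^sup>2)"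
      by (subst sum.swap) (intro sum.cong refl, simp add: B_sym)
    then show ?thesis using 1 by simp
  qed
  have "(\<Sum>u\<in>I. \<Sum>v\<in>I. B u v * (f u - f v)\<^sup>2)
      = (\<Sum>u\<in>I. \<Sum>v\<in>I. B u v * (f u)\<^sup>2) + (\<Sum>u\<in>I. \<Sum>v\<in>I. B u v * (f v)\<^sup>2)
        - 2 * (\<Sum>u\<in>I. \<Sum>v\<in>I. B u v * f u * f v)"
    by (simp add: power2_diff algebra_simps sum.distrib sum_subtractf sum_distrib_left)
  then show ?thesis unfolding 1 2 energy_def by simp
qed

lemma energy_nonneg: "energy f \<ge> 0"
  unfolding energy_alt using B_nonneg by (simp add: sum_nonneg)

lemma energy_le: "energy f \<le> 2 * d * mass f"
proof -
  have "energy f + energy f + 2 * (\<Sum>u\<in>I. \<Sum>v\<in>I. B u v * f u * f v) = 2 * d * mass f"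
    unfolding energy_def by simp
  moreover have "0 \<le> (\<Sum>u\<in>I. \<Sum>v\<in>I. B u v * (f u + f v)\<^sup>2)"
    using B_nonneg by (simp add: sum_nonneg)
  moreover have "(\<Sum>u\<in>I. \<Sum>v\<in>I. B u v * (f u + f v)\<^sup>2)
      = (\<Sum>u\<in>I. \<Sum>v\<in>I. B u v * (f u - f v)\<^sup>2) + 4 * (\<Sum>u\<in>I. \<Sum>v\<in>I. B u v * f u * f v)"
    by (simp add: power2_diff power2_sum algebra_simps sum.distrib sum_subtractf sum_distrib_left)
  ultimately show ?thesis using energy_alt[of f] by simp
qed

lemma mass_pos: "v \<in> I \<Longrightarrow> f v \<noteq> 0 \<Longrightarrow> mass f > 0"
  unfolding mass_def using w_pos by (intro sum_pos2[OF fin, of v]) (auto simp: less_imp_le)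

lemma total_pos: "total > 0"
  unfolding total_def using two w_pos fin by (intro sum_pos) auto

lemma energy_zero_imp_constant:
  assumes "energy f = 0" "u \<in> I" "v \<in> I"
  shows "f u = f v"
proof -
  have nn: "\<forall>u\<in>I. 0 \<le> (\<Sum>v\<in>I. B u v * (f u - f v)\<^sup>2)" using B_nonneg by (simp add: sum_nonneg)
  have "(\<Sum>u\<in>I. \<Sum>v\<in>I. B u v * (f u - f v)\<^sup>2) = 0" using assms energy_alt[of f] by simp
  then have rows: "\<forall>u\<in>I. (\<Sum>v\<in>I. B u v * (f u - f v)\<^sup>2) = 0"
    using sum_nonneg_eq_0_iff[OF fin, of "\<lambda>u. \<Sum>v\<in>I. B u v * (f u - f v)\<^sup>2"] nn by simp
  have "B u v * (f u - f v)\<^sup>2 = 0" if "u \<in> I" "v \<in> I" for u v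
    using sum_nonneg_eq_0_iff[OF fin, of "\<lambda>v. B u v * (f u - f v)\<^sup>2"] B_nonneg rows that by simp
  then have edge: "f x = f y" if "x \<in> I" "y \<in> I" "B x y > 0" for x y using that by fastforce
  from conn[OF assms(2,3)] show ?thesis
    by (induction rule: rtrancl_induct) (auto dest: edge)
qed

text \<open>The constant functions are the kernel of the Laplacian, so its other eigenfunctions have
  mean zero and the smallest positive eigenvalue is the minimum of the Rayleigh quotient on
  the functions of mean zero.\<close>

lemma spectral_gap:
  shows gap_pos: "gap > 0" and gap_le: "gap \<le> 2 * d"
    and gap_mean_zero: "weighted_sum f = 0 \<Longrightarrow> energy f \<ge> gap * mass f"
proof -
  define A where "A i j = (if i = j then d * w i else 0) - B i j" for i j
  have A_form: "(\<Sum>i\<in>I. \<Sum>j\<in>I. A i j * y i * y j) = energy y" for y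
  proof -
    have "(\<Sum>j\<in>I. A i j * y i * y j) = d * (w i * (y i)\<^sup>2) - (\<Sum>j\<in>I. B i j * y i * y j)"
      if "i \<in> I" for i
    proof -
      have "(\<Sum>j\<in>I. (if i = j then d * w i else 0) * y i * y j) = d * (w i * (y i)\<^sup>2)"
        using that fin by (simp add: if_distrib[of "\<lambda>x. x * _"] power2_eq_square cong: if_cong)
      then show ?thesis by (simp add: A_def left_diff_distrib sum_subtractf)
    qed
    then show ?thesis by (simp add: energy_def mass_def sum_subtractf sum_distrib_left)
  qed
  obtain u v where uv: "u \<in> I" "v \<in> I" "u \<noteq> v" using two by blast
  \<comment> \<open>A nonzero function of mean zero, so that there is something to minimise over.\<close>
  define z where "z = (\<lambda>i. if i = u then 1 / w u else if i = v then - (1 / w v) else 0)"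
  have z0: "(\<Sum>i\<in>I. w i * z i) = 0"
  proof -
    have "(\<Sum>i\<in>I. w i * z i) = (\<Sum>i\<in>{u, v}. w i * z i)"
      using uv fin by (intro sum.mono_neutral_right) (auto simp: z_def)
    also have "\<dots> = 0"
      using uv w_pos[OF uv(1)] w_pos[OF uv(2)] by (simp add: z_def)
    finally show ?thesis .
  qed
  have zu: "z u \<noteq> 0" using w_pos[OF uv(1)] by (simp add: z_def)
  obtain x e where x0: "\<forall>m\<in>{()}. (\<Sum>i\<in>I. w i * x i) = 0" and x1: "(\<Sum>i\<in>I. w i * (x i)\<^sup>2) = 1"
    and ge: "\<And>y. (\<forall>m\<in>{()}. (\<Sum>i\<in>I. w i * y i) = 0) \<Longrightarrow>
           (\<Sum>i\<in>I. \<Sum>j\<in>I. A i j * y i * y j) \<ge> e * (\<Sum>i\<in>I. w i * (y i)\<^sup>2)"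
    and crit: "\<And>y. (\<forall>m\<in>{()}. (\<Sum>i\<in>I. w i * y i) = 0) \<Longrightarrow>
           (\<Sum>i\<in>I. (\<Sum>j\<in>I. A i j * x j) * y i) = e * (\<Sum>i\<in>I. w i * x i * y i)"
  proof (rule constrained_minimiser[of I w A "{()}" "\<lambda>_. w" z u])
    show "A i j = A j i" if "i \<in> I" "j \<in> I" for i j using that B_sym by (simp add: A_def)
  qed (use fin w_pos z0 zu uv in auto)
  have Ax: "(\<Sum>j\<in>I. A i j * f j) = d * w i * f i - (\<Sum>j\<in>I. B i j * f j)" if "i \<in> I" for i f
  proof -
    have "(\<Sum>j\<in>I. (if i = j then d * w i else 0) * f j) = d * w i * f i"
      using that fin by (simp add: if_distrib[of "\<lambda>x. x * _"] cong: if_cong)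
    then show ?thesis by (simp add: A_def left_diff_distrib sum_subtractf)
  qed
  have colsum: "(\<Sum>i\<in>I. \<Sum>j\<in>I. A i j * f j) = 0" for f
  proof -
    have "(\<Sum>i\<in>I. \<Sum>j\<in>I. B i j * f j) = (\<Sum>j\<in>I. d * w j * f j)"
      by (subst sum.swap) (simp add: degree flip: sum_distrib_right)
    then show ?thesis by (simp add: Ax sum_subtractf)
  qed
  define s where "s i = (\<Sum>j\<in>I. A i j * x j) - e * w i * x i" for i
  have s0: "(\<Sum>i\<in>I. s i) = 0"
  proof -
    have "(\<Sum>i\<in>I. e * w i * x i) = e * (\<Sum>i\<in>I. w i * x i)" by (simp add: sum_distrib_left mult.assoc)
    then show ?thesis using x0 colsum[of x] by (simp add: s_def sum_subtractf)
  qed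
  have s_eq: "s i = 0" if i: "i \<in> I" for i
  proof -
    \<comment> \<open>The indicator of \<open>i\<close>, corrected to mean zero so that it is an admissible variation.\<close>
    define y where "y = (\<lambda>j. (if j = i then 1 else 0) - w i / total)"
    have lin: "(\<Sum>j\<in>I. f j * y j) = f i - (\<Sum>j\<in>I. f j) * (w i / total)" for f
    proof -
      have "(\<Sum>j\<in>I. f j * (if j = i then 1 else 0)) = f i"
        using i fin by (simp add: if_distrib[of "\<lambda>x. _ * x"] cong: if_cong)
      then show ?thesis unfolding y_def right_diff_distrib sum_subtractf
        by (simp add: sum_distrib_right sum_divide_distrib)
    qed
    have "(\<Sum>j\<in>I. w j * y j) = 0" unfolding lin using total_pos by (simp add: total_def)
    then have "(\<Sum>j\<in>I. s j * y j) = 0" using crit[of y]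
      by (simp add: s_def left_diff_distrib sum_subtractf sum_distrib_left mult.assoc)
    then show ?thesis unfolding lin s0 by simp
  qed
  have x_mass: "mass x = 1" using x1 by (simp add: mass_def)
  have x_nz: "\<exists>v\<in>I. x v \<noteq> 0" using x1 by (metis (no_types, lifting) mult_zero_right power_zero_numeral sum.neutral zero_neq_one)
  have eig: "eigenvalue e"
    unfolding eigenvalue_def
  proof (intro exI conjI ballI)
    fix v assume v: "v \<in> I"
    have "(\<Sum>j\<in>I. B v j * x j) = w v * (d * x v - e * x v)"
      using s_eq[OF v] unfolding s_def Ax[OF v] by (simp add: algebra_simps)
    moreover have "(\<Sum>u\<in>I. B u v / w v * x u) = (\<Sum>j\<in>I. B v j * x j) / w v"
      using v B_sym by (simp add: sum_divide_distrib)
    ultimately show "d * x v - (\<Sum>u\<in>I. B u v / w v * x u) = e * x v"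
      using w_pos[OF v] by simp
  qed (rule x_nz)
  have e_energy: "energy x = e"
  proof -
    have "energy x = (\<Sum>i\<in>I. (\<Sum>j\<in>I. A i j * x j) * x i)"
      unfolding A_form[symmetric] by (simp add: sum_distrib_left sum_distrib_right mult_ac)
    also have "\<dots> = e * mass x"
      using crit[of x] x0 by (simp add: mass_def power2_eq_square mult.assoc)
    finally show ?thesis using x_mass by simp
  qed
  have e_pos: "e > 0"
  proof (rule ccontr)
    assume "\<not> e > 0"
    then have "energy x = 0" using energy_nonneg[of x] e_energy by simp
    then have const: "x i = x u" if "i \<in> I" for i using energy_zero_imp_constant that uv by blast
    then have "(\<Sum>i\<in>I. w i * x i) = total * x u" by (simp add: total_def sum_distrib_right)
    then have "x u = 0" using x0 total_pos by simp
    then show False using const x_nz by auto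
  qed
  have mean0: "energy f \<ge> e * mass f" if "weighted_sum f = 0" for f
    using ge[of f] that by (simp add: A_form weighted_sum_def mass_def)
  have "gap = e"
    unfolding gap_def
  proof (rule Least_equality)
    show "0 < e \<and> eigenvalue e" using e_pos eig by simp
    fix c assume c: "0 < c \<and> eigenvalue c"
    then obtain f v where f: "v \<in> I" "f v \<noteq> 0"
      "\<And>v. v \<in> I \<Longrightarrow> d * f v - (\<Sum>u\<in>I. B u v / w v * f u) = c * f v"
      unfolding eigenvalue_def by blast
    have Af: "(\<Sum>j\<in>I. A i j * f j) = c * w i * f i" if i: "i \<in> I" for i
    proof -
      have "(\<Sum>u\<in>I. B u i / w i * f u) = (\<Sum>j\<in>I. B i j * f j) / w i"
        using i B_sym by (simp add: sum_divide_distrib)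
      then have "d * f i - (\<Sum>j\<in>I. B i j * f j) / w i = c * f i" using f(3)[OF i] by simp
      then have "(\<Sum>j\<in>I. B i j * f j) = w i * (d * f i - c * f i)"
        using w_pos[OF i] by (simp add: field_simps)
      then show ?thesis unfolding Ax[OF i] by (simp add: algebra_simps)
    qed
    have "c * weighted_sum f = 0"
      using colsum[of f] Af by (simp add: weighted_sum_def sum_distrib_left mult.assoc)
    then have "energy f \<ge> e * mass f" using c by (intro mean0) simp
    moreover have "energy f = c * mass f"
    proof -
      have "energy f = (\<Sum>i\<in>I. (\<Sum>j\<in>I. A i j * f j) * f i)"
        unfolding A_form[symmetric] by (simp add: sum_distrib_left sum_distrib_right mult_ac)
      then show ?thesis by (simp add: Af mass_def sum_distrib_left power2_eq_square mult.assoc)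
    qed
    ultimately show "e \<le> c" using mass_pos[of v f, OF f(1,2)] by simp
  qed
  then show "gap > 0" "gap \<le> 2 * d" "weighted_sum f = 0 \<Longrightarrow> energy f \<ge> gap * mass f"
    using e_pos energy_le[of x] e_energy x_mass mean0 by simp_all
qed

text \<open>Subtracting the mean value does not change the energy.\<close>

lemma energy_ge_gap: "energy f \<ge> gap * (mass f - (weighted_sum f)\<^sup>2 / total)"
proof -
  define c where "c = weighted_sum f / total"
  have mean_total: "weighted_sum f = c * total" using total_pos by (simp add: c_def)
  have "weighted_sum (\<lambda>v. f v - c) = 0"
    using mean_total by (simp add: weighted_sum_def total_def right_diff_distrib sum_subtractf sum_distrib_left mult.commute)
  then have "energy (\<lambda>v. f v - c) \<ge> gap * mass (\<lambda>v. f v - c)" by (rule gap_mean_zero)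
  moreover have "energy (\<lambda>v. f v - c) = energy f" by (simp add: energy_alt)
  moreover have "mass (\<lambda>v. f v - c) = mass f - 2 * c * weighted_sum f + c\<^sup>2 * total"
    by (simp add: mass_def weighted_sum_def total_def power2_diff algebra_simps sum.distrib sum_subtractf sum_distrib_left sum_distrib_right)
  moreover have "mass f - 2 * c * weighted_sum f + c\<^sup>2 * total = mass f - (weighted_sum f)\<^sup>2 / total"
    using total_pos by (simp add: c_def power2_eq_square)
  ultimately show ?thesis by simp
qed

text \<open>The inequality for real functions holds for the coordinates of a vector-valued function with
  respect to an orthonormal system spanning its values.\<close>

lemma energy_ge_gap_hilbert:
  fixes \<phi> :: "'i \<Rightarrow> 'h::complex_hilbert"
  shows "d * (\<Sum>v\<in>I. w v * (norm (\<phi> v))\<^sup>2) - (\<Sum>u\<in>I. \<Sum>v\<in>I. B u v * ip (\<phi> u) (\<phi> v))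
    \<ge> gap * ((\<Sum>v\<in>I. w v * (norm (\<phi> v))\<^sup>2) - (norm (\<Sum>v\<in>I. w v *\<^sub>R \<phi> v))\<^sup>2 / total)"
proof -
  obtain E where E: "finite E"
    "\<And>i j. i \<in> I \<Longrightarrow> j \<in> I \<Longrightarrow> ip (\<phi> i) (\<phi> j) = (\<Sum>e\<in>E. ip (\<phi> i) e * ip (\<phi> j) e)"
    using finite_parseval[OF fin] by blast
  define f where "f e v = ip (\<phi> v) e" for e v
  have ip_f: "ip (\<phi> i) (\<phi> j) = (\<Sum>e\<in>E. f e i * f e j)" if "i \<in> I" "j \<in> I" for i j
    using E(2)[OF that] by (simp add: f_def)
  have m: "(\<Sum>v\<in>I. w v * (norm (\<phi> v))\<^sup>2) = (\<Sum>e\<in>E. mass (f e))"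
  proof -
    have "(\<Sum>v\<in>I. w v * (norm (\<phi> v))\<^sup>2) = (\<Sum>v\<in>I. \<Sum>e\<in>E. w v * (f e v)\<^sup>2)"
      by (intro sum.cong refl) (simp only: ip_self[symmetric] ip_f, simp add: sum_distrib_left power2_eq_square)
    also have "\<dots> = (\<Sum>e\<in>E. mass (f e))" unfolding mass_def by (rule sum.swap)
    finally show ?thesis .
  qed
  have double: "(\<Sum>u\<in>I. \<Sum>v\<in>I. b u v * ip (\<phi> u) (\<phi> v)) = (\<Sum>e\<in>E. \<Sum>u\<in>I. \<Sum>v\<in>I. b u v * f e u * f e v)"
    for b :: "'i \<Rightarrow> 'i \<Rightarrow> real"
  proof -
    have "(\<Sum>u\<in>I. \<Sum>v\<in>I. b u v * ip (\<phi> u) (\<phi> v)) = (\<Sum>u\<in>I. \<Sum>v\<in>I. \<Sum>e\<in>E. b u v * f e u * f e v)"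
      by (intro sum.cong refl) (simp add: ip_f sum_distrib_left mult.assoc)
    also have "\<dots> = (\<Sum>u\<in>I. \<Sum>e\<in>E. \<Sum>v\<in>I. b u v * f e u * f e v)"
      by (intro sum.cong refl sum.swap)
    also have "\<dots> = (\<Sum>e\<in>E. \<Sum>u\<in>I. \<Sum>v\<in>I. b u v * f e u * f e v)" by (rule sum.swap)
    finally show ?thesis .
  qed
  have mean: "(norm (\<Sum>v\<in>I. w v *\<^sub>R \<phi> v))\<^sup>2 = (\<Sum>e\<in>E. (weighted_sum (f e))\<^sup>2)"
  proof -
    have "(norm (\<Sum>v\<in>I. w v *\<^sub>R \<phi> v))\<^sup>2 = (\<Sum>u\<in>I. \<Sum>v\<in>I. (w u * w v) * ip (\<phi> u) (\<phi> v))"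
      by (simp add: ip_self[symmetric] ip_sum_left ip_sum_right ip_scaleR_left ip_scaleR_right sum_distrib_left mult_ac)
        (auto intro!: sum.cong simp: ip_commute)
    also have "\<dots> = (\<Sum>e\<in>E. (weighted_sum (f e))\<^sup>2)"
      unfolding double weighted_sum_def power2_eq_square sum_product by (simp add: mult_ac)
    finally show ?thesis .
  qed
  have "(\<Sum>e\<in>E. energy (f e)) \<ge> (\<Sum>e\<in>E. gap * (mass (f e) - (weighted_sum (f e))\<^sup>2 / total))"
    by (intro sum_mono energy_ge_gap)
  then show ?thesis
    unfolding m mean double energy_def
    by (simp add: sum_subtractf sum_distrib_left sum_divide_distrib right_diff_distrib)
qed

end

section \<open>The polynomial of a simplex\<close>

lemma finite_ordered_faces: "finite (ordered_faces j \<gamma>)"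
proof (rule finite_subset)
  show "ordered_faces j \<gamma> \<subseteq> set (subseqs \<gamma>)" unfolding ordered_faces_def by auto
qed simp

lemma poly_face_poly:
  "poly (face_poly k \<gamma> (\<lambda>\<sigma>. [:- S \<sigma>, 1:])) t = face_poly k \<gamma> (\<lambda>\<sigma>. t - S \<sigma> :: real)"
proof -
  have "poly (face_matrix k \<gamma> (\<lambda>\<sigma>. [:- S \<sigma>, 1:]) \<alpha> \<beta>) t = face_matrix k \<gamma> (\<lambda>\<sigma>. t - S \<sigma>) \<alpha> \<beta>" for \<alpha> \<beta>
    by (auto simp: face_matrix_def poly_of_int)
  then show ?thesis
    unfolding face_poly_def set_det_def by (simp add: poly_sum poly_prod poly_of_int)
qed

text \<open>By Lagrange's rule, a minimiser \<open>x\<close> of the quadratic form with coefficients \<open>S\<close> on the closed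
  cochains of norm one satisfies \<open>S x - c x = d\<^sup>* y\<close> with \<open>c\<close> the minimum; together with
  \<open>d x = 0\<close> this says that \<open>(x, y)\<close> is a kernel vector of the face matrix at \<open>c\<close>.\<close>

lemma closed_form_ge_of_face_poly_roots:
  fixes x :: "'v list \<Rightarrow> real"
  assumes roots: "\<And>t. poly (face_poly k \<gamma> (\<lambda>\<sigma>. [:- S \<sigma>, 1:])) t = 0 \<Longrightarrow> t \<ge> \<epsilon>"
    and x: "\<And>\<nu>. \<nu> \<in> ordered_faces (k + 1) \<gamma> \<Longrightarrow>
        (\<Sum>\<sigma> | \<sigma> \<in> ordered_faces k \<gamma> \<and> subseq \<sigma> \<nu>. of_int (incidence \<nu> \<sigma>) * x \<sigma>) = 0"
  shows "(\<Sum>\<sigma>\<in>ordered_faces k \<gamma>. S \<sigma> * (x \<sigma>)\<^sup>2) \<ge> \<epsilon> * (\<Sum>\<sigma>\<in>ordered_faces k \<gamma>. (x \<sigma>)\<^sup>2)"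
proof (cases "\<exists>\<sigma>\<in>ordered_faces k \<gamma>. x \<sigma> \<noteq> 0")
  case False
  then show ?thesis by simp
next
  case True
  let ?F = "ordered_faces k \<gamma>" and ?F' = "ordered_faces (k + 1) \<gamma>"
  have fin: "finite ?F" "finite ?F'" by (rule finite_ordered_faces)+
  have disj: "?F \<inter> ?F' = {}" unfolding ordered_faces_def by auto
  obtain \<sigma>0 where \<sigma>0: "\<sigma>0 \<in> ?F" "x \<sigma>0 \<noteq> 0" using True by blast
  define c where "c \<nu> \<sigma> = (if subseq \<sigma> \<nu> then of_int (incidence \<nu> \<sigma>) else 0 :: real)" for \<nu> \<sigma> :: "'v list"
  have c_sum: "(\<Sum>\<sigma>\<in>?F. c \<nu> \<sigma> * y \<sigma>) = (\<Sum>\<sigma> | \<sigma> \<in> ?F \<and> subseq \<sigma> \<nu>. of_int (incidence \<nu> \<sigma>) * y \<sigma>)" for \<nu> y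
    unfolding c_def using fin
    by (simp add: if_distrib[of "\<lambda>x. x * _"] sum.inter_filter cong: if_cong)
  let ?A = "\<lambda>\<alpha> \<beta>. if \<alpha> = \<beta> then S \<alpha> else 0"
  have A_form: "(\<Sum>i\<in>?F. \<Sum>j\<in>?F. ?A i j * y i * y j) = (\<Sum>i\<in>?F. S i * (y i)\<^sup>2)" for y
    using fin by (intro sum.cong refl) (simp add: if_distrib[of "\<lambda>x. x * _"] power2_eq_square mult.assoc cong: if_cong)
  have A_row: "(\<Sum>j\<in>?F. ?A i j * y j) = S i * y i" if "i \<in> ?F" for i y
    using fin that by (simp add: if_distrib[of "\<lambda>x. x * _"] cong: if_cong)
  obtain z e where z: "\<forall>\<nu>\<in>?F'. (\<Sum>\<sigma>\<in>?F. c \<nu> \<sigma> * z \<sigma>) = 0" and z1: "(\<Sum>\<sigma>\<in>?F. 1 * (z \<sigma>)\<^sup>2) = 1"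
    and ge: "\<And>y. (\<forall>\<nu>\<in>?F'. (\<Sum>\<sigma>\<in>?F. c \<nu> \<sigma> * y \<sigma>) = 0) \<Longrightarrow>
           (\<Sum>i\<in>?F. \<Sum>j\<in>?F. ?A i j * y i * y j) \<ge> e * (\<Sum>i\<in>?F. 1 * (y i)\<^sup>2)"
    and crit: "\<And>y. (\<forall>\<nu>\<in>?F'. (\<Sum>\<sigma>\<in>?F. c \<nu> \<sigma> * y \<sigma>) = 0) \<Longrightarrow>
           (\<Sum>i\<in>?F. (\<Sum>j\<in>?F. ?A i j * z j) * y i) = e * (\<Sum>i\<in>?F. 1 * z i * y i)"
    by (rule constrained_minimiser[of ?F "\<lambda>_. 1" ?A ?F' c x \<sigma>0]) (use fin \<sigma>0 x c_sum in auto)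
  have "\<exists>y. \<forall>i\<in>?F. S i * z i - e * z i = (\<Sum>\<nu>\<in>?F'. y \<nu> * c \<nu> i)"
  proof (rule annihilator_of_common_kernel[OF fin(2,1)])
    fix y assume "\<And>\<nu>. \<nu> \<in> ?F' \<Longrightarrow> (\<Sum>\<sigma>\<in>?F. c \<nu> \<sigma> * y \<sigma>) = 0"
    then show "(\<Sum>i\<in>?F. (S i * z i - e * z i) * y i) = 0"
      using crit[of y] by (simp add: A_row left_diff_distrib sum_subtractf sum_distrib_left mult.assoc cong: sum.cong)
  qed
  then obtain y where y: "\<And>i. i \<in> ?F \<Longrightarrow> S i * z i - e * z i = (\<Sum>\<nu>\<in>?F'. y \<nu> * c \<nu> i)" by blast
  define v where "v \<alpha> = (if \<alpha> \<in> ?F then z \<alpha> else y \<alpha>)" for \<alpha>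
  let ?M = "face_matrix k \<gamma> (\<lambda>\<sigma>. e - S \<sigma>)"
  obtain \<sigma>1 where \<sigma>1: "\<sigma>1 \<in> ?F" "z \<sigma>1 \<noteq> 0" using z1 by (metis (no_types, lifting) mult_zero_right power_zero_numeral sum.neutral zero_neq_one)
  have "set_det (?F \<union> ?F') ?M = 0"
  proof (rule set_det_eq_0_if_kernel[of _ \<sigma>1 v])
    fix \<alpha> assume \<alpha>: "\<alpha> \<in> ?F \<union> ?F'"
    have split: "(\<Sum>\<beta>\<in>?F \<union> ?F'. ?M \<alpha> \<beta> * v \<beta>) = (\<Sum>\<beta>\<in>?F. ?M \<alpha> \<beta> * z \<beta>) + (\<Sum>\<beta>\<in>?F'. ?M \<alpha> \<beta> * y \<beta>)"
    proof -
      have "(\<Sum>\<beta>\<in>?F'. ?M \<alpha> \<beta> * v \<beta>) = (\<Sum>\<beta>\<in>?F'. ?M \<alpha> \<beta> * y \<beta>)"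
        using disj by (intro sum.cong) (auto simp: v_def)
      then show ?thesis using fin disj by (simp add: sum.union_disjoint v_def)
    qed
    show "(\<Sum>\<beta>\<in>?F \<union> ?F'. ?M \<alpha> \<beta> * v \<beta>) = 0"
    proof (cases "\<alpha> \<in> ?F")
      case True
      then have nF': "\<alpha> \<notin> ?F'" using disj by auto
      have "(\<Sum>\<beta>\<in>?F. ?M \<alpha> \<beta> * z \<beta>) = (\<Sum>\<beta>\<in>?F. if \<beta> = \<alpha> then (e - S \<alpha>) * z \<alpha> else 0)"
      proof (rule sum.cong)
        fix \<beta> assume b: "\<beta> \<in> ?F"
        then have "\<beta> \<notin> ?F'" using disj by auto
        then show "?M \<alpha> \<beta> * z \<beta> = (if \<beta> = \<alpha> then (e - S \<alpha>) * z \<alpha> else 0)"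
          using True nF' by (simp add: face_matrix_def)
      qed simp
      also have "\<dots> = (e - S \<alpha>) * z \<alpha>" using True fin by simp
      finally have 1: "(\<Sum>\<beta>\<in>?F. ?M \<alpha> \<beta> * z \<beta>) = (e - S \<alpha>) * z \<alpha>" .
      have "(\<Sum>\<beta>\<in>?F'. ?M \<alpha> \<beta> * y \<beta>) = (\<Sum>\<nu>\<in>?F'. y \<nu> * c \<nu> \<alpha>)"
      proof (rule sum.cong)
        fix \<beta> assume b: "\<beta> \<in> ?F'"
        then have "\<beta> \<notin> ?F" using disj by auto
        then show "?M \<alpha> \<beta> * y \<beta> = y \<beta> * c \<beta> \<alpha>"
          using True nF' b by (auto simp: face_matrix_def c_def)
      qed simp
      then show ?thesis unfolding split 1 using y[OF True] by (simp add: algebra_simps)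
    next
      case False
      then have F': "\<alpha> \<in> ?F'" using \<alpha> by simp
      have "(\<Sum>\<beta>\<in>?F. ?M \<alpha> \<beta> * z \<beta>) = (\<Sum>\<beta>\<in>?F. c \<alpha> \<beta> * z \<beta>)"
        by (intro sum.cong refl) (use False F' in \<open>auto simp: face_matrix_def c_def\<close>)
      moreover have "(\<Sum>\<beta>\<in>?F'. ?M \<alpha> \<beta> * y \<beta>) = 0"
        by (intro sum.neutral ballI) (use False disj in \<open>auto simp: face_matrix_def\<close>)
      ultimately show ?thesis unfolding split using z F' by simp
    qed
  qed (use fin \<sigma>1 in \<open>auto simp: v_def\<close>)
  then have "poly (face_poly k \<gamma> (\<lambda>\<sigma>. [:- S \<sigma>, 1:])) e = 0"
    by (subst poly_face_poly) (simp only: face_poly_def)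
  then have "\<epsilon> \<le> e" by (rule roots)
  then have "\<epsilon> * (\<Sum>\<sigma>\<in>?F. (x \<sigma>)\<^sup>2) \<le> e * (\<Sum>\<sigma>\<in>?F. (x \<sigma>)\<^sup>2)"
    by (intro mult_right_mono sum_nonneg) auto
  also have "\<dots> \<le> (\<Sum>\<sigma>\<in>?F. S \<sigma> * (x \<sigma>)\<^sup>2)"
    using ge[of x] x c_sum by (simp add: A_form)
  finally show ?thesis .
qed

lemma closed_form_ge_of_face_poly_roots_hilbert:
  fixes h :: "'v list \<Rightarrow> 'h::complex_hilbert"
  assumes roots: "\<And>t. poly (face_poly k \<gamma> (\<lambda>\<sigma>. [:- S \<sigma>, 1:])) t = 0 \<Longrightarrow> t \<ge> \<epsilon>"
    and h: "\<And>\<nu>. \<nu> \<in> ordered_faces (k + 1) \<gamma> \<Longrightarrow>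
        (\<Sum>\<sigma> | \<sigma> \<in> ordered_faces k \<gamma> \<and> subseq \<sigma> \<nu>. of_int (incidence \<nu> \<sigma>) *\<^sub>R h \<sigma>) = 0"
  shows "(\<Sum>\<sigma>\<in>ordered_faces k \<gamma>. (S \<sigma> - \<epsilon>) * (norm (h \<sigma>))\<^sup>2) \<ge> 0"
proof -
  let ?F = "ordered_faces k \<gamma>"
  obtain E where E: "finite E"
    "\<And>i j. i \<in> ?F \<Longrightarrow> j \<in> ?F \<Longrightarrow> ip (h i) (h j) = (\<Sum>e\<in>E. ip (h i) e * ip (h j) e)"
    using finite_parseval[OF finite_ordered_faces] by blast
  have "(\<Sum>\<sigma>\<in>?F. (S \<sigma> - \<epsilon>) * (norm (h \<sigma>))\<^sup>2) = (\<Sum>\<sigma>\<in>?F. \<Sum>e\<in>E. (S \<sigma> - \<epsilon>) * (ip (h \<sigma>) e)\<^sup>2)"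
    by (intro sum.cong refl) (simp only: ip_self[symmetric] E(2), simp add: sum_distrib_left power2_eq_square)
  also have "\<dots> = (\<Sum>e\<in>E. \<Sum>\<sigma>\<in>?F. (S \<sigma> - \<epsilon>) * (ip (h \<sigma>) e)\<^sup>2)" by (rule sum.swap)
  also have "\<dots> \<ge> 0"
  proof (rule sum_nonneg)
    fix e assume "e \<in> E"
    have "\<epsilon> * (\<Sum>\<sigma>\<in>?F. (ip (h \<sigma>) e)\<^sup>2) \<le> (\<Sum>\<sigma>\<in>?F. S \<sigma> * (ip (h \<sigma>) e)\<^sup>2)"
    proof (rule closed_form_ge_of_face_poly_roots[OF roots])
      fix \<nu> assume "\<nu> \<in> ordered_faces (k + 1) \<gamma>"
      from arg_cong[OF h[OF this], of "\<lambda>x. ip x e"]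
      show "(\<Sum>\<sigma> | \<sigma> \<in> ?F \<and> subseq \<sigma> \<nu>. of_int (incidence \<nu> \<sigma>) * ip (h \<sigma>) e) = 0"
        by (simp add: ip_sum_left ip_scaleR_left)
    qed
    then show "(\<Sum>\<sigma>\<in>?F. (S \<sigma> - \<epsilon>) * (ip (h \<sigma>) e)\<^sup>2) \<ge> 0"
      by (simp add: left_diff_distrib sum_subtractf sum_distrib_left)
  qed
  finally show ?thesis .
qed

section \<open>Simplicial complexes and their links\<close>

definition insert_nth :: "nat \<Rightarrow> 'v \<Rightarrow> 'v list \<Rightarrow> 'v list" where
  "insert_nth i v \<tau> = take i \<tau> @ v # drop i \<tau>"

lemma set_insert_nth [simp]: "set (insert_nth i v \<tau>) = insert v (set \<tau>)"
  unfolding insert_nth_def by (metis Un_insert_right append_take_drop_id list.simps(15) set_append)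

lemma length_insert_nth [simp]: "length (insert_nth i v \<tau>) = Suc (length \<tau>)"
  unfolding insert_nth_def by simp

lemma distinct_insert_nth [simp]: "distinct (insert_nth i v \<tau>) \<longleftrightarrow> v \<notin> set \<tau> \<and> distinct \<tau>"
proof -
  have move: "mset (xs @ v # ys) = mset (v # xs @ ys)" for xs ys :: "'a list" by simp
  have "mset (insert_nth i v \<tau>) = mset (v # take i \<tau> @ drop i \<tau>)"
    unfolding insert_nth_def by (rule move)
  then have "distinct (insert_nth i v \<tau>) \<longleftrightarrow> distinct (v # take i \<tau> @ drop i \<tau>)"
    by (rule mset_eq_imp_distinct_iff)
  then show ?thesis by simp
qed

lemma delete_insert_nth: "i \<le> length \<tau> \<Longrightarrow> delete_nth i (insert_nth i v \<tau>) = \<tau>"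
  by (simp add: delete_nth_def insert_nth_def)

lemma insert_delete_nth: "i < length \<sigma> \<Longrightarrow> insert_nth i (\<sigma> ! i) (delete_nth i \<sigma>) = \<sigma>"
  by (simp add: delete_nth_def insert_nth_def id_take_nth_drop[symmetric])

lemma length_delete_nth: "i < length \<sigma> \<Longrightarrow> length (delete_nth i \<sigma>) = length \<sigma> - 1"
  by (simp add: delete_nth_def)

lemma map_delete_nth: "map f (delete_nth i \<sigma>) = delete_nth i (map f \<sigma>)"
  by (simp add: delete_nth_def take_map drop_map)

lemma map_insert_nth: "map f (insert_nth i v \<tau>) = insert_nth i (f v) (map f \<tau>)"
  by (simp add: insert_nth_def take_map drop_map)

lemma insert_nth_length: "insert_nth (length \<tau>) v \<tau> = \<tau> @ [v]"
  by (simp add: insert_nth_def)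

lemma inj_insert_nth: "insert_nth i u \<tau> = insert_nth i v \<tau> \<Longrightarrow> u = v"
  by (simp add: insert_nth_def)

lemma top_count_cong: "set \<sigma> = set \<sigma>' \<Longrightarrow> top_count X n \<sigma> = top_count X n \<sigma>'"
  by (simp add: top_count_def)

text \<open>The vertices of the link of \<open>\<tau>\<close>.\<close>

definition ext_verts :: "'v set set \<Rightarrow> 'v list \<Rightarrow> 'v set" where
  "ext_verts X \<tau> = {v. v \<notin> set \<tau> \<and> insert v (set \<tau>) \<in> X}"

lemma ext_verts_cong: "set \<sigma> = set \<sigma>' \<Longrightarrow> ext_verts X \<sigma> = ext_verts X \<sigma>'"
  by (simp add: ext_verts_def)

locale pure_complex =
  fixes X :: "'v set set" and n :: nat
  assumes cx: "abstract_complex X" and lf: "locally_finite_complex X"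
    and dim: "has_dimension X n" and pure: "\<forall>s\<in>X. \<exists>t\<in>X. s \<subseteq> t \<and> card t = n + 1"
begin

abbreviation weight :: "'v list \<Rightarrow> real" where "weight \<sigma> \<equiv> real (top_count X n \<sigma>)"

abbreviation ext :: "'v list \<Rightarrow> 'v set" where "ext \<equiv> ext_verts X"

lemma subset_simplex: "s \<in> X \<Longrightarrow> t \<subseteq> s \<Longrightarrow> t \<noteq> {} \<Longrightarrow> t \<in> X"
  using cx unfolding abstract_complex_def by blast

lemma simplex_finite: "s \<in> X \<Longrightarrow> finite s"
  using cx unfolding abstract_complex_def by blast

lemma simplex_dim: "\<sigma> \<in> ordered_simplices X j \<Longrightarrow> j \<le> n"
  using dim unfolding ordered_simplices_def has_dimension_def
  by (metis (mono_tags, lifting) add_le_cancel_right distinct_card mem_Collect_eq)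

lemma delete_nth_simplex:
  assumes "\<sigma> \<in> ordered_simplices X (Suc j)" "i \<le> Suc j"
  shows "delete_nth i \<sigma> \<in> ordered_simplices X j"
proof -
  have \<sigma>: "length \<sigma> = Suc (Suc j)" "distinct \<sigma>" "set \<sigma> \<in> X"
    using assms(1) by (auto simp: ordered_simplices_def)
  let ?\<tau> = "delete_nth i \<sigma>"
  have ins: "insert_nth i (\<sigma> ! i) ?\<tau> = \<sigma>" using \<sigma> assms(2) by (intro insert_delete_nth) simp
  have "distinct ?\<tau>" using ins \<sigma>(2) distinct_insert_nth[of i "\<sigma> ! i" ?\<tau>] by simp
  moreover have len: "length ?\<tau> = Suc j" using \<sigma> assms(2) by (simp add: length_delete_nth)
  moreover have "set ?\<tau> \<in> X"
  proof (rule subset_simplex[OF \<sigma>(3)])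
    show "set ?\<tau> \<subseteq> set \<sigma>" using ins set_insert_nth[of i "\<sigma> ! i" ?\<tau>] by auto
    show "set ?\<tau> \<noteq> {}" using len by auto
  qed
  ultimately show ?thesis by (simp add: ordered_simplices_def)
qed

lemma insert_nth_simplex:
  assumes "\<tau> \<in> ordered_simplices X j" "v \<in> ext \<tau>"
  shows "insert_nth i v \<tau> \<in> ordered_simplices X (Suc j)"
  using assms by (simp add: ordered_simplices_def ext_verts_def)

lemma append_simplex:
  assumes "\<tau> \<in> ordered_simplices X j" "v \<in> ext \<tau>"
  shows "\<tau> @ [v] \<in> ordered_simplices X (Suc j)"
  using insert_nth_simplex[OF assms, of "length \<tau>"] by (simp add: insert_nth_length)

lemma delete_nth_fibre:
  assumes "\<tau> \<in> ordered_simplices X j" "i \<le> Suc j"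
  shows "{\<sigma> \<in> ordered_simplices X (Suc j). delete_nth i \<sigma> = \<tau>} = (\<lambda>v. insert_nth i v \<tau>) ` ext \<tau>"
proof (intro equalityI subsetI)
  fix \<sigma> assume "\<sigma> \<in> {\<sigma> \<in> ordered_simplices X (Suc j). delete_nth i \<sigma> = \<tau>}"
  then have \<sigma>: "length \<sigma> = Suc (Suc j)" "distinct \<sigma>" "set \<sigma> \<in> X" "delete_nth i \<sigma> = \<tau>"
    by (auto simp: ordered_simplices_def)
  then have ins: "insert_nth i (\<sigma> ! i) \<tau> = \<sigma>"
    using insert_delete_nth[of i \<sigma>] assms(2) by simp
  then have "\<sigma> ! i \<in> ext \<tau>"
    using \<sigma> set_insert_nth[of i "\<sigma> ! i" \<tau>] distinct_insert_nth[of i "\<sigma> ! i" \<tau>] by (simp add: ext_verts_def)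
  then show "\<sigma> \<in> (\<lambda>v. insert_nth i v \<tau>) ` ext \<tau>" using ins by (metis imageI)
next
  fix \<sigma> assume "\<sigma> \<in> (\<lambda>v. insert_nth i v \<tau>) ` ext \<tau>"
  then show "\<sigma> \<in> {\<sigma> \<in> ordered_simplices X (Suc j). delete_nth i \<sigma> = \<tau>}"
    using assms insert_nth_simplex[OF assms(1)]
    by (auto simp: ordered_simplices_def intro!: delete_insert_nth)
qed

lemma finite_simplices_meeting:
  assumes "\<tau> \<in> ordered_simplices X j"
  shows "finite {s \<in> X. set \<tau> \<subseteq> s}"
proof -
  have "hd \<tau> \<in> set \<tau>" "set \<tau> \<in> X" using assms by (auto simp: ordered_simplices_def intro!: hd_in_set)
  then have "finite {s \<in> X. hd \<tau> \<in> s}" using lf unfolding locally_finite_complex_def by blast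
  then show ?thesis by (rule rev_finite_subset) (use \<open>hd \<tau> \<in> set \<tau>\<close> in auto)
qed

lemma finite_ext: "\<tau> \<in> ordered_simplices X j \<Longrightarrow> finite (ext \<tau>)"
proof -
  assume \<tau>: "\<tau> \<in> ordered_simplices X j"
  have "finite (\<Union>{s \<in> X. set \<tau> \<subseteq> s})"
    using finite_simplices_meeting[OF \<tau>] simplex_finite by auto
  then show ?thesis by (rule rev_finite_subset) (auto simp: ext_verts_def)
qed

lemma weight_pos: "\<tau> \<in> ordered_simplices X j \<Longrightarrow> weight \<tau> > 0"
proof -
  assume \<tau>: "\<tau> \<in> ordered_simplices X j"
  then have "set \<tau> \<in> X" by (simp add: ordered_simplices_def)
  then have "{s \<in> X. card s = n + 1 \<and> set \<tau> \<subseteq> s} \<noteq> {}" using pure by blast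
  moreover have "finite {s \<in> X. card s = n + 1 \<and> set \<tau> \<subseteq> s}"
    by (rule finite_subset[OF _ finite_simplices_meeting[OF \<tau>]]) auto
  ultimately show ?thesis by (simp add: top_count_def card_gt_0_iff)
qed

text \<open>Each top simplex containing \<open>\<tau>\<close> has \<open>n - j\<close> vertices outside \<open>\<tau>\<close>.\<close>

lemma sum_weight_ext:
  assumes \<tau>: "\<tau> \<in> ordered_simplices X j"
  shows "(\<Sum>v\<in>ext \<tau>. weight (\<tau> @ [v])) = (real n - real j) * weight \<tau>"
proof -
  define Top where "Top = {s \<in> X. card s = n + 1 \<and> set \<tau> \<subseteq> s}"
  have fin: "finite Top" unfolding Top_def
    by (rule finite_subset[OF _ finite_simplices_meeting[OF \<tau>]]) auto
  have card_\<tau>: "card (set \<tau>) = j + 1" using \<tau> by (simp add: ordered_simplices_def distinct_card)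
  have "weight (\<tau> @ [v]) = (\<Sum>s\<in>Top. if v \<in> s then 1 else 0)" for v
  proof -
    have "{s \<in> X. card s = n + 1 \<and> set (\<tau> @ [v]) \<subseteq> s} = {s \<in> Top. v \<in> s}" by (auto simp: Top_def)
    then show ?thesis using fin by (simp add: top_count_def sum.If_cases Int_def)
  qed
  then have "(\<Sum>v\<in>ext \<tau>. weight (\<tau> @ [v])) = (\<Sum>s\<in>Top. \<Sum>v\<in>ext \<tau>. if v \<in> s then 1 else 0)"
    by (simp add: sum.swap[of _ Top])
  also have "\<dots> = (\<Sum>s\<in>Top. real n - real j)"
  proof (rule sum.cong)
    fix s assume s: "s \<in> Top"
    have "ext \<tau> \<inter> {v. v \<in> s} = s - set \<tau>"
      using s subset_simplex by (fastforce simp: Top_def ext_verts_def)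
    moreover have "card (s - set \<tau>) = (n + 1) - (j + 1)"
      using s card_\<tau> by (subst card_Diff_subset) (auto simp: Top_def)
    ultimately show "(\<Sum>v\<in>ext \<tau>. if v \<in> s then 1 else 0) = real n - real j"
      using finite_ext[OF \<tau>] simplex_dim[OF \<tau>] by (simp add: sum.If_cases of_nat_diff)
  qed simp
  also have "\<dots> = (real n - real j) * weight \<tau>" by (simp add: top_count_def Top_def)
  finally show ?thesis .
qed

lemma Union_link: "\<tau> \<in> ordered_simplices X j \<Longrightarrow> \<Union>(link X \<tau>) = ext \<tau>"
proof (intro equalityI subsetI)
  fix v assume \<tau>: "\<tau> \<in> ordered_simplices X j" and "v \<in> \<Union>(link X \<tau>)"
  then obtain \<eta> where \<eta>: "v \<in> \<eta>" "\<eta> \<inter> set \<tau> = {}" "set \<tau> \<union> \<eta> \<in> X" by (auto simp: link_def)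
  then show "v \<in> ext \<tau>"
    using subset_simplex[OF \<eta>(3), of "insert v (set \<tau>)"] by (auto simp: ext_verts_def)
next
  fix v assume \<tau>: "\<tau> \<in> ordered_simplices X j" and v: "v \<in> ext \<tau>"
  then have "{v} \<in> X" using subset_simplex[of "insert v (set \<tau>)" "{v}"] by (auto simp: ext_verts_def)
  then have "{v} \<in> link X \<tau>" using v by (auto simp: link_def ext_verts_def)
  then show "v \<in> \<Union>(link X \<tau>)" by blast
qed

lemma edge_link:
  assumes "\<tau> \<in> ordered_simplices X j" "u \<noteq> v" "v \<in> ext \<tau>"
  shows "{u, v} \<in> link X \<tau> \<longleftrightarrow> u \<in> ext (\<tau> @ [v])"
proof -
  have "{u, v} \<in> X" if "insert u (insert v (set \<tau>)) \<in> X"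
    using subset_simplex[OF that, of "{u, v}"] by auto
  then show ?thesis
    using assms by (auto simp: link_def ext_verts_def insert_commute Un_insert_right)
qed

lemma ext_append_subset: "\<tau> \<in> ordered_simplices X j \<Longrightarrow> ext (\<tau> @ [v]) \<subseteq> ext \<tau>"
proof
  fix u assume "u \<in> ext (\<tau> @ [v])"
  then have u: "u \<notin> set \<tau>" "insert u (insert v (set \<tau>)) \<in> X" by (simp_all add: ext_verts_def)
  have "insert u (set \<tau>) \<in> X" by (rule subset_simplex[OF u(2)]) auto
  then show "u \<in> ext \<tau>" using u(1) by (simp add: ext_verts_def)
qed

lemma link_laplacian_alt:
  assumes "\<tau> \<in> ordered_simplices X j" "v \<in> ext \<tau>"
  shows "link_laplacian X n k \<tau> f v = (real n - real k) * f v -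
     (\<Sum>u\<in>ext (\<tau> @ [v]). weight (\<tau> @ [u, v]) / weight (\<tau> @ [v]) * f u)"
proof -
  have "{u. u \<noteq> v \<and> {u, v} \<in> link X \<tau>} = ext (\<tau> @ [v])"
    using edge_link[OF assms(1) _ assms(2)] by (auto simp: ext_verts_def)
  then show ?thesis by (simp add: link_laplacian_def)
qed

text \<open>Extended by zero, so that adjacency in the link is positivity of the weight.\<close>

definition edge_weight :: "'v list \<Rightarrow> 'v \<Rightarrow> 'v \<Rightarrow> real" where
  "edge_weight \<tau> u v = (if u \<in> ext (\<tau> @ [v]) then weight (\<tau> @ [u, v]) else 0)"

lemma sum_edge_weight:
  assumes "\<tau> \<in> ordered_simplices X j"
  shows "(\<Sum>u\<in>ext \<tau>. edge_weight \<tau> u v * f u) = (\<Sum>u\<in>ext (\<tau> @ [v]). weight (\<tau> @ [u, v]) * f u)"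
proof (rule sum.mono_neutral_cong_right)
  show "finite (ext \<tau>)" by (rule finite_ext[OF assms])
  show "ext (\<tau> @ [v]) \<subseteq> ext \<tau>" by (rule ext_append_subset[OF assms])
qed (simp_all add: edge_weight_def)

text \<open>The degree condition counts the top simplices around \<open>\<tau>v\<close>, one dimension higher than \<open>\<tau>\<close>. There are
  two vertices because a top simplex containing \<open>\<tau>\<close> has at least two more.\<close>

lemma weighted_link:
  assumes \<tau>: "\<tau> \<in> ordered_simplices X j" and j: "j + 1 < n"
    and conn: "connected_complex (link X \<tau>)"
  shows "weighted_graph (ext \<tau>) (\<lambda>v. weight (\<tau> @ [v])) (edge_weight \<tau>) (real n - real (j + 1))"
proof (rule weighted_graph.intro)
  show "finite (ext \<tau>)" by (rule finite_ext[OF \<tau>])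
  show "weight (\<tau> @ [v]) > 0" if "v \<in> ext \<tau>" for v using weight_pos[OF append_simplex[OF \<tau> that]] .
  show "edge_weight \<tau> u v = edge_weight \<tau> v u" if "u \<in> ext \<tau>" "v \<in> ext \<tau>" for u v
    using that top_count_cong[of "\<tau> @ [u, v]" "\<tau> @ [v, u]" X n]
    by (auto simp: edge_weight_def ext_verts_def insert_commute)
  show "edge_weight \<tau> u v \<ge> 0" for u v by (simp add: edge_weight_def)
  show "(\<Sum>u\<in>ext \<tau>. edge_weight \<tau> u v) = (real n - real (j + 1)) * weight (\<tau> @ [v])" if "v \<in> ext \<tau>" for v
  proof -
    have "(\<Sum>u\<in>ext \<tau>. edge_weight \<tau> u v) = (\<Sum>u\<in>ext (\<tau> @ [v]). weight (\<tau> @ [u, v]))"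
      using sum_edge_weight[OF \<tau>, of v "\<lambda>_. 1"] by simp
    also have "\<dots> = (\<Sum>u\<in>ext (\<tau> @ [v]). weight ((\<tau> @ [v]) @ [u]))"
      by (intro sum.cong refl arg_cong[of _ _ real] top_count_cong) auto
    also have "\<dots> = (real n - real (j + 1)) * weight (\<tau> @ [v])"
      using sum_weight_ext[OF append_simplex[OF \<tau> that]] by simp
    finally show ?thesis .
  qed
  show "\<exists>u\<in>ext \<tau>. \<exists>v\<in>ext \<tau>. u \<noteq> v"
  proof -
    obtain s where s: "s \<in> X" "set \<tau> \<subseteq> s" "card s = n + 1"
      using pure \<tau> by (auto simp: ordered_simplices_def)
    have "card (s - set \<tau>) = (n + 1) - (j + 1)"
      using s \<tau> by (subst card_Diff_subset) (auto simp: ordered_simplices_def distinct_card)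
    then have "\<not> card (s - set \<tau>) \<le> Suc 0" using j by simp
    moreover have "finite (s - set \<tau>)" using simplex_finite[OF s(1)] by simp
    ultimately obtain u v where "u \<in> s - set \<tau>" "v \<in> s - set \<tau>" "u \<noteq> v"
      using card_le_Suc0_iff_eq by blast
    moreover have "s - set \<tau> \<subseteq> ext \<tau>"
      using subset_simplex[OF s(1)] s(2) by (auto simp: ext_verts_def)
    ultimately show ?thesis by blast
  qed
  fix u v assume uv: "u \<in> ext \<tau>" "v \<in> ext \<tau>"
  let ?E = "{(x, y). x \<in> ext \<tau> \<and> y \<in> ext \<tau> \<and> edge_weight \<tau> x y > 0}"
  have "(u, v) \<in> {(x, y). {x, y} \<in> link X \<tau>}\<^sup>*"
    using conn uv unfolding connected_complex_def Union_link[OF \<tau>] by blast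
  then show "(u, v) \<in> ?E\<^sup>*"
  proof (induction rule: rtrancl_induct)
    case (step x y)
    then have e: "{x, y} \<in> link X \<tau>" by simp
    then have xy: "x \<in> ext \<tau>" "y \<in> ext \<tau>" using Union_link[OF \<tau>] by blast+
    show ?case
    proof (cases "x = y")
      case False
      have "x \<in> ext (\<tau> @ [y])" using edge_link[OF \<tau> False xy(2)] e by simp
      moreover have "weight (\<tau> @ [x, y]) > 0"
        using weight_pos[OF append_simplex[OF append_simplex[OF \<tau> xy(2)] \<open>x \<in> ext (\<tau> @ [y])\<close>]]
          top_count_cong[of "\<tau> @ [x, y]" "(\<tau> @ [y]) @ [x]" X n] by (simp add: insert_commute)
      ultimately have "(x, y) \<in> ?E" using xy by (simp add: edge_weight_def)
      then show ?thesis using step.IH by (rule rtrancl_into_rtrancl[rotated])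
    qed (use step in simp)
  qed simp
qed

lemma lambda_min_eq_gap:
  assumes \<tau>: "\<tau> \<in> ordered_simplices X j" and j: "j + 1 < n"
    and conn: "connected_complex (link X \<tau>)"
  shows "lambda_min X n (j + 1) \<tau>
    = weighted_graph.gap (ext \<tau>) (\<lambda>v. weight (\<tau> @ [v])) (edge_weight \<tau>) (real n - real (j + 1))"
proof -
  interpret W: weighted_graph "ext \<tau>" "\<lambda>v. weight (\<tau> @ [v])" "edge_weight \<tau>" "real n - real (j + 1)"
    by (rule weighted_link[OF \<tau> j conn])
  have lap: "link_laplacian X n (j + 1) \<tau> f v
      = (real n - real (j + 1)) * f v - (\<Sum>u\<in>ext \<tau>. edge_weight \<tau> u v / weight (\<tau> @ [v]) * f u)"
    if "v \<in> ext \<tau>" for f v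
  proof -
    have "(\<Sum>u\<in>ext \<tau>. edge_weight \<tau> u v / weight (\<tau> @ [v]) * f u)
        = (\<Sum>u\<in>ext \<tau>. edge_weight \<tau> u v * (f u / weight (\<tau> @ [v])))"
      by (intro sum.cong refl) simp
    also have "\<dots> = (\<Sum>u\<in>ext (\<tau> @ [v]). weight (\<tau> @ [u, v]) * (f u / weight (\<tau> @ [v])))"
      by (rule sum_edge_weight[OF \<tau>])
    also have "\<dots> = (\<Sum>u\<in>ext (\<tau> @ [v]). weight (\<tau> @ [u, v]) / weight (\<tau> @ [v]) * f u)"
      by (intro sum.cong refl) simp
    finally show ?thesis using link_laplacian_alt[OF \<tau> that, of "j + 1" f] by argo
  qed
  have "(\<forall>v\<in>ext \<tau>. link_laplacian X n (j + 1) \<tau> f v = c * f v) \<longleftrightarrow>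
      (\<forall>v\<in>ext \<tau>. (real n - real (j + 1)) * f v
         - (\<Sum>u\<in>ext \<tau>. edge_weight \<tau> u v / weight (\<tau> @ [v]) * f u) = c * f v)" for f c
    by (rule ball_cong[OF refl], subst lap, assumption, rule refl)
  then have "link_eigenvalue X n (j + 1) \<tau> c \<longleftrightarrow> W.eigenvalue c" for c
    unfolding link_eigenvalue_def W.eigenvalue_def Union_link[OF \<tau>] by presburger
  then show ?thesis unfolding lambda_min_def W.gap_def by (simp only:)
qed

lemma
  assumes \<tau>: "\<tau> \<in> ordered_simplices X j" and j: "j + 1 < n"
    and conn: "connected_complex (link X \<tau>)"
  shows lambda_min_pos: "lambda_min X n (j + 1) \<tau> > 0"
    and lambda_min_le: "lambda_min X n (j + 1) \<tau> \<le> 2 * (real n - real (j + 1))"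
  unfolding lambda_min_eq_gap[OF assms]
  by (rule weighted_graph.gap_pos[OF weighted_link[OF assms]] weighted_graph.gap_le[OF weighted_link[OF assms]])+

lemma link_energy_ge:
  fixes \<phi> :: "'v \<Rightarrow> 'h::complex_hilbert"
  assumes \<tau>: "\<tau> \<in> ordered_simplices X j" and j: "j + 1 < n"
    and conn: "connected_complex (link X \<tau>)"
  shows "(real n - real (j + 1)) * (\<Sum>v\<in>ext \<tau>. weight (\<tau> @ [v]) * (norm (\<phi> v))\<^sup>2)
        - (\<Sum>v\<in>ext \<tau>. \<Sum>u\<in>ext (\<tau> @ [v]). weight (\<tau> @ [u, v]) * ip (\<phi> u) (\<phi> v))
      \<ge> lambda_min X n (j + 1) \<tau> * ((\<Sum>v\<in>ext \<tau>. weight (\<tau> @ [v]) * (norm (\<phi> v))\<^sup>2)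
          - (norm (\<Sum>v\<in>ext \<tau>. weight (\<tau> @ [v]) *\<^sub>R \<phi> v))\<^sup>2 / ((real n - real j) * weight \<tau>))"
proof -
  interpret W: weighted_graph "ext \<tau>" "\<lambda>v. weight (\<tau> @ [v])" "edge_weight \<tau>" "real n - real (j + 1)"
    by (rule weighted_link[OF \<tau> j conn])
  have total: "W.total = (real n - real j) * weight \<tau>"
    unfolding W.total_def by (rule sum_weight_ext[OF \<tau>])
  have cross: "(\<Sum>u\<in>ext \<tau>. \<Sum>v\<in>ext \<tau>. edge_weight \<tau> u v * ip (\<phi> u) (\<phi> v))
      = (\<Sum>v\<in>ext \<tau>. \<Sum>u\<in>ext (\<tau> @ [v]). weight (\<tau> @ [u, v]) * ip (\<phi> u) (\<phi> v))"
    by (subst sum.swap) (intro sum.cong refl sum_edge_weight[OF \<tau>])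
  show ?thesis
    using W.energy_ge_gap_hilbert[of \<phi>] unfolding lambda_min_eq_gap[OF assms] total cross .
qed

end

section \<open>Actions of locally compact groups on complexes\<close>

locale lc_action = pure_complex X n
  for X :: "'v set set" and n :: nat +
  fixes G :: "('g, 'm) monoid_scheme" and T :: "'g topology" and \<mu> :: "'g measure"
    and a :: "'g \<Rightarrow> 'v \<Rightarrow> 'v" and R :: "nat \<Rightarrow> 'v list set"
  assumes lcg: "locally_compact_group G T" and unimod: "unimodular G T"
    and pd: "properly_discontinuous_action G T X a" and haar: "left_haar_measure G T \<mu>"
    and reps: "\<forall>j. orbit_representatives G X a j (R j)"
begin

sublocale group G
  using lcg by (simp add: locally_compact_group_def)

sublocale group_action G "\<Union>X" a
  using pd by (simp add: properly_discontinuous_action_def)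

abbreviation act :: "'g \<Rightarrow> 'v list \<Rightarrow> 'v list" where "act g \<equiv> map (a g)"

abbreviation stab :: "'v list \<Rightarrow> 'g set" where "stab \<equiv> simplex_stabilizer G a"

abbreviation vol :: "'v list \<Rightarrow> real" where "vol \<sigma> \<equiv> measure \<mu> (stab \<sigma>)"

abbreviation simps :: "nat \<Rightarrow> 'v list set" where "simps \<equiv> ordered_simplices X"

lemma simplex_vertex: "\<sigma> \<in> simps j \<Longrightarrow> v \<in> set \<sigma> \<Longrightarrow> v \<in> \<Union>X"
  by (auto simp: ordered_simplices_def)

lemma act_simplex: "g \<in> carrier G \<Longrightarrow> \<sigma> \<in> simps j \<Longrightarrow> act g \<sigma> \<in> simps j"
proof -
  assume g: "g \<in> carrier G" and \<sigma>: "\<sigma> \<in> simps j"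
  have "a g ` set \<sigma> \<in> X"
    using pd g \<sigma> by (simp add: properly_discontinuous_action_def ordered_simplices_def)
  moreover have "inj_on (a g) (set \<sigma>)"
    by (rule inj_on_subset[OF inj_prop[OF g]]) (use simplex_vertex[OF \<sigma>] in blast)
  ultimately show ?thesis using \<sigma> by (simp add: ordered_simplices_def distinct_map)
qed

lemma act_mult:
  assumes "\<sigma> \<in> simps j" "g \<in> carrier G" "h \<in> carrier G"
  shows "act (g \<otimes>\<^bsub>G\<^esub> h) \<sigma> = act g (act h \<sigma>)"
  using composition_rule[OF simplex_vertex[OF assms(1)] assms(2,3)] by simp

lemma a_one: "v \<in> \<Union>X \<Longrightarrow> a \<one>\<^bsub>G\<^esub> v = v"
  using fun_cong[OF id_eq_one, of v] by simp

lemma act_one: "\<sigma> \<in> simps j \<Longrightarrow> act \<one>\<^bsub>G\<^esub> \<sigma> = \<sigma>"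
  by (rule map_idI) (rule a_one, rule simplex_vertex)

lemma a_inv: "g \<in> carrier G \<Longrightarrow> v \<in> \<Union>X \<Longrightarrow> a (inv\<^bsub>G\<^esub> g) (a g v) = v"
  using composition_rule[of v "inv\<^bsub>G\<^esub> g" g] a_one by simp

lemma act_inv: "g \<in> carrier G \<Longrightarrow> \<sigma> \<in> simps j \<Longrightarrow> act (inv\<^bsub>G\<^esub> g) (act g \<sigma>) = \<sigma>"
  using act_mult[of \<sigma> j "inv\<^bsub>G\<^esub> g" g] act_one by simp

lemma act_inv': "g \<in> carrier G \<Longrightarrow> \<sigma> \<in> simps j \<Longrightarrow> act g (act (inv\<^bsub>G\<^esub> g) \<sigma>) = \<sigma>"
  using act_mult[of \<sigma> j g "inv\<^bsub>G\<^esub> g"] act_one by simp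

section \<open>Stabilisers and their cosets\<close>

lemma left_coset_stab:
  assumes "\<sigma> \<in> simps j" "g \<in> carrier G"
  shows "{h \<in> carrier G. act h \<sigma> = act g \<sigma>} = g <#\<^bsub>G\<^esub> stab \<sigma>"
proof (intro equalityI subsetI)
  fix h assume "h \<in> {h \<in> carrier G. act h \<sigma> = act g \<sigma>}"
  then have h: "h \<in> carrier G" "act h \<sigma> = act g \<sigma>" by auto
  let ?k = "inv\<^bsub>G\<^esub> g \<otimes>\<^bsub>G\<^esub> h"
  have k: "?k \<in> carrier G" using assms(2) h(1) by simp
  have "act ?k \<sigma> = act (inv\<^bsub>G\<^esub> g) (act h \<sigma>)" by (rule act_mult[OF assms(1)]) (use assms(2) h(1) in simp_all)
  also have "\<dots> = \<sigma>" unfolding h(2) by (rule act_inv[OF assms(2,1)])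
  finally have "?k \<in> stab \<sigma>" using k unfolding simplex_stabilizer_def by blast
  moreover have "h = g \<otimes>\<^bsub>G\<^esub> ?k" using assms(2) h(1) by (simp add: m_assoc[symmetric])
  ultimately show "h \<in> g <#\<^bsub>G\<^esub> stab \<sigma>" unfolding l_coset_def by blast
next
  fix h assume "h \<in> g <#\<^bsub>G\<^esub> stab \<sigma>"
  then obtain k where k: "k \<in> carrier G" "act k \<sigma> = \<sigma>" "h = g \<otimes>\<^bsub>G\<^esub> k"
    unfolding l_coset_def simplex_stabilizer_def by blast
  have "act h \<sigma> = act g \<sigma>" unfolding k(3) act_mult[OF assms k(1)] k(2) ..
  moreover have "h \<in> carrier G" unfolding k(3) using assms(2) k(1) by (rule m_closed)
  ultimately show "h \<in> {h \<in> carrier G. act h \<sigma> = act g \<sigma>}" by blast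
qed

lemma right_coset_stab:
  assumes "\<sigma> \<in> simps j" "g \<in> carrier G"
  shows "{h \<in> carrier G. act h \<sigma> = act g \<sigma>} = stab (act g \<sigma>) #>\<^bsub>G\<^esub> g"
proof (intro equalityI subsetI)
  fix h assume "h \<in> {h \<in> carrier G. act h \<sigma> = act g \<sigma>}"
  then have h: "h \<in> carrier G" "act h \<sigma> = act g \<sigma>" by auto
  let ?k = "h \<otimes>\<^bsub>G\<^esub> inv\<^bsub>G\<^esub> g"
  have k: "?k \<in> carrier G" using assms(2) h(1) by simp
  have "act ?k (act g \<sigma>) = act h (act (inv\<^bsub>G\<^esub> g) (act g \<sigma>))"
    by (rule act_mult[OF act_simplex[OF assms(2,1)]]) (use assms(2) h(1) in simp_all)
  also have "\<dots> = act g \<sigma>" unfolding act_inv[OF assms(2,1)] by (rule h(2))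
  finally have "?k \<in> stab (act g \<sigma>)" using k unfolding simplex_stabilizer_def by blast
  moreover have "h = ?k \<otimes>\<^bsub>G\<^esub> g" using assms(2) h(1) by (simp add: m_assoc)
  ultimately show "h \<in> stab (act g \<sigma>) #>\<^bsub>G\<^esub> g" unfolding r_coset_def by blast
next
  fix h assume "h \<in> stab (act g \<sigma>) #>\<^bsub>G\<^esub> g"
  then obtain k where k: "k \<in> carrier G" "act k (act g \<sigma>) = act g \<sigma>" "h = k \<otimes>\<^bsub>G\<^esub> g"
    unfolding r_coset_def simplex_stabilizer_def by blast
  have "act h \<sigma> = act g \<sigma>" unfolding k(3) act_mult[OF assms(1) k(1) assms(2)] by (rule k(2))
  moreover have "h \<in> carrier G" unfolding k(3) using k(1) assms(2) by (rule m_closed)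
  ultimately show "h \<in> {h \<in> carrier G. act h \<sigma> = act g \<sigma>}" by blast
qed

lemma topspace_T: "topspace T = carrier G"
  using lcg by (simp add: locally_compact_group_def)

lemma
  shows haar_sets: "sets \<mu> = sigma_sets (topspace T) {U. openin T U}"
    and haar_nonzero: "emeasure \<mu> (topspace T) \<noteq> 0"
    and haar_compact: "\<forall>K. compactin T K \<longrightarrow> emeasure \<mu> K < \<infinity>"
    and haar_inner: "\<forall>U. openin T U \<longrightarrow>
        emeasure \<mu> U = (SUP K\<in>{K. compactin T K \<and> K \<subseteq> U}. emeasure \<mu> K)"
    and haar_left: "\<forall>g\<in>carrier G. \<forall>A\<in>sets \<mu>. emeasure \<mu> (g <#\<^bsub>G\<^esub> A) = emeasure \<mu> A"
proof -
  note h = haar[unfolded left_haar_measure_def]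
  show "sets \<mu> = sigma_sets (topspace T) {U. openin T U}" using h by (elim conjE)
  show "emeasure \<mu> (topspace T) \<noteq> 0" using h by (elim conjE)
  show "\<forall>K. compactin T K \<longrightarrow> emeasure \<mu> K < \<infinity>" using h by (elim conjE)
  show "\<forall>U. openin T U \<longrightarrow>
        emeasure \<mu> U = (SUP K\<in>{K. compactin T K \<and> K \<subseteq> U}. emeasure \<mu> K)" using h by (elim conjE)
  show "\<forall>g\<in>carrier G. \<forall>A\<in>sets \<mu>. emeasure \<mu> (g <#\<^bsub>G\<^esub> A) = emeasure \<mu> A" using h by (elim conjE)
qed

lemma open_sets: "openin T U \<Longrightarrow> U \<in> sets \<mu>"
  unfolding haar_sets by (rule sigma_sets.Basic) simp

lemma open_left_coset:
  assumes U: "openin T U" and g: "g \<in> carrier G"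
  shows "openin T (g <#\<^bsub>G\<^esub> U)"
proof -
  have U_sub: "U \<subseteq> carrier G" using openin_subset[OF U] topspace_T by simp
  have "continuous_map T (prod_topology T T) (\<lambda>x. (inv\<^bsub>G\<^esub> g, x))"
    by (intro continuous_map_pairedI continuous_map_const[THEN iffD2] continuous_map_id[unfolded id_def])
       (use g topspace_T in simp)
  moreover have "continuous_map (prod_topology T T) T (\<lambda>(g, h). g \<otimes>\<^bsub>G\<^esub> h)"
    using lcg by (simp add: locally_compact_group_def)
  ultimately have "continuous_map T T ((\<lambda>(g, h). g \<otimes>\<^bsub>G\<^esub> h) \<circ> (\<lambda>x. (inv\<^bsub>G\<^esub> g, x)))"
    by (rule continuous_map_compose)
  then have "openin T {x \<in> topspace T. ((\<lambda>(g, h). g \<otimes>\<^bsub>G\<^esub> h) \<circ> (\<lambda>x. (inv\<^bsub>G\<^esub> g, x))) x \<in> U}"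
    using U by (rule openin_continuous_map_preimage)
  moreover have "{x \<in> topspace T. ((\<lambda>(g, h). g \<otimes>\<^bsub>G\<^esub> h) \<circ> (\<lambda>x. (inv\<^bsub>G\<^esub> g, x))) x \<in> U} = g <#\<^bsub>G\<^esub> U"
  proof (intro equalityI subsetI)
    fix x assume "x \<in> {x \<in> topspace T. ((\<lambda>(g, h). g \<otimes>\<^bsub>G\<^esub> h) \<circ> (\<lambda>x. (inv\<^bsub>G\<^esub> g, x))) x \<in> U}"
    then have x: "x \<in> carrier G" "inv\<^bsub>G\<^esub> g \<otimes>\<^bsub>G\<^esub> x \<in> U" by (auto simp: topspace_T)
    moreover have "x = g \<otimes>\<^bsub>G\<^esub> (inv\<^bsub>G\<^esub> g \<otimes>\<^bsub>G\<^esub> x)" using x(1) g by (simp add: m_assoc[symmetric])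
    ultimately show "x \<in> g <#\<^bsub>G\<^esub> U" unfolding l_coset_def by blast
  next
    fix x assume "x \<in> g <#\<^bsub>G\<^esub> U"
    then obtain u where u: "u \<in> U" "x = g \<otimes>\<^bsub>G\<^esub> u" unfolding l_coset_def by blast
    then have "inv\<^bsub>G\<^esub> g \<otimes>\<^bsub>G\<^esub> x = u" using U_sub g by (auto simp: m_assoc[symmetric])
    then show "x \<in> {x \<in> topspace T. ((\<lambda>(g, h). g \<otimes>\<^bsub>G\<^esub> h) \<circ> (\<lambda>x. (inv\<^bsub>G\<^esub> g, x))) x \<in> U}"
      using u U_sub g by (auto simp: topspace_T)
  qed
  ultimately show ?thesis by simp
qed

lemma left_invariant: "g \<in> carrier G \<Longrightarrow> A \<in> sets \<mu> \<Longrightarrow> emeasure \<mu> (g <#\<^bsub>G\<^esub> A) = emeasure \<mu> A"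
  by (rule haar_left[rule_format])

lemma right_invariant: "g \<in> carrier G \<Longrightarrow> A \<in> sets \<mu> \<Longrightarrow> emeasure \<mu> (A #>\<^bsub>G\<^esub> g) = emeasure \<mu> A"
  using unimod[unfolded unimodular_def, rule_format, OF haar] .

text \<open>A null open neighbourhood of the identity would make every compact set null, as finitely many
  translates cover it, and then the whole group by inner regularity.\<close>

lemma open_not_null:
  assumes U: "openin T U" and one: "\<one>\<^bsub>G\<^esub> \<in> U"
  shows "emeasure \<mu> U \<noteq> 0"
proof
  assume null: "emeasure \<mu> U = 0"
  have compact_null: "emeasure \<mu> K = 0" if K: "compactin T K" for K
  proof -
    have K_sub: "K \<subseteq> carrier G" using compactin_subset_topspace[OF K] topspace_T by simp
    let ?\<U> = "(\<lambda>g. g <#\<^bsub>G\<^esub> U) ` K"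
    have "\<forall>V\<in>?\<U>. openin T V" using open_left_coset[OF U] K_sub by blast
    moreover have "K \<subseteq> \<Union>?\<U>"
    proof
      fix g assume g: "g \<in> K"
      have "g \<in> carrier G" by (rule subsetD[OF K_sub g])
      moreover have "g \<otimes>\<^bsub>G\<^esub> \<one>\<^bsub>G\<^esub> \<in> g <#\<^bsub>G\<^esub> U"
        unfolding l_coset_def by (rule UN_I[OF one]) simp
      ultimately have "g \<in> g <#\<^bsub>G\<^esub> U" by (simp only: r_one)
      then show "g \<in> \<Union>?\<U>" using g by blast
    qed
    ultimately obtain \<F> where \<F>: "finite \<F>" "\<F> \<subseteq> ?\<U>" "K \<subseteq> \<Union>\<F>"
      using K unfolding compactin_def by meson
    have V: "V \<in> sets \<mu> \<and> emeasure \<mu> V = 0" if V: "V \<in> \<F>" for V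
    proof -
      obtain g where g: "g \<in> K" "V = g <#\<^bsub>G\<^esub> U" using V \<F>(2) by blast
      have gG: "g \<in> carrier G" by (rule subsetD[OF K_sub g(1)])
      show ?thesis
        unfolding g(2) using open_sets[OF open_left_coset[OF U gG]] left_invariant[OF gG open_sets[OF U]] null
        by simp
    qed
    have "emeasure \<mu> K \<le> emeasure \<mu> (\<Union>V\<in>\<F>. V)"
      using \<F> V by (intro emeasure_mono sets.finite_UN) auto
    also have "\<dots> \<le> (\<Sum>V\<in>\<F>. emeasure \<mu> V)"
      using \<F>(1) V by (intro emeasure_subadditive_finite) auto
    also have "\<dots> = 0" using V by simp
    finally show ?thesis by simp
  qed
  have "emeasure \<mu> (topspace T) = (SUP K\<in>{K. compactin T K \<and> K \<subseteq> topspace T}. emeasure \<mu> K)"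
    by (rule haar_inner[rule_format]) simp
  also have "\<dots> = (SUP K\<in>{K. compactin T K \<and> K \<subseteq> topspace T}. 0)"
    using compact_null by (intro SUP_cong) auto
  also have "\<dots> = 0" by (simp add: SUP_constant bot_ennreal)
  finally have "emeasure \<mu> (topspace T) = 0" .
  moreover have "emeasure \<mu> (topspace T) \<noteq> 0" by (rule haar_nonzero)
  ultimately show False by simp
qed

lemma stab_open: "\<sigma> \<in> simps j \<Longrightarrow> openin T (stab \<sigma>)"
  and stab_compact: "\<sigma> \<in> simps j \<Longrightarrow> compactin T (stab \<sigma>)"
  using pd by (auto simp: properly_discontinuous_action_def)

lemma stab_emeasure:
  assumes "\<sigma> \<in> simps j"
  shows "emeasure \<mu> (stab \<sigma>) \<noteq> 0" "emeasure \<mu> (stab \<sigma>) \<noteq> \<infinity>"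
proof -
  have "\<one>\<^bsub>G\<^esub> \<in> stab \<sigma>" 
    unfolding simplex_stabilizer_def using act_one[OF assms] one_closed by blast
  then show "emeasure \<mu> (stab \<sigma>) \<noteq> 0" by (rule open_not_null[OF stab_open[OF assms]])
  show "emeasure \<mu> (stab \<sigma>) \<noteq> \<infinity>"
    using haar_compact[rule_format, OF stab_compact[OF assms]] by simp
qed

lemma vol_pos: "\<sigma> \<in> simps j \<Longrightarrow> vol \<sigma> > 0"
  using stab_emeasure[of \<sigma> j]
  by (simp add: measure_def enn2real_positive_iff top.not_eq_extremum zero_less_iff_neq_zero)

text \<open>The elements carrying \<open>p \<sigma>\<close> to \<open>\<tau>\<close> form a right coset of the stabiliser of \<open>\<tau>\<close>. They are also
  the disjoint union, over the points \<open>\<sigma>'\<close> of the orbit of \<open>\<sigma>\<close> with \<open>p \<sigma>' = \<tau>\<close>, of the left cosets of the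
  stabiliser of \<open>\<sigma>\<close> that carry \<open>\<sigma>\<close> to \<open>\<sigma>'\<close>. Unimodularity makes both kinds of cosets as large as
  the stabilisers.\<close>

lemma card_orbit_fibre:
  assumes p: "\<And>\<sigma>. \<sigma> \<in> simps j \<Longrightarrow> p \<sigma> \<in> simps i"
    and equi: "\<And>g \<sigma>. g \<in> carrier G \<Longrightarrow> \<sigma> \<in> simps j \<Longrightarrow> p (act g \<sigma>) = act g (p \<sigma>)"
    and \<sigma>: "\<sigma> \<in> simps j" and g0: "g0 \<in> carrier G" "act g0 (p \<sigma>) = \<tau>"
    and fin: "finite {\<sigma>' \<in> simps j. p \<sigma>' = \<tau>}"
  shows "real (card {\<sigma>' \<in> simps j. p \<sigma>' = \<tau> \<and> (\<exists>g\<in>carrier G. act g \<sigma> = \<sigma>')}) * vol \<sigma> = vol \<tau>"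
proof -
  define N where "N = {\<sigma>' \<in> simps j. p \<sigma>' = \<tau> \<and> (\<exists>g\<in>carrier G. act g \<sigma> = \<sigma>')}"
  define A where "A \<sigma>' = {h \<in> carrier G. act h \<sigma> = \<sigma>'}" for \<sigma>'
  have finN: "finite N" unfolding N_def by (rule finite_subset[OF _ fin]) auto
  have A: "A \<sigma>' \<in> sets \<mu> \<and> emeasure \<mu> (A \<sigma>') = emeasure \<mu> (stab \<sigma>)" if \<sigma>': "\<sigma>' \<in> N" for \<sigma>'
  proof -
    obtain g where g: "g \<in> carrier G" "act g \<sigma> = \<sigma>'" using \<sigma>' unfolding N_def by blast
    have "A \<sigma>' = g <#\<^bsub>G\<^esub> stab \<sigma>"
      unfolding A_def g(2)[symmetric] by (rule left_coset_stab[OF \<sigma> g(1)])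
    then show ?thesis
      using open_sets[OF open_left_coset[OF stab_open[OF \<sigma>] g(1)]]
        left_invariant[OF g(1) open_sets[OF stab_open[OF \<sigma>]]] by simp
  qed
  have \<tau>: "\<tau> \<in> simps i" using act_simplex[OF g0(1) p[OF \<sigma>]] g0(2) by simp
  have un: "(\<Union>\<sigma>'\<in>N. A \<sigma>') = {h \<in> carrier G. act h (p \<sigma>) = act g0 (p \<sigma>)}"
    using equi[OF _ \<sigma>] act_simplex[OF _ \<sigma>] g0 unfolding N_def A_def by force
  have "(\<Sum>\<sigma>'\<in>N. emeasure \<mu> (A \<sigma>')) = emeasure \<mu> (\<Union>\<sigma>'\<in>N. A \<sigma>')"
    by (rule sum_emeasure) (use A finN in \<open>auto simp: disjoint_family_on_def A_def\<close>)
  also have "\<dots> = emeasure \<mu> (stab (act g0 (p \<sigma>)) #>\<^bsub>G\<^esub> g0)"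
    by (simp only: un right_coset_stab[OF p[OF \<sigma>] g0(1)])
  also have "\<dots> = emeasure \<mu> (stab \<tau>)"
    using right_invariant[OF g0(1) open_sets[OF stab_open[OF \<tau>]]] by (simp only: g0(2))
  finally have "of_nat (card N) * emeasure \<mu> (stab \<sigma>) = emeasure \<mu> (stab \<tau>)" using A by simp
  from arg_cong[OF this, of enn2real] show ?thesis
    unfolding N_def[symmetric] by (simp add: measure_def enn2real_mult ennreal_of_nat_eq_real_of_nat)
qed

section \<open>Sums over orbits\<close>

text \<open>Sums over orbits of \<open>j\<close>-simplices, an orbit having the weight \<open>1 / vol\<close> of its representative.\<close>

definition orbit_summable :: "nat \<Rightarrow> ('v list \<Rightarrow> real) \<Rightarrow> bool" where
  "orbit_summable j F \<longleftrightarrow> (\<lambda>\<sigma>. F \<sigma> / vol \<sigma>) summable_on R j"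

definition orbit_sum :: "nat \<Rightarrow> ('v list \<Rightarrow> real) \<Rightarrow> real" where
  "orbit_sum j F = (\<Sum>\<^sub>\<infinity>\<sigma>\<in>R j. F \<sigma> / vol \<sigma>)"

definition invariant :: "nat \<Rightarrow> ('v list \<Rightarrow> real) \<Rightarrow> bool" where
  "invariant j F \<longleftrightarrow> (\<forall>g\<in>carrier G. \<forall>\<sigma>\<in>simps j. F (act g \<sigma>) = F \<sigma>)"

lemma R_simplex: "\<sigma> \<in> R j \<Longrightarrow> \<sigma> \<in> simps j"
  using reps unfolding orbit_representatives_def by blast

lemma R_ex: "\<sigma> \<in> simps j \<Longrightarrow> \<exists>\<tau>\<in>R j. \<exists>g\<in>carrier G. act g \<tau> = \<sigma>"
  using reps unfolding orbit_representatives_def by blast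

lemma R_unique:
  assumes "\<sigma> \<in> simps j" "\<tau> \<in> R j" "g \<in> carrier G" "act g \<tau> = \<sigma>" "\<tau>' \<in> R j" "g' \<in> carrier G" "act g' \<tau>' = \<sigma>"
  shows "\<tau> = \<tau>'"
  using reps assms unfolding orbit_representatives_def by blast

lemma orbit_sum_cong: "(\<And>\<sigma>. \<sigma> \<in> simps j \<Longrightarrow> F \<sigma> = F' \<sigma>) \<Longrightarrow> orbit_sum j F = orbit_sum j F'"
  unfolding orbit_sum_def by (intro infsum_cong) (simp add: R_simplex)

lemma orbit_summable_cong:
  "(\<And>\<sigma>. \<sigma> \<in> simps j \<Longrightarrow> F \<sigma> = F' \<sigma>) \<Longrightarrow> orbit_summable j F \<longleftrightarrow> orbit_summable j F'"
  unfolding orbit_summable_def by (intro summable_on_cong) (simp add: R_simplex)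

lemma orbit_summable_bound:
  assumes F': "orbit_summable j F'" and le: "\<And>\<sigma>. \<sigma> \<in> simps j \<Longrightarrow> \<bar>F \<sigma>\<bar> \<le> F' \<sigma>"
  shows "orbit_summable j F"
proof -
  have "(\<lambda>\<sigma>. norm (F \<sigma> / vol \<sigma>)) summable_on R j"
  proof (rule summable_on_comparison_test[OF F'[unfolded orbit_summable_def]])
    fix \<sigma> assume "\<sigma> \<in> R j"
    then show "norm (F \<sigma> / vol \<sigma>) \<le> F' \<sigma> / vol \<sigma>"
      using le[OF R_simplex] by (simp add: divide_right_mono)
  qed simp
  then show ?thesis unfolding orbit_summable_def by (rule abs_summable_summable)
qed

lemma orbit_summable_add:
  "orbit_summable j F \<Longrightarrow> orbit_summable j F' \<Longrightarrow> orbit_summable j (\<lambda>\<sigma>. F \<sigma> + F' \<sigma>)"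
  unfolding orbit_summable_def add_divide_distrib by (rule summable_on_add)

lemma orbit_sum_add:
  "orbit_summable j F \<Longrightarrow> orbit_summable j F' \<Longrightarrow> orbit_sum j (\<lambda>\<sigma>. F \<sigma> + F' \<sigma>) = orbit_sum j F + orbit_sum j F'"
  unfolding orbit_summable_def orbit_sum_def add_divide_distrib by (rule infsum_add)

lemma orbit_summable_cmult: "orbit_summable j F \<Longrightarrow> orbit_summable j (\<lambda>\<sigma>. c * F \<sigma>)"
  unfolding orbit_summable_def using summable_on_cmult_right[of "\<lambda>\<sigma>. F \<sigma> / vol \<sigma>" "R j" c] by simp

lemma orbit_sum_cmult: "orbit_sum j (\<lambda>\<sigma>. c * F \<sigma>) = c * orbit_sum j F"
  unfolding orbit_sum_def using infsum_cmult_right'[of c "\<lambda>\<sigma>. F \<sigma> / vol \<sigma>" "R j"] by simp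

lemma orbit_summable_diff:
  "orbit_summable j F \<Longrightarrow> orbit_summable j F' \<Longrightarrow> orbit_summable j (\<lambda>\<sigma>. F \<sigma> - F' \<sigma>)"
  using orbit_summable_add[OF _ orbit_summable_cmult[of j F' "-1"]] by simp

lemma orbit_sum_diff:
  "orbit_summable j F \<Longrightarrow> orbit_summable j F' \<Longrightarrow> orbit_sum j (\<lambda>\<sigma>. F \<sigma> - F' \<sigma>) = orbit_sum j F - orbit_sum j F'"
  using orbit_sum_add[OF _ orbit_summable_cmult[of j F' "-1"]] orbit_sum_cmult[of j "-1" F'] by simp

lemma orbit_summable_sum:
  "(\<And>i. i \<in> I \<Longrightarrow> orbit_summable j (F i)) \<Longrightarrow> orbit_summable j (\<lambda>\<sigma>. \<Sum>i\<in>I. F i \<sigma>)"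
  by (induction I rule: infinite_finite_induct)
    (auto intro: orbit_summable_add simp: orbit_summable_def[of _ "\<lambda>_. 0"])

lemma orbit_sum_sum:
  "(\<And>i. i \<in> I \<Longrightarrow> orbit_summable j (F i)) \<Longrightarrow> orbit_sum j (\<lambda>\<sigma>. \<Sum>i\<in>I. F i \<sigma>) = (\<Sum>i\<in>I. orbit_sum j (F i))"
  by (induction I rule: infinite_finite_induct)
    (auto simp: orbit_sum_add orbit_summable_sum orbit_sum_def[of _ "\<lambda>_. 0"])

lemma orbit_sum_mono:
  assumes "orbit_summable j F" "orbit_summable j F'" "\<And>\<sigma>. \<sigma> \<in> R j \<Longrightarrow> F \<sigma> \<le> F' \<sigma>"
  shows "orbit_sum j F \<le> orbit_sum j F'"
  unfolding orbit_sum_def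
  by (rule infsum_mono) (use assms in \<open>auto simp: orbit_summable_def intro: divide_right_mono\<close>)

lemma orbit_sum_nonneg: "(\<And>\<sigma>. \<sigma> \<in> R j \<Longrightarrow> F \<sigma> \<ge> 0) \<Longrightarrow> orbit_sum j F \<ge> 0"
  unfolding orbit_sum_def by (rule infsum_nonneg) simp

definition pushforward :: "nat \<Rightarrow> ('v list \<Rightarrow> 'v list) \<Rightarrow> ('v list \<Rightarrow> real) \<Rightarrow> 'v list \<Rightarrow> real" where
  "pushforward j p F \<tau> = (\<Sum>\<sigma> | \<sigma> \<in> simps j \<and> p \<sigma> = \<tau>. F \<sigma>)"

text \<open>The representatives \<open>\<sigma>\<close> of \<open>j\<close>-simplices are grouped into finite blocks \<open>B \<tau>\<close>, by the representative \<open>\<tau>\<close> of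
  the orbit of \<open>p \<sigma>\<close>. The fibre of \<open>p\<close> over \<open>\<tau>\<close> meets the orbit of each \<open>\<sigma>\<close> in its block in
  \<open>vol \<tau> / vol \<sigma>\<close> points, so the block contributes the value of the pushforward at \<open>\<tau>\<close>
  divided by \<open>vol \<tau>\<close>.\<close>

lemma
  assumes p: "\<And>\<sigma>. \<sigma> \<in> simps j \<Longrightarrow> p \<sigma> \<in> simps i"
    and equi: "\<And>g \<sigma>. g \<in> carrier G \<Longrightarrow> \<sigma> \<in> simps j \<Longrightarrow> p (act g \<sigma>) = act g (p \<sigma>)"
    and fin: "\<And>\<tau>. \<tau> \<in> simps i \<Longrightarrow> finite {\<sigma> \<in> simps j. p \<sigma> = \<tau>}"
    and inv: "invariant j F"
  shows orbit_summable_pushforward: "orbit_summable j F \<Longrightarrow> orbit_summable i (pushforward j p F)"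
    and orbit_sum_pushforward: "orbit_summable j F \<Longrightarrow> orbit_sum i (pushforward j p F) = orbit_sum j F"
    and orbit_summable_if_pushforward: "(\<And>\<sigma>. \<sigma> \<in> simps j \<Longrightarrow> F \<sigma> \<ge> 0) \<Longrightarrow>
        orbit_summable i (pushforward j p F) \<Longrightarrow> orbit_summable j F"
proof -
  define B where "B \<tau> = {\<sigma> \<in> R j. \<exists>g\<in>carrier G. act g \<tau> = p \<sigma>}" for \<tau>
  define N where "N \<tau> \<sigma> = {\<sigma>' \<in> simps j. p \<sigma>' = \<tau> \<and> (\<exists>g\<in>carrier G. act g \<sigma> = \<sigma>')}" for \<tau> \<sigma>
  have B_fibre: "\<exists>\<sigma>'\<in>{\<sigma> \<in> simps j. p \<sigma> = \<tau>}. \<exists>g\<in>carrier G. act g \<sigma> = \<sigma>'"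
    if \<tau>: "\<tau> \<in> simps i" and \<sigma>: "\<sigma> \<in> B \<tau>" for \<tau> \<sigma>
  proof -
    obtain g where g: "g \<in> carrier G" "act g \<tau> = p \<sigma>" using \<sigma> unfolding B_def by blast
    have s: "\<sigma> \<in> simps j" using \<sigma> R_simplex unfolding B_def by blast
    have "p (act (inv\<^bsub>G\<^esub> g) \<sigma>) = \<tau>"
      using equi[OF inv_closed[OF g(1)] s] act_inv[OF g(1) \<tau>] g(2) by simp
    then show ?thesis using act_simplex[OF inv_closed[OF g(1)] s] g(1) by blast
  qed
  have fibre_B: "\<exists>\<sigma>\<in>B \<tau>. \<exists>g\<in>carrier G. act g \<sigma> = \<sigma>'"
    if \<sigma>': "\<sigma>' \<in> simps j" "p \<sigma>' = \<tau>" for \<tau> \<sigma>'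
  proof -
    obtain \<sigma> g where g: "\<sigma> \<in> R j" "g \<in> carrier G" "act g \<sigma> = \<sigma>'" using R_ex[OF \<sigma>'(1)] by blast
    have s: "\<sigma> \<in> simps j" by (rule R_simplex[OF g(1)])
    have "act g (p \<sigma>) = \<tau>" using equi[OF g(2) s] g(3) \<sigma>'(2) by simp
    then have "act (inv\<^bsub>G\<^esub> g) \<tau> = p \<sigma>" using act_inv[OF g(2) p[OF s]] by simp
    then have "\<sigma> \<in> B \<tau>" using g(1) inv_closed[OF g(2)] unfolding B_def by blast
    then show ?thesis using g by blast
  qed
  have finB: "finite (B \<tau>)" if \<tau>: "\<tau> \<in> simps i" for \<tau>
  proof -
    let ?r = "\<lambda>\<sigma>'. SOME \<sigma>. \<sigma> \<in> R j \<and> (\<exists>g\<in>carrier G. act g \<sigma> = \<sigma>')"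
    have "B \<tau> \<subseteq> ?r ` {\<sigma> \<in> simps j. p \<sigma> = \<tau>}"
    proof
      fix \<sigma> assume \<sigma>: "\<sigma> \<in> B \<tau>"
      then obtain \<sigma>' where \<sigma>': "\<sigma>' \<in> simps j" "p \<sigma>' = \<tau>" "\<exists>g\<in>carrier G. act g \<sigma> = \<sigma>'"
        using B_fibre[OF \<tau>] by blast
      have R\<sigma>: "\<sigma> \<in> R j" using \<sigma> unfolding B_def by blast
      have "?r \<sigma>' = \<sigma>"
        by (rule some_equality) (use R\<sigma> \<sigma>' R_unique[OF \<sigma>'(1)] in blast)+
      then show "\<sigma> \<in> ?r ` {\<sigma> \<in> simps j. p \<sigma> = \<tau>}" using \<sigma>' by blast
    qed
    then show ?thesis using fin[OF \<tau>] by (meson finite_imageI finite_subset)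
  qed
  have push_B: "pushforward j p F \<tau> / vol \<tau> = (\<Sum>\<sigma>\<in>B \<tau>. F \<sigma> / vol \<sigma>)" if \<tau>R: "\<tau> \<in> R i" for \<tau>
  proof -
    have \<tau>: "\<tau> \<in> simps i" by (rule R_simplex[OF \<tau>R])
    have decomp: "{\<sigma> \<in> simps j. p \<sigma> = \<tau>} = (\<Union>\<sigma>\<in>B \<tau>. N \<tau> \<sigma>)"
    proof (intro equalityI subsetI)
      fix \<sigma>' assume "\<sigma>' \<in> {\<sigma> \<in> simps j. p \<sigma> = \<tau>}"
      then have \<sigma>': "\<sigma>' \<in> simps j" "p \<sigma>' = \<tau>" by auto
      obtain \<sigma> where "\<sigma> \<in> B \<tau>" "\<exists>g\<in>carrier G. act g \<sigma> = \<sigma>'" using fibre_B[OF \<sigma>'] by blast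
      then show "\<sigma>' \<in> (\<Union>\<sigma>\<in>B \<tau>. N \<tau> \<sigma>)" using \<sigma>' by (auto simp: N_def)
    qed (auto simp: N_def)
    have finN: "finite (N \<tau> \<sigma>)" for \<sigma>
      unfolding N_def by (rule finite_subset[OF _ fin[OF \<tau>]]) auto
    have disj: "\<forall>\<sigma>\<in>B \<tau>. \<forall>\<sigma>'\<in>B \<tau>. \<sigma> \<noteq> \<sigma>' \<longrightarrow> N \<tau> \<sigma> \<inter> N \<tau> \<sigma>' = {}"
    proof (intro ballI impI)
      fix \<sigma> \<sigma>' assume s: "\<sigma> \<in> B \<tau>" "\<sigma>' \<in> B \<tau>" "\<sigma> \<noteq> \<sigma>'"
      have "\<sigma> = \<sigma>'" if \<eta>: "\<eta> \<in> N \<tau> \<sigma>" "\<eta> \<in> N \<tau> \<sigma>'" for \<eta>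
      proof -
        obtain g g' where "g \<in> carrier G" "act g \<sigma> = \<eta>" "g' \<in> carrier G" "act g' \<sigma>' = \<eta>" "\<eta> \<in> simps j"
          using \<eta> unfolding N_def by blast
        then show ?thesis using s(1,2) R_unique[of \<eta> j \<sigma> g \<sigma>' g'] unfolding B_def by blast
      qed
      then show "N \<tau> \<sigma> \<inter> N \<tau> \<sigma>' = {}" using s(3) by blast
    qed
    have "pushforward j p F \<tau> = (\<Sum>\<sigma>\<in>B \<tau>. \<Sum>\<sigma>'\<in>N \<tau> \<sigma>. F \<sigma>')"
      unfolding pushforward_def decomp
      by (rule sum.UNION_disjoint[OF finB[OF \<tau>]]) (use finN disj in auto)
    also have "\<dots> = (\<Sum>\<sigma>\<in>B \<tau>. vol \<tau> * (F \<sigma> / vol \<sigma>))"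
    proof (rule sum.cong)
      fix \<sigma> assume \<sigma>: "\<sigma> \<in> B \<tau>"
      then have s: "\<sigma> \<in> simps j" using R_simplex unfolding B_def by blast
      obtain g where g: "g \<in> carrier G" "act g \<tau> = p \<sigma>" using \<sigma> unfolding B_def by blast
      have "(\<Sum>\<sigma>'\<in>N \<tau> \<sigma>. F \<sigma>') = (\<Sum>\<sigma>'\<in>N \<tau> \<sigma>. F \<sigma>)"
        using inv s unfolding invariant_def N_def by (intro sum.cong) auto
      moreover have "real (card (N \<tau> \<sigma>)) * vol \<sigma> = vol \<tau>"
        unfolding N_def
        by (rule card_orbit_fibre[OF p equi s inv_closed[OF g(1)] _ fin[OF \<tau>]])
          (use act_inv[OF g(1) \<tau>] g(2) in simp_all)
      ultimately show "(\<Sum>\<sigma>'\<in>N \<tau> \<sigma>. F \<sigma>') = vol \<tau> * (F \<sigma> / vol \<sigma>)"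
        using vol_pos[OF s] by (simp add: field_simps)
    qed simp
    also have "\<dots> = vol \<tau> * (\<Sum>\<sigma>\<in>B \<tau>. F \<sigma> / vol \<sigma>)" by (simp only: sum_distrib_left)
    finally show ?thesis using vol_pos[OF \<tau>] by simp
  qed
  have bij: "bij_betw snd (Sigma (R i) B) (R j)"
  proof (rule bij_betwI')
    fix x y assume x: "x \<in> Sigma (R i) B" and y: "y \<in> Sigma (R i) B"
    obtain \<tau> \<sigma> where x_eq: "x = (\<tau>, \<sigma>)" "\<tau> \<in> R i" "\<sigma> \<in> B \<tau>" using x by blast
    obtain \<tau>' \<sigma>' where y_eq: "y = (\<tau>', \<sigma>')" "\<tau>' \<in> R i" "\<sigma>' \<in> B \<tau>'" using y by blast
    have "\<tau> = \<tau>'" if "\<sigma> = \<sigma>'"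
    proof -
      obtain g where g: "g \<in> carrier G" "act g \<tau> = p \<sigma>" "\<sigma> \<in> R j"
        using x_eq(3) unfolding B_def by blast
      obtain g' where g': "g' \<in> carrier G" "act g' \<tau>' = p \<sigma>'" using y_eq(3) unfolding B_def by blast
      show ?thesis
        by (rule R_unique[OF p[OF R_simplex[OF g(3)]] x_eq(2) g(1,2) y_eq(2) g'(1) g'(2)[folded that]])
    qed
    then show "(snd x = snd y) = (x = y)" unfolding x_eq(1) y_eq(1) by auto
  next
    fix x assume "x \<in> Sigma (R i) B"
    then show "snd x \<in> R j" unfolding B_def by auto
  next
    fix \<sigma> assume \<sigma>: "\<sigma> \<in> R j"
    obtain \<tau> g where "\<tau> \<in> R i" "g \<in> carrier G" "act g \<tau> = p \<sigma>"
      using R_ex[OF p[OF R_simplex[OF \<sigma>]]] by blast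
    then show "\<exists>x\<in>Sigma (R i) B. \<sigma> = snd x" using \<sigma> unfolding B_def by force
  qed
  have sum_iff: "orbit_summable j F \<longleftrightarrow> (\<lambda>(\<tau>, \<sigma>). F \<sigma> / vol \<sigma>) summable_on Sigma (R i) B"
    unfolding orbit_summable_def case_prod_unfold by (rule summable_on_reindex_bij_betw[OF bij, symmetric])
  have inner: "(\<Sum>\<^sub>\<infinity>\<sigma>\<in>B \<tau>. F \<sigma> / vol \<sigma>) = pushforward j p F \<tau> / vol \<tau>" if "\<tau> \<in> R i" for \<tau>
    using push_B[OF that] finB[OF R_simplex[OF that]] by simp
  show "orbit_summable i (pushforward j p F)" if "orbit_summable j F"
    unfolding orbit_summable_def
    using iffD1[OF summable_on_cong[OF inner] summable_on_Sigma_banach[OF that[unfolded sum_iff]]] .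
  show "orbit_sum i (pushforward j p F) = orbit_sum j F" if s: "orbit_summable j F"
  proof -
    have "orbit_sum i (pushforward j p F) = (\<Sum>\<^sub>\<infinity>\<tau>\<in>R i. \<Sum>\<^sub>\<infinity>\<sigma>\<in>B \<tau>. F \<sigma> / vol \<sigma>)"
      unfolding orbit_sum_def by (intro infsum_cong) (simp add: inner)
    also have "\<dots> = (\<Sum>\<^sub>\<infinity>(\<tau>, \<sigma>)\<in>Sigma (R i) B. F \<sigma> / vol \<sigma>)"
      by (rule infsum_Sigma'_banach[OF s[unfolded sum_iff]])
    also have "\<dots> = orbit_sum j F"
      unfolding orbit_sum_def case_prod_unfold by (rule infsum_reindex_bij_betw[OF bij])
    finally show ?thesis .
  qed
  show "orbit_summable j F" if nonneg: "\<And>\<sigma>. \<sigma> \<in> simps j \<Longrightarrow> F \<sigma> \<ge> 0" and s: "orbit_summable i (pushforward j p F)"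
    unfolding sum_iff
  proof (rule summable_on_SigmaI)
    show "((\<lambda>\<sigma>. case (\<tau>, \<sigma>) of (\<tau>, \<sigma>) \<Rightarrow> F \<sigma> / vol \<sigma>) has_sum pushforward j p F \<tau> / vol \<tau>) (B \<tau>)"
      if "\<tau> \<in> R i" for \<tau>
      using push_B[OF that] finB[OF R_simplex[OF that]] by simp
    show "(\<lambda>\<tau>. pushforward j p F \<tau> / vol \<tau>) summable_on R i" using s by (simp add: orbit_summable_def)
    show "(case (\<tau>, \<sigma>) of (\<tau>, \<sigma>) \<Rightarrow> F \<sigma> / vol \<sigma>) \<ge> 0" if "\<tau> \<in> R i" "\<sigma> \<in> B \<tau>" for \<tau> \<sigma>
      using that nonneg R_simplex unfolding B_def by simp
  qed
qed

lemma pushforward_delete_nth: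
  assumes "\<tau> \<in> simps j" "i \<le> Suc j"
  shows "pushforward (Suc j) (delete_nth i) F \<tau> = (\<Sum>v\<in>ext \<tau>. F (insert_nth i v \<tau>))"
  unfolding pushforward_def delete_nth_fibre[OF assms]
  by (rule sum.reindex_cong[of "\<lambda>v. insert_nth i v \<tau>"]) (auto simp: inj_on_def dest: inj_insert_nth)

text \<open>All comparisons of dimensions below use this case: the fibre of the deletion of the \<open>i\<close>-th entry
  consists of the insertions of the vertices of the link.\<close>

lemma
  assumes i: "i \<le> Suc j" and inv: "invariant (Suc j) F"
  shows orbit_summable_delete: "orbit_summable (Suc j) F \<Longrightarrow> orbit_summable j (\<lambda>\<tau>. \<Sum>v\<in>ext \<tau>. F (insert_nth i v \<tau>))"
    and orbit_sum_delete: "orbit_summable (Suc j) F \<Longrightarrow>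
      orbit_sum (Suc j) F = orbit_sum j (\<lambda>\<tau>. \<Sum>v\<in>ext \<tau>. F (insert_nth i v \<tau>))"
    and orbit_summable_if_delete: "(\<And>\<sigma>. \<sigma> \<in> simps (Suc j) \<Longrightarrow> F \<sigma> \<ge> 0) \<Longrightarrow>
      orbit_summable j (\<lambda>\<tau>. \<Sum>v\<in>ext \<tau>. F (insert_nth i v \<tau>)) \<Longrightarrow> orbit_summable (Suc j) F"
proof -
  have p: "delete_nth i \<sigma> \<in> simps j" if "\<sigma> \<in> simps (Suc j)" for \<sigma>
    using delete_nth_simplex[OF that i] .
  have equi: "delete_nth i (act g \<sigma>) = act g (delete_nth i \<sigma>)" for g \<sigma> by (simp add: map_delete_nth)
  have fin: "finite {\<sigma> \<in> simps (Suc j). delete_nth i \<sigma> = \<tau>}" if "\<tau> \<in> simps j" for \<tau>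
    unfolding delete_nth_fibre[OF that i] using finite_ext[OF that] by simp
  have push: "pushforward (Suc j) (delete_nth i) F \<tau> = (\<Sum>v\<in>ext \<tau>. F (insert_nth i v \<tau>))"
    if "\<tau> \<in> simps j" for \<tau> by (rule pushforward_delete_nth[OF that i])
  note P = orbit_summable_pushforward[OF p equi fin inv] orbit_sum_pushforward[OF p equi fin inv]
    orbit_summable_if_pushforward[OF p equi fin inv]
  show "orbit_summable (Suc j) F \<Longrightarrow> orbit_summable j (\<lambda>\<tau>. \<Sum>v\<in>ext \<tau>. F (insert_nth i v \<tau>))"
    using P(1) orbit_summable_cong[of j, OF push] by simp
  show "orbit_summable (Suc j) F \<Longrightarrow>
      orbit_sum (Suc j) F = orbit_sum j (\<lambda>\<tau>. \<Sum>v\<in>ext \<tau>. F (insert_nth i v \<tau>))"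
    using P(2) orbit_sum_cong[of j, OF push] by simp
  show "orbit_summable (Suc j) F" if "\<And>\<sigma>. \<sigma> \<in> simps (Suc j) \<Longrightarrow> F \<sigma> \<ge> 0"
    "orbit_summable j (\<lambda>\<tau>. \<Sum>v\<in>ext \<tau>. F (insert_nth i v \<tau>))"
    using P(3) orbit_summable_cong[of j, OF push] that by simp
qed

section \<open>Invariance of the local data\<close>

lemma weight_act: 
  assumes g: "g \<in> carrier G" and \<sigma>: "\<sigma> \<in> simps j"
  shows "weight (act g \<sigma>) = weight \<sigma>"
proof -
  have le: "top_count X n \<sigma> \<le> top_count X n (act g \<sigma>)" if g: "g \<in> carrier G" and \<sigma>: "\<sigma> \<in> simps j" for g \<sigma>
    unfolding top_count_def
  proof (rule card_inj_on_le[where f = "image (a g)"])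
    have "inj_on (image (a g)) (Pow (\<Union>X))" by (rule inj_on_image_Pow[OF inj_prop[OF g]])
    then show "inj_on (image (a g)) {s \<in> X. card s = n + 1 \<and> set \<sigma> \<subseteq> s}" by (rule inj_on_subset) auto
    show "image (a g) ` {s \<in> X. card s = n + 1 \<and> set \<sigma> \<subseteq> s} \<subseteq> {s \<in> X. card s = n + 1 \<and> set (act g \<sigma>) \<subseteq> s}"
    proof
      fix t assume "t \<in> image (a g) ` {s \<in> X. card s = n + 1 \<and> set \<sigma> \<subseteq> s}"
      then obtain s where s: "s \<in> X" "card s = n + 1" "set \<sigma> \<subseteq> s" "t = a g ` s" by auto
      have "inj_on (a g) s" by (rule inj_on_subset[OF inj_prop[OF g]]) (use s in auto)
      then show "t \<in> {s \<in> X. card s = n + 1 \<and> set (act g \<sigma>) \<subseteq> s}"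
        using s pd g by (auto simp: properly_discontinuous_action_def card_image)
    qed
    show "finite {s \<in> X. card s = n + 1 \<and> set (act g \<sigma>) \<subseteq> s}"
      by (rule finite_subset[OF _ finite_simplices_meeting[OF act_simplex[OF g \<sigma>]]]) auto
  qed
  have "top_count X n (act g \<sigma>) \<le> top_count X n (act (inv\<^bsub>G\<^esub> g) (act g \<sigma>))"
    by (rule le[OF inv_closed[OF g] act_simplex[OF g \<sigma>]])
  then show ?thesis using le[OF g \<sigma>] act_inv[OF g \<sigma>] by simp
qed

lemma ext_act:
  assumes g: "g \<in> carrier G" and \<tau>: "\<tau> \<in> simps j"
  shows "ext (act g \<tau>) = a g ` ext \<tau>"
proof -
  have sub: "a g ` ext \<tau> \<subseteq> ext (act g \<tau>)" if g: "g \<in> carrier G" and \<tau>: "\<tau> \<in> simps j" for g \<tau>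
  proof
    fix w assume "w \<in> a g ` ext \<tau>"
    then obtain v where v: "v \<in> ext \<tau>" "w = a g v" by blast
    have "act g (\<tau> @ [v]) \<in> simps (Suc j)" by (rule act_simplex[OF g append_simplex[OF \<tau> v(1)]])
    then show "w \<in> ext (act g \<tau>)" using v(2) by (simp add: ordered_simplices_def ext_verts_def)
  qed
  show ?thesis
  proof
    show "ext (act g \<tau>) \<subseteq> a g ` ext \<tau>"
    proof
      fix w assume w: "w \<in> ext (act g \<tau>)"
      then have "a (inv\<^bsub>G\<^esub> g) w \<in> ext \<tau>"
        using sub[OF inv_closed[OF g] act_simplex[OF g \<tau>]] act_inv[OF g \<tau>] by auto
      moreover have "a g (a (inv\<^bsub>G\<^esub> g) w) = w"
        using a_inv[of "inv\<^bsub>G\<^esub> g" w] w g by (auto simp: ext_verts_def)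
      ultimately show "w \<in> a g ` ext \<tau>" by (metis imageI)
    qed
  qed (rule sub[OF g \<tau>])
qed

lemma ext_vertex: "v \<in> ext \<tau> \<Longrightarrow> v \<in> \<Union>X"
  by (auto simp: ext_verts_def)

lemma inj_on_ext: "g \<in> carrier G \<Longrightarrow> inj_on (a g) (ext \<tau>)"
  by (rule inj_on_subset[OF inj_prop]) (use ext_vertex in blast)+

lemma sum_ext_act:
  assumes "g \<in> carrier G" "\<tau> \<in> simps j"
  shows "(\<Sum>v\<in>ext (act g \<tau>). f v) = (\<Sum>v\<in>ext \<tau>. f (a g v))"
  unfolding ext_act[OF assms] by (rule sum.reindex_cong[OF inj_on_ext[OF assms(1)]]) auto

text \<open>Group elements carry eigenfunctions on one link to eigenfunctions on the other.\<close>

lemma lambda_min_act: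
  assumes g: "g \<in> carrier G" and \<tau>: "\<tau> \<in> simps j"
  shows "lambda_min X n k (act g \<tau>) = lambda_min X n k \<tau>"
proof -
  have le: "link_eigenvalue X n k (act g \<tau>) c"
    if g: "g \<in> carrier G" and \<tau>: "\<tau> \<in> simps j" and e: "link_eigenvalue X n k \<tau> c" for g \<tau> c
  proof -
    obtain f v0 where f: "v0 \<in> ext \<tau>" "f v0 \<noteq> 0" "\<And>v. v \<in> ext \<tau> \<Longrightarrow> link_laplacian X n k \<tau> f v = c * f v"
      using e unfolding link_eigenvalue_def Union_link[OF \<tau>] by blast
    define f' where "f' w = f (a (inv\<^bsub>G\<^esub> g) w)" for w
    have f'_a: "f' (a g v) = f v" if "v \<in> ext \<rho>" for v \<rho>
      using a_inv[OF g ext_vertex[OF that]] by (simp add: f'_def)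
    have "link_laplacian X n k (act g \<tau>) f' w = c * f' w" if w: "w \<in> ext (act g \<tau>)" for w
    proof -
      obtain v where v: "v \<in> ext \<tau>" "w = a g v" using w unfolding ext_act[OF g \<tau>] by blast
      have \<tau>v: "\<tau> @ [v] \<in> simps (Suc j)" by (rule append_simplex[OF \<tau> v(1)])
      have "(\<Sum>u\<in>ext (act g \<tau> @ [w]). weight (act g \<tau> @ [u, w]) / weight (act g \<tau> @ [w]) * f' u)
          = (\<Sum>u\<in>ext (act g (\<tau> @ [v])). weight (act g \<tau> @ [u, w]) / weight (act g \<tau> @ [w]) * f' u)"
        using v(2) by simp
      also have "\<dots> = (\<Sum>u\<in>ext (\<tau> @ [v]). weight (act g \<tau> @ [a g u, w]) / weight (act g \<tau> @ [w]) * f' (a g u))"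
        by (rule sum_ext_act[OF g \<tau>v])
      also have "\<dots> = (\<Sum>u\<in>ext (\<tau> @ [v]). weight (\<tau> @ [u, v]) / weight (\<tau> @ [v]) * f u)"
      proof (rule sum.cong)
        fix u assume u: "u \<in> ext (\<tau> @ [v])"
        have "weight (act g \<tau> @ [a g u, w]) = weight (act g ((\<tau> @ [v]) @ [u]))"
          using v(2) by (intro arg_cong[of _ _ real] top_count_cong) auto
        also have "\<dots> = weight ((\<tau> @ [v]) @ [u])" by (rule weight_act[OF g append_simplex[OF \<tau>v u]])
        also have "\<dots> = weight (\<tau> @ [u, v])" by (intro arg_cong[of _ _ real] top_count_cong) auto
        finally have "weight (act g \<tau> @ [a g u, w]) = weight (\<tau> @ [u, v])" .
        moreover have "weight (act g \<tau> @ [w]) = weight (\<tau> @ [v])" using weight_act[OF g \<tau>v] v(2) by simp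
        ultimately show "weight (act g \<tau> @ [a g u, w]) / weight (act g \<tau> @ [w]) * f' (a g u)
            = weight (\<tau> @ [u, v]) / weight (\<tau> @ [v]) * f u" using f'_a[OF u] by simp
      qed simp
      finally have sum_eq: "(\<Sum>u\<in>ext (act g \<tau> @ [w]). weight (act g \<tau> @ [u, w]) / weight (act g \<tau> @ [w]) * f' u)
          = (\<Sum>u\<in>ext (\<tau> @ [v]). weight (\<tau> @ [u, v]) / weight (\<tau> @ [v]) * f u)" .
      have f'_w: "f' w = f v" using f'_a[OF v(1)] v(2) by simp
      show ?thesis
        using f(3)[OF v(1)]
        unfolding link_laplacian_alt[OF act_simplex[OF g \<tau>] w] link_laplacian_alt[OF \<tau> v(1)] sum_eq f'_w .
    qed
    moreover have "\<exists>w\<in>ext (act g \<tau>). f' w \<noteq> 0"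
      using f(1,2) f'_a[OF f(1)] unfolding ext_act[OF g \<tau>] by force
    ultimately show ?thesis
      unfolding link_eigenvalue_def Union_link[OF act_simplex[OF g \<tau>]] by blast
  qed
  have "link_eigenvalue X n k (act g \<tau>) c \<longleftrightarrow> link_eigenvalue X n k \<tau> c" for c
    using le[OF g \<tau>, of c] le[OF inv_closed[OF g] act_simplex[OF g \<tau>], of c] act_inv[OF g \<tau>] by auto
  then show ?thesis by (simp add: lambda_min_def)
qed

lemma invariant_delete:
  assumes "invariant (Suc j) F" "i \<le> Suc j"
  shows "invariant j (\<lambda>\<tau>. \<Sum>v\<in>ext \<tau>. F (insert_nth i v \<tau>))"
  unfolding invariant_def
proof (intro ballI)
  fix g \<tau> assume g: "g \<in> carrier G" and \<tau>: "\<tau> \<in> simps j"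
  have "(\<Sum>v\<in>ext (act g \<tau>). F (insert_nth i v (act g \<tau>))) = (\<Sum>v\<in>ext \<tau>. F (insert_nth i (a g v) (act g \<tau>)))"
    by (rule sum_ext_act[OF g \<tau>])
  also have "\<dots> = (\<Sum>v\<in>ext \<tau>. F (insert_nth i v \<tau>))"
  proof (rule sum.cong)
    fix v assume v: "v \<in> ext \<tau>"
    have "F (act g (insert_nth i v \<tau>)) = F (insert_nth i v \<tau>)"
      using assms(1) g insert_nth_simplex[OF \<tau> v] unfolding invariant_def by blast
    then show "F (insert_nth i (a g v) (act g \<tau>)) = F (insert_nth i v \<tau>)" by (simp add: map_insert_nth)
  qed simp
  finally show "(\<Sum>v\<in>ext (act g \<tau>). F (insert_nth i v (act g \<tau>))) = (\<Sum>v\<in>ext \<tau>. F (insert_nth i v \<tau>))" .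
qed

end

section \<open>Square summable cochains\<close>

lemma delete_nth_append: "i < length xs \<Longrightarrow> delete_nth i (xs @ ys) = delete_nth i xs @ ys"
  by (simp add: delete_nth_def)

lemma delete_nth_append_right: "delete_nth (length xs + i) (xs @ ys) = xs @ delete_nth i ys"
  by (simp add: delete_nth_def)

lemma delete_nth_delete_nth:
  assumes "i \<le> l" "l + 1 < length \<sigma>"
  shows "delete_nth l (delete_nth i \<sigma>) = delete_nth i (delete_nth (Suc l) \<sigma>)"
proof (rule nth_equalityI)
  have nth: "delete_nth p xs ! q = xs ! (if q < p then q else Suc q)"
    if "p < length xs" "q < length xs - 1" for p q and xs :: "'a list"
    using that by (auto simp: delete_nth_def nth_append min_def)
  have len: "length (delete_nth p xs) = length xs - 1" if "p < length xs" for p and xs :: "'a list"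
    using that by (rule length_delete_nth)
  show "length (delete_nth l (delete_nth i \<sigma>)) = length (delete_nth i (delete_nth (Suc l) \<sigma>))"
    using assms by (simp add: len)
  fix q assume "q < length (delete_nth l (delete_nth i \<sigma>))"
  then have "q < length \<sigma> - 2" using assms by (simp add: len)
  then show "delete_nth l (delete_nth i \<sigma>) ! q = delete_nth i (delete_nth (Suc l) \<sigma>) ! q"
    using assms by (auto simp: len nth)
qed

text \<open>The combinatorics of \<open>d d = 0\<close>: the pair \<open>(i, l)\<close> with \<open>i \<le> l\<close> cancels against \<open>(l + 1, i)\<close>.\<close>

lemma sum_alternating_pairs_zero:
  fixes f :: "nat \<Rightarrow> nat \<Rightarrow> 'h::real_vector"
  assumes "\<And>i l. i \<le> l \<Longrightarrow> l \<le> m \<Longrightarrow> f i l = f (Suc l) i"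
  shows "(\<Sum>i\<le>Suc m. (-1) ^ i *\<^sub>R (\<Sum>l\<le>m. (-1) ^ l *\<^sub>R f i l)) = 0"
proof -
  let ?t = "\<lambda>(i, l). (-1) ^ (i + l) *\<^sub>R f i l"
  define A where "A = {(i, l). i \<le> l \<and> l \<le> m}"
  define B where "B = {(i, l). l < i \<and> i \<le> Suc m}"
  have fin: "finite A" "finite B"
    by (rule finite_subset[of _ "{..Suc m} \<times> {..Suc m}"]; auto simp: A_def B_def)+
  have bij: "bij_betw (\<lambda>(i, l). (Suc l, i)) A B"
    by (rule bij_betw_byWitness[where f' = "\<lambda>(i, l). (l, i - 1)"]) (auto simp: A_def B_def)
  have "(\<Sum>i\<le>Suc m. (-1) ^ i *\<^sub>R (\<Sum>l\<le>m. (-1) ^ l *\<^sub>R f i l)) = (\<Sum>i\<le>Suc m. \<Sum>l\<le>m. ?t (i, l))"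
    by (simp add: scaleR_sum_right power_add)
  also have "\<dots> = (\<Sum>x\<in>{..Suc m} \<times> {..m}. ?t x)" by (simp add: sum.cartesian_product case_prod_unfold)
  also have "{..Suc m} \<times> {..m} = A \<union> B" by (auto simp: A_def B_def)
  also have "(\<Sum>x\<in>A \<union> B. ?t x) = (\<Sum>x\<in>A. ?t x) + (\<Sum>x\<in>B. ?t x)"
    by (rule sum.union_disjoint[OF fin]) (auto simp: A_def B_def)
  also have "(\<Sum>x\<in>B. ?t x) = (\<Sum>x\<in>A. ?t ((\<lambda>(i, l). (Suc l, i)) x))"
    by (rule sum.reindex_bij_betw[OF bij, symmetric])
  also have "\<dots> = (\<Sum>x\<in>A. - ?t x)"
    by (intro sum.cong refl) (auto simp: A_def assms add.commute)
  finally show ?thesis by (simp add: sum_negf)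
qed

text \<open>Swapping the entries \<open>a\<close> and \<open>a + 1\<close> of a simplex exchanges its faces number \<open>a\<close> and \<open>a + 1\<close>, which carry
  opposite signs, and swaps two adjacent entries in all the other faces.\<close>

lemma swap_antisym_coboundary:
  fixes \<psi> :: "'v list \<Rightarrow> 'h::real_vector"
  assumes cx: "abstract_complex X" and \<psi>: "swap_antisym D \<psi>"
    and D: "\<And>\<sigma> i. \<sigma> \<in> ordered_simplices X (Suc j) \<Longrightarrow> i \<le> Suc j \<Longrightarrow> delete_nth i \<sigma> \<in> D"
  shows "swap_antisym (ordered_simplices X (Suc j)) (coboundary X j \<psi>)"
  unfolding swap_antisym_def
proof (intro allI impI)
  fix xs u v ys assume \<sigma>: "xs @ u # v # ys \<in> ordered_simplices X (Suc j)"
  let ?\<sigma> = "xs @ u # v # ys" and ?\<sigma>' = "xs @ v # u # ys" and ?a = "length xs"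
  let ?s = "Transposition.transpose ?a (Suc ?a)"
  have len: "length xs + length ys = j" using \<sigma> by (simp add: ordered_simplices_def)
  have \<sigma>': "?\<sigma>' \<in> ordered_simplices X (Suc j)" using \<sigma> by (auto simp: ordered_simplices_def insert_commute)
  have trm: "(-1) ^ i *\<^sub>R \<psi> (delete_nth i ?\<sigma>') = - ((-1) ^ ?s i *\<^sub>R \<psi> (delete_nth (?s i) ?\<sigma>))" if i: "i \<le> Suc j" for i
  proof -
    have d0: "delete_nth ?a (xs @ p # q # ys) = xs @ q # ys" for p q
      using delete_nth_append_right[of xs 0 "p # q # ys"] by (simp add: delete_nth_def)
    have d1: "delete_nth (Suc ?a) (xs @ p # q # ys) = xs @ p # ys" for p q
      using delete_nth_append_right[of xs 1 "p # q # ys"] by (simp add: delete_nth_def)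
    consider "i < ?a" | "i = ?a" | "i = Suc ?a" | "i > Suc ?a" by linarith
    then show ?thesis
    proof cases
      case 1
      have "delete_nth i xs @ u # v # ys \<in> D" using D[OF \<sigma> i] 1 by (simp add: delete_nth_append)
      then have "\<psi> (delete_nth i xs @ v # u # ys) = - \<psi> (delete_nth i xs @ u # v # ys)"
        using \<psi> unfolding swap_antisym_def by blast
      then show ?thesis using 1 by (simp add: delete_nth_append Transposition.transpose_def)
    next
      case 4
      define b where "b = i - ?a - 2"
      have i_eq: "i = ?a + Suc (Suc b)" using 4 by (simp add: b_def)
      have del: "delete_nth i (xs @ p # q # ys) = xs @ p # q # delete_nth b ys" for p q
        unfolding i_eq delete_nth_append_right by (simp add: delete_nth_def)
      have "xs @ u # v # delete_nth b ys \<in> D" using D[OF \<sigma> i] by (simp add: del)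
      then have "\<psi> (xs @ v # u # delete_nth b ys) = - \<psi> (xs @ u # v # delete_nth b ys)"
        using \<psi> unfolding swap_antisym_def by blast
      then show ?thesis using 4 by (simp add: del Transposition.transpose_def)
    qed (simp_all add: d0 d1)
  qed
  have perm: "bij_betw ?s {0..Suc j} {0..Suc j}"
    by (rule permutes_imp_bij, rule permutes_swap_id) (use len in auto)
  have "coboundary X j \<psi> ?\<sigma>' = (\<Sum>i = 0..Suc j. - ((-1) ^ ?s i *\<^sub>R \<psi> (delete_nth (?s i) ?\<sigma>)))"
    using \<sigma>' by (simp only: coboundary_def Suc_eq_plus1[symmetric] if_True) (intro sum.cong refl trm, simp)
  also have "\<dots> = - (\<Sum>i = 0..Suc j. (-1) ^ ?s i *\<^sub>R \<psi> (delete_nth (?s i) ?\<sigma>))"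
    by (rule sum_negf)
  also have "(\<Sum>i = 0..Suc j. (-1) ^ ?s i *\<^sub>R \<psi> (delete_nth (?s i) ?\<sigma>)) = (\<Sum>i = 0..Suc j. (-1) ^ i *\<^sub>R \<psi> (delete_nth i ?\<sigma>))"
    by (rule sum.reindex_bij_betw[OF perm, of "\<lambda>i. (-1) ^ i *\<^sub>R \<psi> (delete_nth i ?\<sigma>)"])
  also have "\<dots> = coboundary X j \<psi> ?\<sigma>"
    using \<sigma> by (simp only: coboundary_def Suc_eq_plus1[symmetric] if_True)
  finally show "coboundary X j \<psi> ?\<sigma>' = - coboundary X j \<psi> ?\<sigma>" .
qed

locale l2_cochains = lc_action X n G T \<mu> a R
  for X :: "'v set set" and n :: nat and G :: "('g, 'm) monoid_scheme" and T :: "'g topology"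
    and \<mu> :: "'g measure" and a :: "'g \<Rightarrow> 'v \<Rightarrow> 'v" and R :: "nat \<Rightarrow> 'v list set" +
  fixes \<rho> :: "'g \<Rightarrow> 'h::complex_hilbert \<Rightarrow> 'h"
  assumes rep: "unitary_representation G T \<rho>"
begin

abbreviation C :: "nat \<Rightarrow> ('v list \<Rightarrow> 'h) set" where "C \<equiv> cochains G X a \<rho>"
abbreviation L2 :: "nat \<Rightarrow> ('v list \<Rightarrow> 'h) set" where "L2 \<equiv> L2_cochains G \<mu> X n a R \<rho>"
abbreviation d :: "nat \<Rightarrow> ('v list \<Rightarrow> 'h) \<Rightarrow> 'v list \<Rightarrow> 'h" where "d \<equiv> coboundary X"

text \<open>This is \<open>(j + 1)!\<close> times the squared norm of the space of square summable cochains.\<close>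

definition nsq :: "nat \<Rightarrow> ('v list \<Rightarrow> 'h) \<Rightarrow> real" where
  "nsq j \<phi> = orbit_sum j (\<lambda>\<sigma>. weight \<sigma> * (norm (\<phi> \<sigma>))\<^sup>2)"

lemma unitary: "g \<in> carrier G \<Longrightarrow> unitary_operator (\<rho> g)"
  using rep by (simp add: unitary_representation_def)

lemma rho_bounded_linear: "g \<in> carrier G \<Longrightarrow> bounded_linear (\<rho> g)"
  by (rule unitary_operator_bounded_linear[OF unitary])

lemma simps_perm: "\<sigma> \<in> simps j \<Longrightarrow> mset \<sigma>' = mset \<sigma> \<Longrightarrow> \<sigma>' \<in> simps j"
  unfolding ordered_simplices_def
  by (auto dest: mset_eq_length mset_eq_setD mset_eq_imp_distinct_iff)

lemma cochain_outside: "\<phi> \<in> C j \<Longrightarrow> \<sigma> \<notin> simps j \<Longrightarrow> \<phi> \<sigma> = 0"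
  by (simp add: cochains_def)

lemma cochain_act: "\<phi> \<in> C j \<Longrightarrow> g \<in> carrier G \<Longrightarrow> \<sigma> \<in> simps j \<Longrightarrow> \<phi> (act g \<sigma>) = \<rho> g (\<phi> \<sigma>)"
  by (simp add: cochains_def)

lemma cochain_antisym: "\<phi> \<in> C j \<Longrightarrow> swap_antisym (simps j) \<phi>"
  by (rule swap_antisym_if_alternating) (simp add: cochains_def)

lemma cochainI:
  assumes "\<And>\<sigma>. \<sigma> \<notin> simps j \<Longrightarrow> \<phi> \<sigma> = 0" "swap_antisym (simps j) \<phi>"
    and "\<And>g \<sigma>. g \<in> carrier G \<Longrightarrow> \<sigma> \<in> simps j \<Longrightarrow> \<phi> (act g \<sigma>) = \<rho> g (\<phi> \<sigma>)"
  shows "\<phi> \<in> C j"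
proof -
  have "\<forall>\<sigma>. \<sigma> \<notin> simps j \<longrightarrow> \<phi> \<sigma> = 0" by (intro allI impI assms(1))
  moreover have "\<forall>\<sigma>\<in>simps j. \<forall>\<pi>. \<pi> permutes {..<length \<sigma>} \<longrightarrow>
      \<phi> (permute_list \<pi> \<sigma>) = of_int (sign \<pi>) *\<^sub>R \<phi> \<sigma>"
    by (intro allI ballI impI swap_antisym_permute[OF assms(2) simps_perm])
  moreover have "\<forall>g\<in>carrier G. \<forall>\<sigma>\<in>simps j. \<phi> (act g \<sigma>) = \<rho> g (\<phi> \<sigma>)"
    by (intro ballI assms(3))
  ultimately show ?thesis unfolding cochains_def by (intro CollectI conjI)
qed

lemma cochain_norm_act: "\<phi> \<in> C j \<Longrightarrow> g \<in> carrier G \<Longrightarrow> \<sigma> \<in> simps j \<Longrightarrow> norm (\<phi> (act g \<sigma>)) = norm (\<phi> \<sigma>)"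
  by (simp add: cochain_act unitary_operator_norm unitary)

lemma cochain_insert:
  assumes \<phi>: "\<phi> \<in> C (Suc j)" and \<tau>: "\<tau> \<in> simps j" and v: "v \<in> ext \<tau>" and i: "i \<le> Suc j"
  shows "\<phi> (insert_nth i v \<tau>) = (-1) ^ (Suc j - i) *\<^sub>R \<phi> (\<tau> @ [v])"
proof -
  have len: "length \<tau> = Suc j" using \<tau> by (simp add: ordered_simplices_def)
  have "take i \<tau> @ v # drop i \<tau> @ [] \<in> simps (Suc j)"
    using insert_nth_simplex[OF \<tau> v, of i] by (simp add: insert_nth_def)
  from swap_antisym_move[OF cochain_antisym[OF \<phi>] simps_perm this]
  have "\<phi> (take i \<tau> @ v # drop i \<tau> @ []) = (-1) ^ length (drop i \<tau>) *\<^sub>R \<phi> (take i \<tau> @ drop i \<tau> @ [v])" .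
  moreover have "take i \<tau> @ drop i \<tau> @ [v] = \<tau> @ [v]" by (metis append.assoc append_take_drop_id)
  ultimately show ?thesis using len by (simp add: insert_nth_def)
qed

lemma L2_iff: "\<phi> \<in> L2 j \<longleftrightarrow> \<phi> \<in> C j \<and> orbit_summable j (\<lambda>\<sigma>. weight \<sigma> * (norm (\<phi> \<sigma>))\<^sup>2)"
proof -
  have "(\<lambda>\<sigma>. weight \<sigma> / (fact (j + 1) * vol \<sigma>) * (norm (\<phi> \<sigma>))\<^sup>2) =
      (\<lambda>\<sigma>. (1 / fact (j + 1)) * (weight \<sigma> * (norm (\<phi> \<sigma>))\<^sup>2 / vol \<sigma>))"
    by (rule ext) simp
  then have "(\<lambda>\<sigma>. weight \<sigma> / (fact (j + 1) * vol \<sigma>) * (norm (\<phi> \<sigma>))\<^sup>2) summable_on R j \<longleftrightarrow>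
      orbit_summable j (\<lambda>\<sigma>. weight \<sigma> * (norm (\<phi> \<sigma>))\<^sup>2)"
    unfolding orbit_summable_def
    by (simp only:) (rule summable_on_cmult_right', simp)
  then show ?thesis by (simp only: L2_cochains_def mem_Collect_eq)
qed

lemma L2_cochain: "\<phi> \<in> L2 j \<Longrightarrow> \<phi> \<in> C j"
  and L2_summable: "\<phi> \<in> L2 j \<Longrightarrow> orbit_summable j (\<lambda>\<sigma>. weight \<sigma> * (norm (\<phi> \<sigma>))\<^sup>2)"
  by (simp_all add: L2_iff)

lemma cochain_zero: "(\<lambda>\<sigma>. 0) \<in> C j"
  by (rule cochainI)
    (use rho_bounded_linear in \<open>auto simp: swap_antisym_def bounded_linear.linear linear_0\<close>)

lemma cochain_add:
  assumes "\<phi> \<in> C j" "\<psi> \<in> C j"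
  shows "(\<lambda>\<sigma>. \<phi> \<sigma> + \<psi> \<sigma>) \<in> C j"
proof (rule cochainI)
  show "swap_antisym (simps j) (\<lambda>\<sigma>. \<phi> \<sigma> + \<psi> \<sigma>)"
    using cochain_antisym[OF assms(1)] cochain_antisym[OF assms(2)] by (simp add: swap_antisym_def)
  show "\<phi> (act g \<sigma>) + \<psi> (act g \<sigma>) = \<rho> g (\<phi> \<sigma> + \<psi> \<sigma>)" if "g \<in> carrier G" "\<sigma> \<in> simps j" for g \<sigma>
    using that assms rho_bounded_linear[OF that(1)]
    by (simp add: cochain_act linear_add bounded_linear.linear)
qed (simp add: cochain_outside[OF assms(1)] cochain_outside[OF assms(2)])

lemma cochain_scale:
  assumes "\<phi> \<in> C j"
  shows "(\<lambda>\<sigma>. c *\<^sub>R \<phi> \<sigma>) \<in> C j"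
proof (rule cochainI)
  show "swap_antisym (simps j) (\<lambda>\<sigma>. c *\<^sub>R \<phi> \<sigma>)"
    using cochain_antisym[OF assms(1)] by (simp add: swap_antisym_def)
  show "c *\<^sub>R \<phi> (act g \<sigma>) = \<rho> g (c *\<^sub>R \<phi> \<sigma>)" if "g \<in> carrier G" "\<sigma> \<in> simps j" for g \<sigma>
    using that assms rho_bounded_linear[OF that(1)]
    by (simp add: cochain_act linear_scale bounded_linear.linear)
qed (simp add: cochain_outside[OF assms])

lemma L2_zero: "(\<lambda>\<sigma>. 0) \<in> L2 j"
  by (simp add: L2_iff cochain_zero orbit_summable_def)

lemma L2_add:
  assumes "\<phi> \<in> L2 j" "\<psi> \<in> L2 j"
  shows "(\<lambda>\<sigma>. \<phi> \<sigma> + \<psi> \<sigma>) \<in> L2 j"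
proof -
  have "orbit_summable j (\<lambda>\<sigma>. weight \<sigma> * (norm (\<phi> \<sigma> + \<psi> \<sigma>))\<^sup>2)"
  proof (rule orbit_summable_bound)
    show "orbit_summable j (\<lambda>\<sigma>. 2 * (weight \<sigma> * (norm (\<phi> \<sigma>))\<^sup>2) + 2 * (weight \<sigma> * (norm (\<psi> \<sigma>))\<^sup>2))"
      by (intro orbit_summable_add orbit_summable_cmult L2_summable assms)
    fix \<sigma>
    have "(norm (\<phi> \<sigma> + \<psi> \<sigma>))\<^sup>2 \<le> (norm (\<phi> \<sigma>) + norm (\<psi> \<sigma>))\<^sup>2"
      by (intro power_mono norm_triangle_ineq) simp
    also have "\<dots> \<le> 2 * (norm (\<phi> \<sigma>))\<^sup>2 + 2 * (norm (\<psi> \<sigma>))\<^sup>2"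
      using zero_le_power2[of "norm (\<phi> \<sigma>) - norm (\<psi> \<sigma>)"] by (simp add: power2_sum power2_diff)
    finally have "weight \<sigma> * (norm (\<phi> \<sigma> + \<psi> \<sigma>))\<^sup>2 \<le> weight \<sigma> * (2 * (norm (\<phi> \<sigma>))\<^sup>2 + 2 * (norm (\<psi> \<sigma>))\<^sup>2)"
      by (rule mult_left_mono) simp
    then show "\<bar>weight \<sigma> * (norm (\<phi> \<sigma> + \<psi> \<sigma>))\<^sup>2\<bar> \<le> 2 * (weight \<sigma> * (norm (\<phi> \<sigma>))\<^sup>2) + 2 * (weight \<sigma> * (norm (\<psi> \<sigma>))\<^sup>2)"
      by (simp add: algebra_simps)
  qed
  then show ?thesis using assms by (simp add: L2_iff cochain_add)
qed

lemma L2_scale: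
  assumes "\<phi> \<in> L2 j"
  shows "(\<lambda>\<sigma>. c *\<^sub>R \<phi> \<sigma>) \<in> L2 j"
proof -
  have "orbit_summable j (\<lambda>\<sigma>. c\<^sup>2 * (weight \<sigma> * (norm (\<phi> \<sigma>))\<^sup>2))"
    by (intro orbit_summable_cmult L2_summable assms)
  moreover have "(\<lambda>\<sigma>. c\<^sup>2 * (weight \<sigma> * (norm (\<phi> \<sigma>))\<^sup>2)) = (\<lambda>\<sigma>. weight \<sigma> * (norm (c *\<^sub>R \<phi> \<sigma>))\<^sup>2)"
    by (rule ext) (simp add: power_mult_distrib)
  ultimately show ?thesis using assms by (simp add: L2_iff cochain_scale)
qed

lemma coboundary_simplex: "\<sigma> \<in> simps (Suc j) \<Longrightarrow> d j \<psi> \<sigma> = (\<Sum>i\<le>Suc j. (-1) ^ i *\<^sub>R \<psi> (delete_nth i \<sigma>))"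
  by (simp only: coboundary_def Suc_eq_plus1[symmetric] if_True atMost_atLeast0)

lemma coboundary_cochain:
  assumes \<psi>: "\<psi> \<in> C j"
  shows "d j \<psi> \<in> C (Suc j)"
proof (rule cochainI)
  show "swap_antisym (simps (Suc j)) (d j \<psi>)"
    by (rule swap_antisym_coboundary[OF cx cochain_antisym[OF \<psi>] delete_nth_simplex])
  show "d j \<psi> \<sigma> = 0" if "\<sigma> \<notin> simps (Suc j)" for \<sigma> using that by (simp add: coboundary_def)
  fix g \<sigma> assume g: "g \<in> carrier G" and \<sigma>: "\<sigma> \<in> simps (Suc j)"
  have lin: "linear (\<rho> g)" by (rule bounded_linear.linear[OF rho_bounded_linear[OF g]])
  have "\<psi> (delete_nth i (act g \<sigma>)) = \<rho> g (\<psi> (delete_nth i \<sigma>))" if "i \<le> Suc j" for i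
    using cochain_act[OF \<psi> g delete_nth_simplex[OF \<sigma> that]] by (simp only: map_delete_nth)
  then show "d j \<psi> (act g \<sigma>) = \<rho> g (d j \<psi> \<sigma>)"
    unfolding coboundary_simplex[OF \<sigma>] coboundary_simplex[OF act_simplex[OF g \<sigma>]] linear_sum[OF lin]
    by (intro sum.cong refl) (simp add: linear_scale[OF lin])
qed

lemma coboundary_coboundary: "d (Suc j) (d j \<psi>) = (\<lambda>\<sigma>. 0)"
proof
  fix \<sigma> show "d (Suc j) (d j \<psi>) \<sigma> = 0"
  proof (cases "\<sigma> \<in> simps (Suc (Suc j))")
    case True
    then have len: "length \<sigma> = j + 3" by (simp add: ordered_simplices_def)
    have "d (Suc j) (d j \<psi>) \<sigma>
        = (\<Sum>i\<le>Suc (Suc j). (-1) ^ i *\<^sub>R (\<Sum>l\<le>Suc j. (-1) ^ l *\<^sub>R \<psi> (delete_nth l (delete_nth i \<sigma>))))"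
      unfolding coboundary_simplex[OF True]
      by (intro sum.cong refl) (simp only: atMost_iff coboundary_simplex[OF delete_nth_simplex[OF True]])
    also have "\<dots> = 0"
      by (rule sum_alternating_pairs_zero) (use len in \<open>simp add: delete_nth_delete_nth\<close>)
    finally show ?thesis .
  qed (simp add: coboundary_def)
qed

lemma invariantD: "invariant j F \<Longrightarrow> g \<in> carrier G \<Longrightarrow> \<sigma> \<in> simps j \<Longrightarrow> F (act g \<sigma>) = F \<sigma>"
  unfolding invariant_def by simp

text \<open>Every \<open>j\<close>-simplex \<open>\<tau>\<close> lies below \<open>(j+1)\<close>-simplices of total multiplicity \<open>(n - j) m(\<tau>)\<close>.\<close>

lemma
  assumes i: "i \<le> Suc j" and inv: "invariant j F" and sm: "orbit_summable j (\<lambda>\<tau>. weight \<tau> * F \<tau>)"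
  shows orbit_summable_pull: "orbit_summable (Suc j) (\<lambda>\<sigma>. weight \<sigma> * F (delete_nth i \<sigma>))"
    and orbit_sum_pull: "orbit_sum (Suc j) (\<lambda>\<sigma>. weight \<sigma> * F (delete_nth i \<sigma>))
      = (real n - real j) * orbit_sum j (\<lambda>\<tau>. weight \<tau> * F \<tau>)"
proof -
  have inv': "invariant (Suc j) (\<lambda>\<sigma>. weight \<sigma> * f (delete_nth i \<sigma>))" if "invariant j f" for f
    unfolding invariant_def
  proof (intro ballI)
    fix g \<sigma> assume g: "g \<in> carrier G" and \<sigma>: "\<sigma> \<in> simps (Suc j)"
    have "f (act g (delete_nth i \<sigma>)) = f (delete_nth i \<sigma>)"
      by (rule invariantD[OF that g delete_nth_simplex[OF \<sigma> i]])
    then show "weight (act g \<sigma>) * f (delete_nth i (act g \<sigma>)) = weight \<sigma> * f (delete_nth i \<sigma>)"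
      by (simp only: weight_act[OF g \<sigma>] map_delete_nth)
  qed
  have push: "(\<Sum>v\<in>ext \<tau>. weight (insert_nth i v \<tau>) * f (delete_nth i (insert_nth i v \<tau>)))
      = (real n - real j) * (weight \<tau> * f \<tau>)" if \<tau>: "\<tau> \<in> simps j" for f \<tau>
  proof -
    have len: "i \<le> length \<tau>" using i \<tau> by (simp add: ordered_simplices_def)
    have "(\<Sum>v\<in>ext \<tau>. weight (insert_nth i v \<tau>) * f (delete_nth i (insert_nth i v \<tau>)))
        = (\<Sum>v\<in>ext \<tau>. weight (\<tau> @ [v]) * f \<tau>)"
    proof (rule sum.cong)
      fix v
      have "weight (insert_nth i v \<tau>) = weight (\<tau> @ [v])" by (intro arg_cong[of _ _ real] top_count_cong) simp
      then show "weight (insert_nth i v \<tau>) * f (delete_nth i (insert_nth i v \<tau>)) = weight (\<tau> @ [v]) * f \<tau>"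
        by (simp only: delete_insert_nth[OF len])
    qed simp
    also have "\<dots> = (real n - real j) * (weight \<tau> * f \<tau>)"
      unfolding sum_distrib_right[symmetric] sum_weight_ext[OF \<tau>] by simp
    finally show ?thesis .
  qed
  have "orbit_summable (Suc j) (\<lambda>\<sigma>. weight \<sigma> * \<bar>F (delete_nth i \<sigma>)\<bar>)"
  proof (rule orbit_summable_if_delete[OF i inv'[of "\<lambda>\<tau>. \<bar>F \<tau>\<bar>"]])
    show "invariant j (\<lambda>\<tau>. \<bar>F \<tau>\<bar>)" using inv by (simp add: invariant_def)
    have abs: "orbit_summable j (\<lambda>\<tau>. weight \<tau> * \<bar>F \<tau>\<bar>)"
    proof -
      have "(\<lambda>\<tau>. norm (weight \<tau> * F \<tau> / vol \<tau>)) summable_on R j"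
        by (rule summable_on_iff_abs_summable_on_real[THEN iffD1, OF sm[unfolded orbit_summable_def]])
      moreover have "norm (weight \<tau> * F \<tau> / vol \<tau>) = weight \<tau> * \<bar>F \<tau>\<bar> / vol \<tau>" for \<tau>
        by (simp add: abs_mult)
      ultimately show ?thesis unfolding orbit_summable_def by (simp only:)
    qed
    show "orbit_summable j (\<lambda>\<tau>. \<Sum>v\<in>ext \<tau>. weight (insert_nth i v \<tau>) * \<bar>F (delete_nth i (insert_nth i v \<tau>))\<bar>)"
    proof (rule orbit_summable_cong[THEN iffD2])
      show "orbit_summable j (\<lambda>\<tau>. (real n - real j) * (weight \<tau> * \<bar>F \<tau>\<bar>))"
        by (rule orbit_summable_cmult[OF abs])
    qed (rule push[of _ "\<lambda>\<tau>. \<bar>F \<tau>\<bar>"])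
  qed simp
  then show s: "orbit_summable (Suc j) (\<lambda>\<sigma>. weight \<sigma> * F (delete_nth i \<sigma>))"
    by (rule orbit_summable_bound) (simp add: abs_mult)
  show "orbit_sum (Suc j) (\<lambda>\<sigma>. weight \<sigma> * F (delete_nth i \<sigma>)) = (real n - real j) * orbit_sum j (\<lambda>\<tau>. weight \<tau> * F \<tau>)"
    unfolding orbit_sum_delete[OF i inv'[OF inv] s] orbit_sum_cmult[symmetric]
    by (rule orbit_sum_cong) (rule push)
qed

lemma invariant_norm: "\<phi> \<in> C j \<Longrightarrow> invariant j (\<lambda>\<sigma>. (norm (\<phi> \<sigma>))\<^sup>2)"
  unfolding invariant_def by (intro ballI) (simp only: cochain_norm_act[where j = j])

lemma coboundary_norm_le:
  assumes \<psi>: "\<psi> \<in> L2 j"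
  shows coboundary_L2: "d j \<psi> \<in> L2 (Suc j)"
    and nsq_coboundary_le: "nsq (Suc j) (d j \<psi>) \<le> (real j + 2)\<^sup>2 * (real n - real j) * nsq j \<psi>"
proof -
  let ?B = "\<lambda>\<sigma>. (real j + 2) * (\<Sum>i\<le>Suc j. weight \<sigma> * (norm (\<psi> (delete_nth i \<sigma>)))\<^sup>2)"
  have le: "weight \<sigma> * (norm (d j \<psi> \<sigma>))\<^sup>2 \<le> ?B \<sigma>" if \<sigma>: "\<sigma> \<in> simps (Suc j)" for \<sigma>
  proof -
    have "(norm (d j \<psi> \<sigma>))\<^sup>2 \<le> (\<Sum>i\<le>Suc j. 1) * (\<Sum>i\<le>Suc j. 1 * (norm ((-1) ^ i *\<^sub>R \<psi> (delete_nth i \<sigma>)))\<^sup>2)"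
      using norm_sum_weighted_square_le[of "{..Suc j}" "\<lambda>_. 1" "\<lambda>i. (-1) ^ i *\<^sub>R \<psi> (delete_nth i \<sigma>)"]
      unfolding coboundary_simplex[OF \<sigma>] by simp
    also have "\<dots> = (real j + 2) * (\<Sum>i\<le>Suc j. (norm (\<psi> (delete_nth i \<sigma>)))\<^sup>2)"
      by (simp add: power_abs del: sum.atMost_Suc)
    finally have "weight \<sigma> * (norm (d j \<psi> \<sigma>))\<^sup>2 \<le> weight \<sigma> * ((real j + 2) * (\<Sum>i\<le>Suc j. (norm (\<psi> (delete_nth i \<sigma>)))\<^sup>2))"
      by (rule mult_left_mono) simp
    then show ?thesis by (simp add: sum_distrib_left mult_ac del: sum.atMost_Suc)
  qed
  have trm: "orbit_summable (Suc j) (\<lambda>\<sigma>. weight \<sigma> * (norm (\<psi> (delete_nth i \<sigma>)))\<^sup>2)"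
    "orbit_sum (Suc j) (\<lambda>\<sigma>. weight \<sigma> * (norm (\<psi> (delete_nth i \<sigma>)))\<^sup>2) = (real n - real j) * nsq j \<psi>"
    if "i \<le> Suc j" for i
    using orbit_summable_pull[OF that invariant_norm[OF L2_cochain[OF \<psi>]] L2_summable[OF \<psi>]]
      orbit_sum_pull[OF that invariant_norm[OF L2_cochain[OF \<psi>]] L2_summable[OF \<psi>]]
    unfolding nsq_def by blast+
  have sB: "orbit_summable (Suc j) ?B"
    by (intro orbit_summable_cmult orbit_summable_sum trm) simp
  have s: "orbit_summable (Suc j) (\<lambda>\<sigma>. weight \<sigma> * (norm (d j \<psi> \<sigma>))\<^sup>2)"
    by (rule orbit_summable_bound[OF sB]) (use le in simp)
  then show "d j \<psi> \<in> L2 (Suc j)" using coboundary_cochain[OF L2_cochain[OF \<psi>]] by (simp add: L2_iff)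
  have "nsq (Suc j) (d j \<psi>) \<le> orbit_sum (Suc j) ?B"
    unfolding nsq_def by (rule orbit_sum_mono[OF s sB]) (use le R_simplex in blast)
  also have "\<dots> = (real j + 2) * (\<Sum>i\<le>Suc j. orbit_sum (Suc j) (\<lambda>\<sigma>. weight \<sigma> * (norm (\<psi> (delete_nth i \<sigma>)))\<^sup>2))"
    unfolding orbit_sum_cmult by (subst orbit_sum_sum) (use trm in auto)
  also have "\<dots> = (real j + 2) * (\<Sum>i\<le>Suc j. (real n - real j) * nsq j \<psi>)"
    by (intro arg_cong[of _ _ "(*) _"] sum.cong refl trm) simp
  also have "\<dots> = (real j + 2)\<^sup>2 * (real n - real j) * nsq j \<psi>"
    by (simp add: power2_eq_square algebra_simps)
  finally show "nsq (Suc j) (d j \<psi>) \<le> (real j + 2)\<^sup>2 * (real n - real j) * nsq j \<psi>" .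
qed

text \<open>Up to the factor \<open>j + 2\<close>, this is the adjoint of \<open>d\<close> for the norms \<open>nsq\<close>.\<close>

definition codiff :: "nat \<Rightarrow> ('v list \<Rightarrow> 'h) \<Rightarrow> 'v list \<Rightarrow> 'h" where
  "codiff j \<phi> \<tau> = (if \<tau> \<in> simps j
     then (-1) ^ Suc j *\<^sub>R (\<Sum>v\<in>ext \<tau>. (weight (\<tau> @ [v]) / weight \<tau>) *\<^sub>R \<phi> (\<tau> @ [v])) else 0)"

lemma codiff_cochain:
  assumes \<phi>: "\<phi> \<in> C (Suc j)"
  shows "codiff j \<phi> \<in> C j"
proof (rule cochainI)
  show "swap_antisym (simps j) (codiff j \<phi>)"
    unfolding swap_antisym_def
  proof (intro allI impI)
    fix xs u v ys assume \<tau>: "xs @ u # v # ys \<in> simps j"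
    let ?\<tau> = "xs @ u # v # ys" and ?\<tau>' = "xs @ v # u # ys"
    have \<tau>': "?\<tau>' \<in> simps j" by (rule simps_perm[OF \<tau>]) simp
    have st: "set ?\<tau>' = set ?\<tau>" by auto
    have m: "weight (?\<tau>' @ [w]) = weight (?\<tau> @ [w])" for w
      by (intro arg_cong[of _ _ real] top_count_cong) auto
    have "\<phi> (?\<tau>' @ [w]) = - \<phi> (?\<tau> @ [w])" if "w \<in> ext ?\<tau>" for w
      using cochain_antisym[OF \<phi>] append_simplex[OF \<tau> that] unfolding swap_antisym_def
      by (simp only: append_assoc append_Cons)
    then have "(\<Sum>w\<in>ext ?\<tau>'. (weight (?\<tau>' @ [w]) / weight ?\<tau>') *\<^sub>R \<phi> (?\<tau>' @ [w]))
        = (\<Sum>w\<in>ext ?\<tau>. - ((weight (?\<tau> @ [w]) / weight ?\<tau>) *\<^sub>R \<phi> (?\<tau> @ [w])))"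
      unfolding ext_verts_cong[OF st] top_count_cong[OF st] m
      by (intro sum.cong refl) (simp only: scaleR_minus_right)
    then show "codiff j \<phi> ?\<tau>' = - codiff j \<phi> ?\<tau>"
      using \<tau> \<tau>' by (simp only: codiff_def if_True sum_negf scaleR_minus_right)
  qed
  show "codiff j \<phi> \<tau> = 0" if "\<tau> \<notin> simps j" for \<tau> using that by (simp add: codiff_def)
  fix g \<tau> assume g: "g \<in> carrier G" and \<tau>: "\<tau> \<in> simps j"
  have lin: "linear (\<rho> g)" by (rule bounded_linear.linear[OF rho_bounded_linear[OF g]])
  have "(\<Sum>v\<in>ext (act g \<tau>). (weight (act g \<tau> @ [v]) / weight (act g \<tau>)) *\<^sub>R \<phi> (act g \<tau> @ [v]))
      = (\<Sum>v\<in>ext \<tau>. (weight (act g \<tau> @ [a g v]) / weight (act g \<tau>)) *\<^sub>R \<phi> (act g \<tau> @ [a g v]))"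
    unfolding ext_act[OF g \<tau>] by (rule sum.reindex_cong[OF inj_on_ext[OF g]]) auto
  also have "\<dots> = (\<Sum>v\<in>ext \<tau>. \<rho> g ((weight (\<tau> @ [v]) / weight \<tau>) *\<^sub>R \<phi> (\<tau> @ [v])))"
  proof (rule sum.cong)
    fix v assume v: "v \<in> ext \<tau>"
    have eq: "act g \<tau> @ [a g v] = act g (\<tau> @ [v])" by simp
    have \<sigma>: "\<tau> @ [v] \<in> simps (Suc j)" by (rule append_simplex[OF \<tau> v])
    show "(weight (act g \<tau> @ [a g v]) / weight (act g \<tau>)) *\<^sub>R \<phi> (act g \<tau> @ [a g v])
        = \<rho> g ((weight (\<tau> @ [v]) / weight \<tau>) *\<^sub>R \<phi> (\<tau> @ [v]))"
      unfolding eq weight_act[OF g \<tau>] weight_act[OF g \<sigma>] cochain_act[OF \<phi> g \<sigma>] linear_scale[OF lin] ..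
  qed simp
  finally show "codiff j \<phi> (act g \<tau>) = \<rho> g (codiff j \<phi> \<tau>)"
    using \<tau> act_simplex[OF g \<tau>]
    by (simp only: codiff_def if_True linear_sum[OF lin] linear_scale[OF lin])
qed

text \<open>The squared norm of the function \<open>v \<mapsto> \<phi>(\<tau>v)\<close> on the vertices of the link of \<open>\<tau>\<close>.\<close>

definition link_norm :: "('v list \<Rightarrow> 'h) \<Rightarrow> 'v list \<Rightarrow> real" where
  "link_norm \<phi> \<tau> = (\<Sum>v\<in>ext \<tau>. weight (\<tau> @ [v]) * (norm (\<phi> (\<tau> @ [v])))\<^sup>2)"

text \<open>A weight \<open>c\<close> on one face of each simplex becomes a weight on the links. As \<open>\<phi>\<close> alternates, its norm does not
  see at which position the vertex of the link is inserted, and all faces give the same sum.\<close>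

lemma
  assumes \<phi>: "\<phi> \<in> L2 (Suc j)" and i: "i \<le> Suc j"
    and c: "invariant j c" and bound: "\<And>\<tau>. \<tau> \<in> simps j \<Longrightarrow> \<bar>c \<tau>\<bar> \<le> b"
  shows orbit_summable_face_weight: "orbit_summable (Suc j) (\<lambda>\<sigma>. weight \<sigma> * c (delete_nth i \<sigma>) * (norm (\<phi> \<sigma>))\<^sup>2)"
    and orbit_summable_link_norm: "orbit_summable j (\<lambda>\<tau>. c \<tau> * link_norm \<phi> \<tau>)"
    and orbit_sum_face_weight: "orbit_sum (Suc j) (\<lambda>\<sigma>. weight \<sigma> * c (delete_nth i \<sigma>) * (norm (\<phi> \<sigma>))\<^sup>2)
      = orbit_sum j (\<lambda>\<tau>. c \<tau> * link_norm \<phi> \<tau>)"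
proof -
  let ?F = "\<lambda>\<sigma>. weight \<sigma> * c (delete_nth i \<sigma>) * (norm (\<phi> \<sigma>))\<^sup>2"
  have inv: "invariant (Suc j) ?F"
    unfolding invariant_def
  proof (intro ballI)
    fix g \<sigma> assume g: "g \<in> carrier G" and \<sigma>: "\<sigma> \<in> simps (Suc j)"
    have "c (act g (delete_nth i \<sigma>)) = c (delete_nth i \<sigma>)"
      by (rule invariantD[OF c g delete_nth_simplex[OF \<sigma> i]])
    then show "?F (act g \<sigma>) = ?F \<sigma>"
      by (simp only: weight_act[OF g \<sigma>] map_delete_nth cochain_norm_act[OF L2_cochain[OF \<phi>] g \<sigma>])
  qed
  show s: "orbit_summable (Suc j) ?F"
  proof (rule orbit_summable_bound[OF orbit_summable_cmult[OF L2_summable[OF \<phi>], of b]])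
    fix \<sigma> assume \<sigma>: "\<sigma> \<in> simps (Suc j)"
    have "\<bar>c (delete_nth i \<sigma>)\<bar> * (weight \<sigma> * (norm (\<phi> \<sigma>))\<^sup>2) \<le> b * (weight \<sigma> * (norm (\<phi> \<sigma>))\<^sup>2)"
      by (rule mult_right_mono[OF bound[OF delete_nth_simplex[OF \<sigma> i]]]) simp
    then show "\<bar>?F \<sigma>\<bar> \<le> b * (weight \<sigma> * (norm (\<phi> \<sigma>))\<^sup>2)" by (simp add: abs_mult mult_ac)
  qed
  have push: "(\<Sum>v\<in>ext \<tau>. ?F (insert_nth i v \<tau>)) = c \<tau> * link_norm \<phi> \<tau>" if \<tau>: "\<tau> \<in> simps j" for \<tau>
  proof -
    have len: "i \<le> length \<tau>" using i \<tau> by (simp add: ordered_simplices_def)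
    have "?F (insert_nth i v \<tau>) = c \<tau> * (weight (\<tau> @ [v]) * (norm (\<phi> (\<tau> @ [v])))\<^sup>2)" if v: "v \<in> ext \<tau>" for v
    proof -
      have "weight (insert_nth i v \<tau>) = weight (\<tau> @ [v])" by (intro arg_cong[of _ _ real] top_count_cong) simp
      moreover have "norm (\<phi> (insert_nth i v \<tau>)) = norm (\<phi> (\<tau> @ [v]))"
        unfolding cochain_insert[OF L2_cochain[OF \<phi>] \<tau> v i] by simp
      ultimately show ?thesis by (simp add: delete_insert_nth[OF len])
    qed
    then show ?thesis by (simp add: link_norm_def sum_distrib_left)
  qed
  show "orbit_summable j (\<lambda>\<tau>. c \<tau> * link_norm \<phi> \<tau>)"
    by (rule orbit_summable_cong[THEN iffD1, OF _ orbit_summable_delete[OF i inv s]]) (rule push)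
  show "orbit_sum (Suc j) ?F = orbit_sum j (\<lambda>\<tau>. c \<tau> * link_norm \<phi> \<tau>)"
    unfolding orbit_sum_delete[OF i inv s] by (rule orbit_sum_cong) (rule push)
qed

lemma link_norm_summable: "\<phi> \<in> L2 (Suc j) \<Longrightarrow> orbit_summable j (link_norm \<phi>)"
  and orbit_sum_link_norm: "\<phi> \<in> L2 (Suc j) \<Longrightarrow> orbit_sum j (link_norm \<phi>) = nsq (Suc j) \<phi>"
proof -
  have one: "invariant j (\<lambda>_. 1)" by (simp add: invariant_def)
  show "orbit_summable j (link_norm \<phi>)" if \<phi>: "\<phi> \<in> L2 (Suc j)"
    using orbit_summable_link_norm[OF \<phi> le0 one, of 1] by simp
  show "orbit_sum j (link_norm \<phi>) = nsq (Suc j) \<phi>" if \<phi>: "\<phi> \<in> L2 (Suc j)"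
    using orbit_sum_face_weight[OF \<phi> le0 one, of 1] by (simp add: nsq_def)
qed

text \<open>By the Cauchy-Schwarz inequality, since \<open>codiff j \<phi> \<tau>\<close> is, up to sign, \<open>n - j\<close> times a mean value over the link.\<close>

lemma codiff_norm_le:
  assumes \<phi>: "\<phi> \<in> L2 (Suc j)"
  shows codiff_L2: "codiff j \<phi> \<in> L2 j"
    and nsq_codiff_le: "nsq j (codiff j \<phi>) \<le> (real n - real j) * nsq (Suc j) \<phi>"
proof -
  have le: "weight \<tau> * (norm (codiff j \<phi> \<tau>))\<^sup>2 \<le> (real n - real j) * link_norm \<phi> \<tau>" if \<tau>: "\<tau> \<in> simps j" for \<tau>
  proof -
    let ?w = "\<lambda>v. weight (\<tau> @ [v]) / weight \<tau>"
    have pos: "weight \<tau> > 0" by (rule weight_pos[OF \<tau>])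
    have "norm (codiff j \<phi> \<tau>) = norm (\<Sum>v\<in>ext \<tau>. ?w v *\<^sub>R \<phi> (\<tau> @ [v]))"
      using \<tau> by (simp add: codiff_def)
    then have "(norm (codiff j \<phi> \<tau>))\<^sup>2 \<le> (\<Sum>v\<in>ext \<tau>. ?w v) * (\<Sum>v\<in>ext \<tau>. ?w v * (norm (\<phi> (\<tau> @ [v])))\<^sup>2)"
      using norm_sum_weighted_square_le[of "ext \<tau>" ?w "\<lambda>v. \<phi> (\<tau> @ [v])"] by simp
    also have "(\<Sum>v\<in>ext \<tau>. ?w v) = real n - real j"
      using pos sum_weight_ext[OF \<tau>] by (simp flip: sum_divide_distrib)
    also have "(\<Sum>v\<in>ext \<tau>. ?w v * (norm (\<phi> (\<tau> @ [v])))\<^sup>2) = link_norm \<phi> \<tau> / weight \<tau>"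
      by (simp add: link_norm_def sum_divide_distrib)
    finally show ?thesis using pos by (simp add: field_simps)
  qed
  have s': "orbit_summable j (\<lambda>\<tau>. (real n - real j) * link_norm \<phi> \<tau>)"
    by (rule orbit_summable_cmult[OF link_norm_summable[OF \<phi>]])
  have s: "orbit_summable j (\<lambda>\<tau>. weight \<tau> * (norm (codiff j \<phi> \<tau>))\<^sup>2)"
    by (rule orbit_summable_bound[OF s']) (use le in simp)
  then show "codiff j \<phi> \<in> L2 j" using codiff_cochain[OF L2_cochain[OF \<phi>]] by (simp add: L2_iff)
  have "nsq j (codiff j \<phi>) \<le> orbit_sum j (\<lambda>\<tau>. (real n - real j) * link_norm \<phi> \<tau>)"
    unfolding nsq_def by (rule orbit_sum_mono[OF s s']) (use le R_simplex in blast)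
  then show "nsq j (codiff j \<phi>) \<le> (real n - real j) * nsq (Suc j) \<phi>"
    by (simp only: orbit_sum_cmult orbit_sum_link_norm[OF \<phi>])
qed

lemma summable_weight_ip:
  assumes "orbit_summable j (\<lambda>\<sigma>. weight \<sigma> * (norm (\<phi> \<sigma>))\<^sup>2)" "orbit_summable j (\<lambda>\<sigma>. weight \<sigma> * (norm (\<psi> \<sigma>))\<^sup>2)"
  shows "orbit_summable j (\<lambda>\<sigma>. weight \<sigma> * ip (\<phi> \<sigma>) (\<psi> \<sigma> :: 'h))"
proof (rule orbit_summable_bound[OF orbit_summable_add[OF assms]])
  fix \<sigma>
  have "weight \<sigma> * \<bar>ip (\<phi> \<sigma>) (\<psi> \<sigma>)\<bar> \<le> weight \<sigma> * ((norm (\<phi> \<sigma>))\<^sup>2 + (norm (\<psi> \<sigma>))\<^sup>2)"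
    by (rule mult_left_mono[OF abs_ip_le]) simp
  then show "\<bar>weight \<sigma> * ip (\<phi> \<sigma>) (\<psi> \<sigma>)\<bar> \<le> weight \<sigma> * (norm (\<phi> \<sigma>))\<^sup>2 + weight \<sigma> * (norm (\<psi> \<sigma>))\<^sup>2"
    by (simp add: abs_mult distrib_left)
qed

text \<open>Each of the \<open>j + 2\<close> faces contributes the same: the sign of the face in the coboundary and the sign
  of moving its missing vertex to the end multiply to the sign in \<^const>\<open>codiff\<close>.\<close>

lemma coboundary_codiff_adjoint:
  assumes \<psi>: "\<psi> \<in> L2 j" and \<phi>: "\<phi> \<in> L2 (Suc j)"
  shows "orbit_sum (Suc j) (\<lambda>\<sigma>. weight \<sigma> * ip (d j \<psi> \<sigma>) (\<phi> \<sigma>))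
    = (real j + 2) * orbit_sum j (\<lambda>\<tau>. weight \<tau> * ip (\<psi> \<tau>) (codiff j \<phi> \<tau>))"
proof -
  let ?F = "\<lambda>i \<sigma>. (-1) ^ i * (weight \<sigma> * ip (\<psi> (delete_nth i \<sigma>)) (\<phi> \<sigma>))"
  have inv: "invariant (Suc j) (?F i)" if i: "i \<le> Suc j" for i
    unfolding invariant_def
  proof (intro ballI)
    fix g \<sigma> assume g: "g \<in> carrier G" and \<sigma>: "\<sigma> \<in> simps (Suc j)"
    have "\<psi> (act g (delete_nth i \<sigma>)) = \<rho> g (\<psi> (delete_nth i \<sigma>))"
      by (rule cochain_act[OF L2_cochain[OF \<psi>] g delete_nth_simplex[OF \<sigma> i]])
    then show "?F i (act g \<sigma>) = ?F i \<sigma>"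
      by (simp only: weight_act[OF g \<sigma>] map_delete_nth cochain_act[OF L2_cochain[OF \<phi>] g \<sigma>]
        unitary_operator_ip[OF unitary[OF g]])
  qed
  have s: "orbit_summable (Suc j) (?F i)" if i: "i \<le> Suc j" for i
    by (intro orbit_summable_cmult summable_weight_ip L2_summable[OF \<phi>]
      orbit_summable_pull[OF i invariant_norm[OF L2_cochain[OF \<psi>]] L2_summable[OF \<psi>]])
  have push: "orbit_sum (Suc j) (?F i) = orbit_sum j (\<lambda>\<tau>. weight \<tau> * ip (\<psi> \<tau>) (codiff j \<phi> \<tau>))" if i: "i \<le> Suc j" for i
    unfolding orbit_sum_delete[OF i inv[OF i] s[OF i]]
  proof (rule orbit_sum_cong)
    fix \<tau> assume \<tau>: "\<tau> \<in> simps j"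
    have len: "i \<le> length \<tau>" using i \<tau> by (simp add: ordered_simplices_def)
    have pos: "weight \<tau> > 0" by (rule weight_pos[OF \<tau>])
    have "?F i (insert_nth i v \<tau>)
        = weight \<tau> * ((-1) ^ Suc j * (weight (\<tau> @ [v]) / weight \<tau> * ip (\<psi> \<tau>) (\<phi> (\<tau> @ [v]))))" if v: "v \<in> ext \<tau>" for v
    proof -
      have "weight (insert_nth i v \<tau>) = weight (\<tau> @ [v])" by (intro arg_cong[of _ _ real] top_count_cong) simp
      moreover have "\<phi> (insert_nth i v \<tau>) = (-1) ^ (Suc j - i) *\<^sub>R \<phi> (\<tau> @ [v])"
        by (rule cochain_insert[OF L2_cochain[OF \<phi>] \<tau> v i])
      moreover have "(-1 :: real) ^ i * (-1) ^ (Suc j - i) = (-1) ^ Suc j"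
        using i by (simp flip: power_add)
      ultimately show ?thesis
        using pos by (simp add: delete_insert_nth[OF len] ip_scaleR_right del: power_Suc)
    qed
    then show "(\<Sum>v\<in>ext \<tau>. ?F i (insert_nth i v \<tau>)) = weight \<tau> * ip (\<psi> \<tau>) (codiff j \<phi> \<tau>)"
      using \<tau> by (simp add: codiff_def ip_scaleR_right ip_sum_right sum_distrib_left del: power_Suc)
  qed
  have "orbit_sum (Suc j) (\<lambda>\<sigma>. weight \<sigma> * ip (d j \<psi> \<sigma>) (\<phi> \<sigma>)) = orbit_sum (Suc j) (\<lambda>\<sigma>. \<Sum>i\<le>Suc j. ?F i \<sigma>)"
  proof (rule orbit_sum_cong)
    fix \<sigma> assume \<sigma>: "\<sigma> \<in> simps (Suc j)"
    show "weight \<sigma> * ip (d j \<psi> \<sigma>) (\<phi> \<sigma>) = (\<Sum>i\<le>Suc j. ?F i \<sigma>)"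
      unfolding coboundary_simplex[OF \<sigma>] ip_sum_left ip_scaleR_left sum_distrib_left
      by (intro sum.cong refl) simp
  qed
  also have "\<dots> = (\<Sum>i\<le>Suc j. orbit_sum (Suc j) (?F i))"
    by (rule orbit_sum_sum) (use s in simp)
  also have "\<dots> = (\<Sum>i\<le>Suc j. orbit_sum j (\<lambda>\<tau>. weight \<tau> * ip (\<psi> \<tau>) (codiff j \<phi> \<tau>)))"
    by (intro sum.cong refl push) simp
  also have "\<dots> = (real j + 2) * orbit_sum j (\<lambda>\<tau>. weight \<tau> * ip (\<psi> \<tau>) (codiff j \<phi> \<tau>))"
    by (simp add: algebra_simps)
  finally show ?thesis .
qed

end

section \<open>Faces and closed cochains\<close>

lemma set_delete_nth: "distinct \<sigma> \<Longrightarrow> i < length \<sigma> \<Longrightarrow> set (delete_nth i \<sigma>) = set \<sigma> - {\<sigma> ! i}"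
  using insert_delete_nth[of i \<sigma>] set_insert_nth[of i "\<sigma> ! i" "delete_nth i \<sigma>"]
    distinct_insert_nth[of i "\<sigma> ! i" "delete_nth i \<sigma>"] by auto

lemma subseq_delete_nth: "subseq (delete_nth i \<sigma>) \<sigma>"
proof -
  have "subseq (take i \<sigma> @ drop (Suc i) \<sigma>) (take i \<sigma> @ drop i \<sigma>)"
    by (intro list_emb_append_mono) (auto simp: drop_Suc tl_drop[symmetric] intro: subseq_order.trans)
  then show ?thesis by (simp add: delete_nth_def)
qed

lemma delete_nth_inj: "distinct \<sigma> \<Longrightarrow> i < length \<sigma> \<Longrightarrow> i' < length \<sigma> \<Longrightarrow> delete_nth i \<sigma> = delete_nth i' \<sigma> \<Longrightarrow> i = i'"
  using set_delete_nth[of \<sigma> i] set_delete_nth[of \<sigma> i'] nth_eq_iff_index_eq[of \<sigma> i i'] by (metis Diff_iff insertI1 nth_mem insert_Diff singletonD)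

text \<open>A subsequence that is shorter by one misses exactly one position.\<close>

lemma subseq_codim_one:
  "subseq \<tau> \<sigma> \<Longrightarrow> length \<sigma> = Suc (length \<tau>) \<Longrightarrow> \<exists>i<length \<sigma>. \<tau> = delete_nth i \<sigma>"
proof (induction rule: list_emb.induct)
  case (list_emb_Nil ys)
  then show ?case by (intro exI[of _ 0]) (auto simp: delete_nth_def length_Suc_conv)
next
  case (list_emb_Cons xs ys y)
  have "length xs = length ys" using list_emb_Cons.prems by simp
  then have "xs = ys" by (rule subseq_same_length[OF list_emb_Cons.hyps(1)])
  then show ?case by (intro exI[of _ 0] conjI) (simp_all add: delete_nth_def)
next
  case (list_emb_Cons2 x y xs ys)
  have "length ys = Suc (length xs)" using list_emb_Cons2.prems by simp
  then obtain i where i: "i < length ys" "xs = delete_nth i ys" using list_emb_Cons2.IH by blast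
  have "x = y" using list_emb_Cons2.hyps by simp
  then show ?case using i by (intro exI[of _ "Suc i"] conjI) (simp_all add: delete_nth_def)
qed

lemma bij_betw_codim_one:
  assumes "distinct \<sigma>" "length \<sigma> = Suc m"
  shows "bij_betw (\<lambda>i. delete_nth i \<sigma>) {..m} {\<tau>. subseq \<tau> \<sigma> \<and> length \<tau> = m}"
proof (rule bij_betwI')
  fix i i' assume "i \<in> {..m}" "i' \<in> {..m}"
  then show "(delete_nth i \<sigma> = delete_nth i' \<sigma>) = (i = i')"
    using delete_nth_inj[OF assms(1), of i i'] assms(2) by auto
next
  fix i assume "i \<in> {..m}"
  then show "delete_nth i \<sigma> \<in> {\<tau>. subseq \<tau> \<sigma> \<and> length \<tau> = m}"
    using assms(2) by (simp add: subseq_delete_nth length_delete_nth)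
next
  fix \<tau> assume "\<tau> \<in> {\<tau>. subseq \<tau> \<sigma> \<and> length \<tau> = m}"
  then show "\<exists>i\<in>{..m}. \<tau> = delete_nth i \<sigma>" using subseq_codim_one[of \<tau> \<sigma>] assms(2) by auto
qed

lemma incidence_delete_nth:
  assumes "distinct \<nu>" "i < length \<nu>"
  shows "incidence \<nu> (delete_nth i \<nu>) = (-1) ^ i"
proof -
  have "(THE i'. i' < length \<nu> \<and> delete_nth i \<nu> = delete_nth i' \<nu>) = i"
    using assms delete_nth_inj[OF assms(1)] by (intro the_equality) auto
  then show ?thesis by (simp add: incidence_def)
qed

lemma bij_betw_nths:
  assumes "distinct \<gamma>" "length \<gamma> = Suc l"
  shows "bij_betw (nths \<gamma>) {S. S \<subseteq> {..l} \<and> card S = Suc k} (ordered_faces k \<gamma>)"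
proof (rule bij_betwI')
  have index: "S = {i. i \<le> l \<and> \<gamma> ! i \<in> set (nths \<gamma> S)}" if "S \<subseteq> {..l}" for S
  proof (intro equalityI subsetI)
    fix x assume "x \<in> S"
    then have "x \<le> l" "x < length \<gamma>" using that assms(2) by auto
    then show "x \<in> {i. i \<le> l \<and> \<gamma> ! i \<in> set (nths \<gamma> S)}" using \<open>x \<in> S\<close> by (auto simp: set_nths)
  qed (use assms nth_eq_iff_index_eq[OF assms(1)] in \<open>auto simp: set_nths\<close>)
  fix S S' assume "S \<in> {S. S \<subseteq> {..l} \<and> card S = Suc k}" "S' \<in> {S. S \<subseteq> {..l} \<and> card S = Suc k}"
  then show "(nths \<gamma> S = nths \<gamma> S') = (S = S')" using index[of S] index[of S'] by auto
next
  fix S assume S: "S \<in> {S. S \<subseteq> {..l} \<and> card S = Suc k}"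
  then have "{i. i < length \<gamma> \<and> i \<in> S} = S" using assms(2) by auto
  then show "nths \<gamma> S \<in> ordered_faces k \<gamma>"
    using S by (auto simp: ordered_faces_def length_nths subseq_conv_nths)
next
  fix \<sigma> assume "\<sigma> \<in> ordered_faces k \<gamma>"
  then obtain N where N: "\<sigma> = nths \<gamma> N" "length \<sigma> = Suc k"
    by (auto simp: ordered_faces_def subseq_conv_nths)
  have "nths \<gamma> (N \<inter> {..l}) = nths \<gamma> N"
    unfolding nths_def by (rule arg_cong[of _ _ "map fst"], rule filter_cong) (use assms(2) in \<open>auto dest!: set_zip_rightD\<close>)
  moreover have "card (N \<inter> {..l}) = Suc k"
  proof -
    have "{i. i < length \<gamma> \<and> i \<in> N} = N \<inter> {..l}" using assms(2) by auto
    then show ?thesis using N by (simp add: length_nths)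
  qed
  ultimately show "\<exists>S\<in>{S. S \<subseteq> {..l} \<and> card S = Suc k}. \<sigma> = nths \<gamma> S"
    using N(1) by (intro bexI[of _ "N \<inter> {..l}"]) auto
qed

lemma nths_delete_nth:
  assumes "i < length \<gamma>" "i \<notin> S"
  shows "nths \<gamma> S = nths (delete_nth i \<gamma>) {q. (if q < i then q else Suc q) \<in> S}"
proof -
  let ?S' = "{q. (if q < i then q else Suc q) \<in> S}"
  have "nths \<gamma> S = nths (take i \<gamma> @ \<gamma> ! i # drop (Suc i) \<gamma>) S"
    using id_take_nth_drop[OF assms(1)] by simp
  also have "\<dots> = nths (take i \<gamma>) S @ nths (drop (Suc i) \<gamma>) {q. q + Suc i \<in> S}"
    using assms by (simp add: nths_append nths_Cons min_def)
  also have "nths (take i \<gamma>) S = nths (take i \<gamma>) ?S'"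
    unfolding nths_def
    by (rule arg_cong[of _ _ "map fst"], rule filter_cong) (auto dest!: set_zip_rightD)
  also have "{q. q + Suc i \<in> S} = {q. q + length (take i \<gamma>) \<in> ?S'}"
    using assms(1) by (auto simp: min_def)
  also have "nths (take i \<gamma>) ?S' @ nths (drop (Suc i) \<gamma>) {q. q + length (take i \<gamma>) \<in> ?S'} = nths (delete_nth i \<gamma>) ?S'"
    by (simp add: delete_nth_def nths_append)
  finally show ?thesis .
qed

context pure_complex
begin

lemma face_simplex: "\<gamma> \<in> ordered_simplices X l \<Longrightarrow> subseq \<sigma> \<gamma> \<Longrightarrow> length \<sigma> = Suc j \<Longrightarrow> \<sigma> \<in> ordered_simplices X j"
proof -
  assume g: "\<gamma> \<in> ordered_simplices X l" and s: "subseq \<sigma> \<gamma>" and l: "length \<sigma> = Suc j"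
  obtain N where N: "\<sigma> = nths \<gamma> N" using s by (auto simp: subseq_conv_nths)
  have \<gamma>: "distinct \<gamma>" "set \<gamma> \<in> X" using g by (auto simp: ordered_simplices_def)
  have "set \<sigma> \<noteq> {}" using l by auto
  then have "set \<sigma> \<in> X"
    by (intro subset_simplex[OF \<gamma>(2)]) (simp_all add: N set_nths_subset)
  moreover have "distinct \<sigma>" unfolding N by (rule distinct_nthsI[OF \<gamma>(1)])
  ultimately show ?thesis using l by (simp add: ordered_simplices_def)
qed

lemma S_sum_alt:
  assumes \<sigma>: "\<sigma> \<in> ordered_simplices X (Suc j)"
  shows "S_sum X n (Suc j) \<sigma> = (\<Sum>i\<le>Suc j. lambda_bar X n (Suc j) (delete_nth i \<sigma>))"
proof -
  have \<sigma>': "distinct \<sigma>" "length \<sigma> = Suc (Suc j)" using \<sigma> by (auto simp: ordered_simplices_def)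
  have "{\<tau> \<in> ordered_simplices X j. subseq \<tau> \<sigma>} = {\<tau>. subseq \<tau> \<sigma> \<and> length \<tau> = Suc j}"
    using face_simplex[OF \<sigma>] by (auto simp: ordered_simplices_def)
  then show ?thesis
    unfolding S_sum_def diff_Suc_1
    using sum.reindex_bij_betw[OF bij_betw_codim_one[OF \<sigma>'], of "lambda_bar X n (Suc j)"] by simp
qed

lemma lambda_bar_bound:
  assumes \<tau>: "\<tau> \<in> ordered_simplices X j" and j: "j + 1 < n" and conn: "connected_complex (link X \<tau>)"
  shows "\<bar>lambda_bar X n (Suc j) \<tau>\<bar> \<le> 3 * real n"
proof -
  have l: "lambda_min X n (Suc j) \<tau> > 0" "lambda_min X n (Suc j) \<tau> \<le> 2 * (real n - real (Suc j))"
    using lambda_min_pos[OF \<tau> j conn] lambda_min_le[OF \<tau> j conn] by simp_all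
  define K where "K = real (Suc j) * (real n - real (Suc j)) / (real (Suc j) + 1)"
  have "K \<ge> 0" unfolding K_def using j by (intro divide_nonneg_nonneg mult_nonneg_nonneg) auto
  moreover have "K \<le> real n"
  proof -
    have "K \<le> (real (Suc j) + 1) * real n / (real (Suc j) + 1)"
      unfolding K_def using j by (intro divide_right_mono mult_mono) auto
    then show ?thesis by simp
  qed
  ultimately show ?thesis using l unfolding lambda_bar_def K_def[symmetric] by simp
qed

end

context l2_cochains
begin

definition cross_term :: "('v list \<Rightarrow> 'h) \<Rightarrow> 'v list \<Rightarrow> real" where
  "cross_term \<phi> \<tau> = (\<Sum>v\<in>ext \<tau>. \<Sum>u\<in>ext (\<tau> @ [v]). weight (\<tau> @ [u, v]) * ip (\<phi> (\<tau> @ [u])) (\<phi> (\<tau> @ [v])))"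

text \<open>Pair \<open>d \<phi> (\<sigma>) = 0\<close> with the value of \<open>\<phi>\<close> at the last face of \<open>\<sigma>\<close> and sum over orbits. The last face
  paired with itself gives the norm of \<open>\<phi>\<close>; each of the \<open>j + 2\<close> other faces, pushed forward to the simplex
  \<open>\<tau>\<close> that it shares with the last one, gives the same sum of cross terms.\<close>

lemma closed_cross_term:
  assumes \<phi>: "\<phi> \<in> L2 (Suc j)" and closed: "d (Suc j) \<phi> = (\<lambda>\<sigma>. 0)"
  shows cross_term_summable: "orbit_summable j (cross_term \<phi>)"
    and orbit_sum_cross_term: "(real j + 2) * orbit_sum j (cross_term \<phi>) = (real n - real (Suc j)) * nsq (Suc j) \<phi>"
proof -
  let ?k = "Suc j"
  let ?Y = "\<lambda>i \<sigma>. weight \<sigma> * ip (\<phi> (delete_nth i \<sigma>)) (\<phi> (delete_nth (Suc ?k) \<sigma>))"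
  note \<phi>C = L2_cochain[OF \<phi>]
  have inv: "invariant (Suc ?k) (?Y i)" if i: "i \<le> Suc ?k" for i
    unfolding invariant_def
  proof (intro ballI)
    fix g \<sigma> assume g: "g \<in> carrier G" and \<sigma>: "\<sigma> \<in> simps (Suc ?k)"
    have 1: "\<phi> (act g (delete_nth i \<sigma>)) = \<rho> g (\<phi> (delete_nth i \<sigma>))" if "i \<le> Suc ?k" for i
      by (rule cochain_act[OF \<phi>C g delete_nth_simplex[OF \<sigma> that]])
    show "?Y i (act g \<sigma>) = ?Y i \<sigma>"
      by (simp only: weight_act[OF g \<sigma>] map_delete_nth[symmetric] 1[OF i] 1[OF order_refl] unitary_operator_ip[OF unitary[OF g]])
  qed
  have sq: "orbit_summable (Suc ?k) (\<lambda>\<sigma>. weight \<sigma> * (norm (\<phi> (delete_nth i \<sigma>)))\<^sup>2)" if "i \<le> Suc ?k" for i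
    by (rule orbit_summable_pull[OF that invariant_norm[OF \<phi>C] L2_summable[OF \<phi>]])
  have s: "orbit_summable (Suc ?k) (?Y i)" if "i \<le> Suc ?k" for i
    by (intro summable_weight_ip sq that order_refl)
  have push_eq: "(\<Sum>u\<in>ext \<tau>. \<Sum>v\<in>ext (insert_nth i u \<tau>). ?Y i (insert_nth (Suc ?k) v (insert_nth i u \<tau>)))
      = (-1) ^ (?k - i) * cross_term \<phi> \<tau>" if i: "i \<le> ?k" and \<tau>: "\<tau> \<in> simps j" for i \<tau>
    unfolding cross_term_def sum_distrib_left
  proof (rule sum.cong)
    fix u assume u: "u \<in> ext \<tau>"
    let ?\<eta> = "insert_nth i u \<tau>"
    have len: "length \<tau> = ?k" using \<tau> by (simp add: ordered_simplices_def)
    have st: "set ?\<eta> = set (\<tau> @ [u])" by simp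
    have "?Y i (insert_nth (Suc ?k) v ?\<eta>) = (-1) ^ (?k - i) * (weight (\<tau> @ [v, u]) * ip (\<phi> (\<tau> @ [v])) (\<phi> (\<tau> @ [u])))" for v
    proof -
      have "length ?\<eta> = Suc ?k" using len by simp
      then have ins: "insert_nth (Suc ?k) v ?\<eta> = ?\<eta> @ [v]" using insert_nth_length[of ?\<eta> v] by simp
      have "delete_nth (Suc ?k) (?\<eta> @ [v]) = ?\<eta>" using len by (simp add: delete_nth_def)
      moreover have "delete_nth i (?\<eta> @ [v]) = \<tau> @ [v]"
        using delete_nth_append[of i ?\<eta> "[v]"] delete_insert_nth[of i \<tau> u] i len by simp
      moreover have "weight (?\<eta> @ [v]) = weight (\<tau> @ [v, u])"
        by (intro arg_cong[of _ _ real] top_count_cong) auto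
      moreover have "\<phi> ?\<eta> = (-1) ^ (?k - i) *\<^sub>R \<phi> (\<tau> @ [u])" by (rule cochain_insert[OF \<phi>C \<tau> u i])
      ultimately show ?thesis unfolding ins by (simp only: ip_scaleR_right) simp
    qed
    then show "(\<Sum>v\<in>ext ?\<eta>. ?Y i (insert_nth (Suc ?k) v ?\<eta>))
        = (\<Sum>v\<in>ext (\<tau> @ [u]). (-1) ^ (?k - i) * (weight (\<tau> @ [v, u]) * ip (\<phi> (\<tau> @ [v])) (\<phi> (\<tau> @ [u]))))"
      unfolding ext_verts_cong[OF st] by (simp only:)
  qed simp
  have push: "orbit_summable j (\<lambda>\<tau>. (-1) ^ (?k - i) * cross_term \<phi> \<tau>) \<and>
      orbit_sum (Suc ?k) (?Y i) = orbit_sum j (\<lambda>\<tau>. (-1) ^ (?k - i) * cross_term \<phi> \<tau>)" if i: "i \<le> ?k" for i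
  proof -
    have i': "i \<le> Suc ?k" using i by simp
    let ?Z = "\<lambda>\<eta>. \<Sum>v\<in>ext \<eta>. ?Y i (insert_nth (Suc ?k) v \<eta>)"
    have Zinv: "invariant ?k ?Z" by (rule invariant_delete[OF inv[OF i'] order_refl])
    have Zs: "orbit_summable ?k ?Z" by (rule orbit_summable_delete[OF order_refl inv[OF i'] s[OF i']])
    have "orbit_sum (Suc ?k) (?Y i) = orbit_sum ?k ?Z"
      by (rule orbit_sum_delete[OF order_refl inv[OF i'] s[OF i']])
    also have "\<dots> = orbit_sum j (\<lambda>\<tau>. \<Sum>u\<in>ext \<tau>. ?Z (insert_nth i u \<tau>))"
      by (rule orbit_sum_delete[OF i Zinv Zs])
    also have "\<dots> = orbit_sum j (\<lambda>\<tau>. (-1) ^ (?k - i) * cross_term \<phi> \<tau>)"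
      by (rule orbit_sum_cong) (rule push_eq[OF i])
    finally have "orbit_sum (Suc ?k) (?Y i) = orbit_sum j (\<lambda>\<tau>. (-1) ^ (?k - i) * cross_term \<phi> \<tau>)" .
    moreover have "orbit_summable j (\<lambda>\<tau>. (-1) ^ (?k - i) * cross_term \<phi> \<tau>)"
      by (rule orbit_summable_cong[THEN iffD1, OF _ orbit_summable_delete[OF i Zinv Zs]]) (rule push_eq[OF i])
    ultimately show ?thesis by blast
  qed
  show "orbit_summable j (cross_term \<phi>)" using push[of ?k] by simp
  have last: "orbit_sum (Suc ?k) (?Y (Suc ?k)) = (real n - real ?k) * nsq ?k \<phi>"
    using orbit_sum_pull[OF order_refl invariant_norm[OF \<phi>C] L2_summable[OF \<phi>]]
    by (simp only: ip_self nsq_def)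
  have "0 = orbit_sum (Suc ?k) (\<lambda>\<sigma>. \<Sum>i\<le>Suc ?k. (-1) ^ i * ?Y i \<sigma>)"
  proof -
    have "(\<Sum>i\<le>Suc ?k. (-1) ^ i * ?Y i \<sigma>) = 0" if \<sigma>: "\<sigma> \<in> simps (Suc ?k)" for \<sigma>
    proof -
      have "(\<Sum>i\<le>Suc ?k. (-1) ^ i * ?Y i \<sigma>) = weight \<sigma> * ip (d ?k \<phi> \<sigma>) (\<phi> (delete_nth (Suc ?k) \<sigma>))"
        unfolding coboundary_simplex[OF \<sigma>] ip_sum_left ip_scaleR_left sum_distrib_left
        by (intro sum.cong refl) simp
      then show ?thesis by (simp add: closed)
    qed
    then have "orbit_sum (Suc ?k) (\<lambda>\<sigma>. \<Sum>i\<le>Suc ?k. (-1) ^ i * ?Y i \<sigma>) = orbit_sum (Suc ?k) (\<lambda>\<sigma>. 0)"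
      by (rule orbit_sum_cong)
    then show ?thesis by (simp add: orbit_sum_def)
  qed
  also have "\<dots> = (\<Sum>i\<le>Suc ?k. (-1) ^ i * orbit_sum (Suc ?k) (?Y i))"
    using s orbit_sum_sum[of "{..Suc ?k}" "Suc ?k" "\<lambda>i \<sigma>. (-1) ^ i * ?Y i \<sigma>"] orbit_summable_cmult[OF s]
    by (simp only: orbit_sum_cmult atMost_iff)
  also have "\<dots> = (\<Sum>i\<le>?k. (-1) ^ i * orbit_sum (Suc ?k) (?Y i)) + (-1) ^ Suc ?k * ((real n - real ?k) * nsq ?k \<phi>)"
    unfolding sum.atMost_Suc[of _ ?k] last ..
  also have "(\<Sum>i\<le>?k. (-1) ^ i * orbit_sum (Suc ?k) (?Y i)) = (\<Sum>i\<le>?k. (-1) ^ ?k * orbit_sum j (cross_term \<phi>))"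
  proof (rule sum.cong)
    fix i assume "i \<in> {..?k}"
    then have i: "i \<le> ?k" by simp
    then have "(-1 :: real) ^ i * (-1) ^ (?k - i) = (-1) ^ ?k" by (simp flip: power_add)
    then have "(-1) ^ i * ((-1) ^ (?k - i) * orbit_sum j (cross_term \<phi>)) = (-1) ^ ?k * orbit_sum j (cross_term \<phi>)"
      by (simp only: mult.assoc[symmetric])
    then show "(-1) ^ i * orbit_sum (Suc ?k) (?Y i) = (-1) ^ ?k * orbit_sum j (cross_term \<phi>)"
      using push[OF i] by (simp only: orbit_sum_cmult)
  qed simp
  finally have "0 = (-1) ^ ?k * ((real j + 2) * orbit_sum j (cross_term \<phi>) - (real n - real ?k) * nsq ?k \<phi>)"
    by (simp add: algebra_simps)
  then show "(real j + 2) * orbit_sum j (cross_term \<phi>) = (real n - real (Suc j)) * nsq (Suc j) \<phi>"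
    by simp
qed

text \<open>The sum of the spectral gap inequalities of all links. Without the weights \<open>\<lambda>\<^sub>\<tau>\<close>, the energies of the
  functions \<open>v \<mapsto> \<phi>(\<tau>v)\<close> sum to \<open>K = k (n - k) / (k + 1)\<close> times the sum of their squared norms, by the formula for the cross
  terms; moving this to the other side replaces \<open>\<lambda>\<^sub>\<tau>\<close> by \<open>\<lambda>\<^sub>\<tau> - K\<close>. Finally each \<open>\<tau>\<close> collects its weight
  from all the simplices of which it is a face, which gives \<open>S\<^sub>\<sigma>\<close>.\<close>

lemma garland_inequality:
  assumes \<phi>: "\<phi> \<in> L2 (Suc j)" and closed: "d (Suc j) \<phi> = (\<lambda>\<sigma>. 0)"
    and j: "j + 1 < n" and links: "links_connected X n"
  shows S_weight_summable: "orbit_summable (Suc j) (\<lambda>\<sigma>. weight \<sigma> * (S_sum X n (Suc j) \<sigma> * (norm (\<phi> \<sigma>))\<^sup>2))"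
    and S_weight_le: "orbit_sum (Suc j) (\<lambda>\<sigma>. weight \<sigma> * (S_sum X n (Suc j) \<sigma> * (norm (\<phi> \<sigma>))\<^sup>2))
      \<le> 2 * (real j + 2) * nsq j (codiff j \<phi>)"
proof -
  let ?k = "Suc j"
  let ?lb = "lambda_bar X n ?k" and ?lm = "lambda_min X n ?k"
  define K where "K = real ?k * (real n - real ?k) / (real ?k + 1)"
  note \<phi>C = L2_cochain[OF \<phi>]
  have conn: "connected_complex (link X \<tau>)" if "\<tau> \<in> simps j" for \<tau>
    using links[unfolded links_connected_def, rule_format, of j \<tau>] that j by simp
  have lb: "\<bar>?lb \<tau>\<bar> \<le> 3 * real n" if "\<tau> \<in> simps j" for \<tau>
    by (rule lambda_bar_bound[OF that j conn[OF that]])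
  have inv: "invariant j ?lb"
    unfolding invariant_def lambda_bar_def by (intro ballI) (simp only: lambda_min_act[where j = j])
  have S_eq: "weight \<sigma> * (S_sum X n ?k \<sigma> * (norm (\<phi> \<sigma>))\<^sup>2)
      = (\<Sum>i\<le>?k. weight \<sigma> * ?lb (delete_nth i \<sigma>) * (norm (\<phi> \<sigma>))\<^sup>2)" if "\<sigma> \<in> simps ?k" for \<sigma>
    unfolding S_sum_alt[OF that] sum_distrib_left sum_distrib_right by (intro sum.cong refl) simp
  have s: "orbit_summable ?k (\<lambda>\<sigma>. weight \<sigma> * ?lb (delete_nth i \<sigma>) * (norm (\<phi> \<sigma>))\<^sup>2)" if "i \<le> ?k" for i
    by (rule orbit_summable_face_weight[OF \<phi> that inv lb])
  show "orbit_summable ?k (\<lambda>\<sigma>. weight \<sigma> * (S_sum X n ?k \<sigma> * (norm (\<phi> \<sigma>))\<^sup>2))"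
    by (rule orbit_summable_cong[THEN iffD2, OF S_eq orbit_summable_sum]) (use s in auto)
  have "orbit_sum ?k (\<lambda>\<sigma>. weight \<sigma> * (S_sum X n ?k \<sigma> * (norm (\<phi> \<sigma>))\<^sup>2))
      = orbit_sum ?k (\<lambda>\<sigma>. \<Sum>i\<le>?k. weight \<sigma> * ?lb (delete_nth i \<sigma>) * (norm (\<phi> \<sigma>))\<^sup>2)"
    by (rule orbit_sum_cong) (rule S_eq)
  also have "\<dots> = (\<Sum>i\<le>?k. orbit_sum ?k (\<lambda>\<sigma>. weight \<sigma> * ?lb (delete_nth i \<sigma>) * (norm (\<phi> \<sigma>))\<^sup>2))"
    by (rule orbit_sum_sum) (use s in auto)
  also have "\<dots> = (\<Sum>i\<le>?k. orbit_sum j (\<lambda>\<tau>. ?lb \<tau> * link_norm \<phi> \<tau>))"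
    by (intro sum.cong refl orbit_sum_face_weight[OF \<phi> _ inv lb]) auto
  also have "\<dots> = (real j + 2) * orbit_sum j (\<lambda>\<tau>. ?lb \<tau> * link_norm \<phi> \<tau>)"
    by (simp add: algebra_simps)
  also have "\<dots> \<le> (real j + 2) * (2 * nsq j (codiff j \<phi>))"
  proof (rule mult_left_mono)
    let ?B = "\<lambda>\<tau>. 2 * (weight \<tau> * (norm (codiff j \<phi> \<tau>))\<^sup>2)"
    have local: "?lb \<tau> * link_norm \<phi> \<tau> + K * link_norm \<phi> \<tau> \<le>
        (real n - real ?k) * link_norm \<phi> \<tau> - cross_term \<phi> \<tau> + ?B \<tau>" if \<tau>: "\<tau> \<in> simps j" for \<tau>
    proof -
      have pos: "weight \<tau> > 0" by (rule weight_pos[OF \<tau>])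
      define D where "D = (norm (\<Sum>v\<in>ext \<tau>. weight (\<tau> @ [v]) *\<^sub>R \<phi> (\<tau> @ [v])))\<^sup>2 / ((real n - real j) * weight \<tau>)"
      have cod: "norm (codiff j \<phi> \<tau>) = norm (\<Sum>v\<in>ext \<tau>. weight (\<tau> @ [v]) *\<^sub>R \<phi> (\<tau> @ [v])) / weight \<tau>"
      proof -
        have "(\<Sum>v\<in>ext \<tau>. (weight (\<tau> @ [v]) / weight \<tau>) *\<^sub>R \<phi> (\<tau> @ [v]))
            = (1 / weight \<tau>) *\<^sub>R (\<Sum>v\<in>ext \<tau>. weight (\<tau> @ [v]) *\<^sub>R \<phi> (\<tau> @ [v]))"
          by (simp add: scaleR_sum_right)
        then show ?thesis using \<tau> by (simp add: codiff_def)
      qed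
      have D: "D = weight \<tau> * (norm (codiff j \<phi> \<tau>))\<^sup>2 / (real n - real j)"
        unfolding cod D_def using pos by (simp add: power_divide power2_eq_square)
      have gap: "?lm \<tau> * (link_norm \<phi> \<tau> - D) \<le> (real n - real ?k) * link_norm \<phi> \<tau> - cross_term \<phi> \<tau>"
        using link_energy_ge[OF \<tau> j conn[OF \<tau>], of "\<lambda>v. \<phi> (\<tau> @ [v])"]
        unfolding link_norm_def cross_term_def D_def Suc_eq_plus1 .
      have lm: "?lm \<tau> > 0" "?lm \<tau> \<le> 2 * (real n - real ?k)"
        unfolding Suc_eq_plus1
        by (rule lambda_min_pos[OF \<tau> j conn[OF \<tau>]] lambda_min_le[OF \<tau> j conn[OF \<tau>]])+
      have "?lm \<tau> * D \<le> ?B \<tau>"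
      proof -
        have "?lm \<tau> \<le> 2 * (real n - real j)" using lm(2) by simp
        moreover have "D \<ge> 0" unfolding D using j by simp
        ultimately have "?lm \<tau> * D \<le> 2 * (real n - real j) * D" by (rule mult_right_mono)
        also have "\<dots> = ?B \<tau>"
        proof -
          have "2 * y * (x / y) = 2 * x" if "y \<noteq> 0" for x y :: real using that by simp
          moreover have "real n - real j \<noteq> 0" using j by simp
          ultimately show ?thesis unfolding D by blast
        qed
        finally show ?thesis .
      qed
      moreover have "?lb \<tau> * link_norm \<phi> \<tau> + K * link_norm \<phi> \<tau> = ?lm \<tau> * link_norm \<phi> \<tau>"
        unfolding lambda_bar_def K_def[symmetric] by (simp add: algebra_simps)
      ultimately show ?thesis using gap by (simp add: algebra_simps)
    qed
    have s_lb: "orbit_summable j (\<lambda>\<tau>. ?lb \<tau> * link_norm \<phi> \<tau>)"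
      by (rule orbit_summable_link_norm[OF \<phi> le0 inv lb])
    note s_ln = link_norm_summable[OF \<phi>]
    note s_ct = cross_term_summable[OF \<phi> closed]
    have s_B: "orbit_summable j ?B" by (rule orbit_summable_cmult[OF L2_summable[OF codiff_L2[OF \<phi>]]])
    have "orbit_sum j (\<lambda>\<tau>. ?lb \<tau> * link_norm \<phi> \<tau> + K * link_norm \<phi> \<tau>)
        \<le> orbit_sum j (\<lambda>\<tau>. (real n - real ?k) * link_norm \<phi> \<tau> - cross_term \<phi> \<tau> + ?B \<tau>)"
      by (intro orbit_sum_mono orbit_summable_add orbit_summable_diff orbit_summable_cmult[OF s_ln] s_lb s_ct s_B local R_simplex)
    then have le: "orbit_sum j (\<lambda>\<tau>. ?lb \<tau> * link_norm \<phi> \<tau>) + K * nsq ?k \<phi>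
        \<le> (real n - real ?k) * nsq ?k \<phi> - orbit_sum j (cross_term \<phi>) + 2 * nsq j (codiff j \<phi>)"
      by (simp only: orbit_sum_add[OF s_lb orbit_summable_cmult[OF s_ln]]
        orbit_sum_add[OF orbit_summable_diff[OF orbit_summable_cmult[OF s_ln] s_ct] s_B]
        orbit_sum_diff[OF orbit_summable_cmult[OF s_ln] s_ct] orbit_sum_cmult orbit_sum_link_norm[OF \<phi>] nsq_def[symmetric])
    have "orbit_sum j (cross_term \<phi>) = (real n - real ?k) * nsq ?k \<phi> / (real j + 2)"
      using orbit_sum_cross_term[OF \<phi> closed] by (simp add: field_simps)
    moreover have "(real n - real ?k) * N - (real n - real ?k) * N / (real j + 2) = K * N" for N
      unfolding K_def by (simp add: field_simps)
    ultimately show "orbit_sum j (\<lambda>\<tau>. ?lb \<tau> * link_norm \<phi> \<tau>) \<le> 2 * nsq j (codiff j \<phi>)"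
      using le by (smt (verit))
  qed simp
  finally show "orbit_sum ?k (\<lambda>\<sigma>. weight \<sigma> * (S_sum X n ?k \<sigma> * (norm (\<phi> \<sigma>))\<^sup>2)) \<le> 2 * (real j + 2) * nsq j (codiff j \<phi>)"
    by (simp add: algebra_simps)
qed

section \<open>Passing to the simplices of dimension \<open>l\<close>\<close>

text \<open>The face with index set \<open>S\<close> is reached by deleting the other vertices one at a time; going down from
  dimension \<open>i + 1\<close> to \<open>i\<close> costs the factor \<open>n - i\<close>, whichever vertex is deleted.\<close>

lemma orbit_sum_pull_nths:
  assumes "k \<le> l" "S \<subseteq> {..l}" "card S = Suc k" and inv: "invariant k F"
    and sm: "orbit_summable k (\<lambda>\<sigma>. weight \<sigma> * F \<sigma>)"
  shows "orbit_summable l (\<lambda>\<gamma>. weight \<gamma> * F (nths \<gamma> S)) \<and>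
    orbit_sum l (\<lambda>\<gamma>. weight \<gamma> * F (nths \<gamma> S)) = (\<Prod>i = k..<l. real n - real i) * orbit_sum k (\<lambda>\<sigma>. weight \<sigma> * F \<sigma>)"
  using assms(1-3)
proof (induction l arbitrary: S rule: dec_induct)
  case base
  have "S = {..k}" by (rule card_subset_eq) (use base in auto)
  then have "nths \<gamma> S = \<gamma>" if "\<gamma> \<in> simps k" for \<gamma>
    using that by (auto simp: ordered_simplices_def intro!: nths_all)
  then have eq: "weight \<gamma> * F (nths \<gamma> S) = weight \<gamma> * F \<gamma>" if "\<gamma> \<in> simps k" for \<gamma> using that by simp
  show ?case using orbit_summable_cong[of k, OF eq] orbit_sum_cong[of k, OF eq] sm by simp
next
  case (step l)
  have "\<not> {..Suc l} \<subseteq> S"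
  proof
    assume "{..Suc l} \<subseteq> S"
    then have "S = {..Suc l}" using step.prems(1) by blast
    then show False using step.prems(2) step.hyps by simp
  qed
  then obtain i where i: "i \<le> Suc l" "i \<notin> S" by auto
  let ?shift = "\<lambda>q. if q < i then q else Suc q"
  define S' where "S' = {q. ?shift q \<in> S}"
  have S_eq: "S = ?shift ` S'"
  proof (intro equalityI subsetI)
    fix s assume s: "s \<in> S"
    have "s \<noteq> i" using s i(2) by blast
    then have "s < i \<or> i < s" by linarith
    define q where "q = (if s < i then s else s - 1)"
    have shift: "?shift q = s" using \<open>s < i \<or> i < s\<close> by (auto simp: q_def)
    have q: "q \<in> S'" unfolding S'_def mem_Collect_eq shift by (rule s)
    show "s \<in> ?shift ` S'" by (rule image_eqI[where f = ?shift and x = q]) (use shift q in simp_all)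
  qed (auto simp: S'_def)
  have card': "card S' = Suc k"
  proof -
    have "inj_on ?shift S'" by (auto simp: inj_on_def split: if_splits)
    then have "card (?shift ` S') = card S'" by (rule card_image)
    then show ?thesis using step.prems(2) unfolding S_eq[symmetric] by simp
  qed
  have sub': "S' \<subseteq> {..l}"
  proof
    fix q assume "q \<in> S'"
    then have "?shift q \<le> Suc l" using step.prems(1) by (auto simp: S'_def)
    then show "q \<in> {..l}" using i(1) by (auto split: if_splits)
  qed
  have face: "nths \<tau> S' \<in> simps k" if "\<tau> \<in> simps l" for \<tau>
  proof -
    have "nths \<tau> S' \<in> ordered_faces k \<tau>"
      using bij_betw_nths[of \<tau> l k] that sub' card' by (auto simp: ordered_simplices_def bij_betw_def)
    then show ?thesis using face_simplex[OF that] by (simp add: ordered_faces_def)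
  qed
  let ?F = "\<lambda>\<tau>. F (nths \<tau> S')"
  have inv': "invariant l ?F"
    unfolding invariant_def
  proof (intro ballI)
    fix g \<tau> assume g: "g \<in> carrier G" and \<tau>: "\<tau> \<in> simps l"
    show "F (nths (act g \<tau>) S') = F (nths \<tau> S')"
      unfolding nths_map by (rule invariantD[OF inv g face[OF \<tau>]])
  qed
  have IH: "orbit_summable l (\<lambda>\<gamma>. weight \<gamma> * F (nths \<gamma> S'))"
    "orbit_sum l (\<lambda>\<gamma>. weight \<gamma> * F (nths \<gamma> S')) = (\<Prod>i = k..<l. real n - real i) * orbit_sum k (\<lambda>\<sigma>. weight \<sigma> * F \<sigma>)"
    using step.IH[OF sub' card'] by blast+
  have eq: "weight \<gamma> * F (nths \<gamma> S) = weight \<gamma> * F (nths (delete_nth i \<gamma>) S')" if "\<gamma> \<in> simps (Suc l)" for \<gamma>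
  proof -
    have "i < length \<gamma>" using that i(1) by (simp add: ordered_simplices_def)
    from nths_delete_nth[OF this i(2)] show ?thesis by (simp only: S'_def)
  qed
  have "orbit_summable (Suc l) (\<lambda>\<gamma>. weight \<gamma> * F (nths \<gamma> S))"
    by (rule orbit_summable_cong[THEN iffD2, OF eq orbit_summable_pull[OF i(1) inv' IH(1)]])
  moreover have "orbit_sum (Suc l) (\<lambda>\<gamma>. weight \<gamma> * F (nths \<gamma> S)) = orbit_sum (Suc l) (\<lambda>\<gamma>. weight \<gamma> * F (nths (delete_nth i \<gamma>) S'))"
    by (rule orbit_sum_cong[OF eq])
  moreover have "\<dots> = (\<Prod>i = k..<Suc l. real n - real i) * orbit_sum k (\<lambda>\<sigma>. weight \<sigma> * F \<sigma>)"
    unfolding orbit_sum_pull[OF i(1) inv' IH(1)] IH(2) using step.hyps by simp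
  ultimately show ?case by simp
qed

lemma orbit_sum_nonneg_if_face_sums_nonneg:
  assumes kl: "k \<le> l" "l \<le> n" and inv: "invariant k F"
    and sm: "orbit_summable k (\<lambda>\<sigma>. weight \<sigma> * F \<sigma>)"
    and nonneg: "\<And>\<gamma>. \<gamma> \<in> R l \<Longrightarrow> (\<Sum>\<sigma>\<in>ordered_faces k \<gamma>. F \<sigma>) \<ge> 0"
  shows "orbit_sum k (\<lambda>\<sigma>. weight \<sigma> * F \<sigma>) \<ge> 0"
proof -
  let ?I = "{S. S \<subseteq> {..l} \<and> card S = Suc k}"
  let ?c = "\<Prod>i = k..<l. real n - real i"
  have fin: "finite ?I" by (rule finite_subset[of _ "Pow {..l}"]) auto
  have I: "?I \<noteq> {}" using kl(1) by (auto intro!: exI[of _ "{..k}"])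
  have pull: "orbit_summable l (\<lambda>\<gamma>. weight \<gamma> * F (nths \<gamma> S))"
    "orbit_sum l (\<lambda>\<gamma>. weight \<gamma> * F (nths \<gamma> S)) = ?c * orbit_sum k (\<lambda>\<sigma>. weight \<sigma> * F \<sigma>)" if "S \<in> ?I" for S
    using orbit_sum_pull_nths[OF kl(1) _ _ inv sm, of S] that by auto
  have faces: "(\<Sum>S\<in>?I. weight \<gamma> * F (nths \<gamma> S)) = weight \<gamma> * (\<Sum>\<sigma>\<in>ordered_faces k \<gamma>. F \<sigma>)" if "\<gamma> \<in> simps l" for \<gamma>
  proof -
    have "distinct \<gamma>" "length \<gamma> = Suc l" using that by (auto simp: ordered_simplices_def)
    from sum.reindex_bij_betw[OF bij_betw_nths[OF this], of F k]
    show ?thesis by (simp add: sum_distrib_left[symmetric])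
  qed
  have "0 \<le> orbit_sum l (\<lambda>\<gamma>. weight \<gamma> * (\<Sum>\<sigma>\<in>ordered_faces k \<gamma>. F \<sigma>))"
    by (rule orbit_sum_nonneg) (use nonneg in auto)
  also have "\<dots> = orbit_sum l (\<lambda>\<gamma>. \<Sum>S\<in>?I. weight \<gamma> * F (nths \<gamma> S))"
    by (rule orbit_sum_cong) (rule faces[symmetric])
  also have "\<dots> = (\<Sum>S\<in>?I. orbit_sum l (\<lambda>\<gamma>. weight \<gamma> * F (nths \<gamma> S)))"
    by (rule orbit_sum_sum) (rule pull(1))
  also have "\<dots> = (\<Sum>S\<in>?I. ?c * orbit_sum k (\<lambda>\<sigma>. weight \<sigma> * F \<sigma>))"
    by (intro sum.cong refl pull(2))
  also have "\<dots> = real (card ?I) * ?c * orbit_sum k (\<lambda>\<sigma>. weight \<sigma> * F \<sigma>)" by simp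
  finally have "0 \<le> real (card ?I) * ?c * orbit_sum k (\<lambda>\<sigma>. weight \<sigma> * F \<sigma>)" .
  moreover have "real (card ?I) * ?c > 0"
    using fin I kl(2) by (intro mult_pos_pos prod_pos) (auto simp: card_gt_0_iff)
  ultimately show ?thesis by (simp add: zero_le_mult_iff)
qed

text \<open>The restriction of a closed cochain to the faces of \<open>\<gamma>\<close> is closed.\<close>

lemma closed_face_sum_nonneg:
  assumes \<gamma>: "\<gamma> \<in> simps l" and closed: "d k \<phi> = (\<lambda>\<sigma>. 0)"
    and roots: "\<forall>t::real. poly (face_poly k \<gamma> (\<lambda>\<sigma>. [:- S \<sigma>, 1:])) t = 0 \<longrightarrow> t \<ge> \<epsilon>"
  shows "(\<Sum>\<sigma>\<in>ordered_faces k \<gamma>. (S \<sigma> - \<epsilon>) * (norm (\<phi> \<sigma> :: 'h))\<^sup>2) \<ge> 0"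
proof (rule closed_form_ge_of_face_poly_roots_hilbert)
  show "t \<ge> \<epsilon>" if "poly (face_poly k \<gamma> (\<lambda>\<sigma>. [:- S \<sigma>, 1:])) t = 0" for t using roots that by blast
  fix \<nu> assume "\<nu> \<in> ordered_faces (k + 1) \<gamma>"
  then have sub: "subseq \<nu> \<gamma>" and len: "length \<nu> = Suc (Suc k)" by (auto simp: ordered_faces_def)
  have \<nu>: "\<nu> \<in> simps (Suc k)" by (rule face_simplex[OF \<gamma> sub len])
  then have dist: "distinct \<nu>" by (simp add: ordered_simplices_def)
  have faces: "{\<sigma> \<in> ordered_faces k \<gamma>. subseq \<sigma> \<nu>} = {\<sigma>. subseq \<sigma> \<nu> \<and> length \<sigma> = Suc k}"
    using subseq_order.trans[OF _ sub] by (auto simp: ordered_faces_def)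
  have "(\<Sum>\<sigma> | \<sigma> \<in> ordered_faces k \<gamma> \<and> subseq \<sigma> \<nu>. of_int (incidence \<nu> \<sigma>) *\<^sub>R \<phi> \<sigma>)
      = (\<Sum>i\<le>Suc k. of_int (incidence \<nu> (delete_nth i \<nu>)) *\<^sub>R \<phi> (delete_nth i \<nu>))"
    unfolding faces
    by (rule sum.reindex_bij_betw[OF bij_betw_codim_one[OF dist len], symmetric])
  also have "\<dots> = (\<Sum>i\<le>Suc k. (-1) ^ i *\<^sub>R \<phi> (delete_nth i \<nu>))"
    by (intro sum.cong refl) (simp add: incidence_delete_nth[OF dist] len)
  also have "\<dots> = 0" using coboundary_simplex[OF \<nu>, of \<phi>] closed by (metis (no_types))
  finally show "(\<Sum>\<sigma> | \<sigma> \<in> ordered_faces k \<gamma> \<and> subseq \<sigma> \<nu>. of_int (incidence \<nu> \<sigma>) *\<^sub>R \<phi> \<sigma>) = 0" .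
qed

lemma nsq_le_codiff:
  assumes \<phi>: "\<phi> \<in> L2 (Suc j)" and closed: "d (Suc j) \<phi> = (\<lambda>\<sigma>. 0)"
    and j: "j + 1 < n" and links: "links_connected X n" and l: "Suc j \<le> l" "l \<le> n"
    and roots: "\<forall>\<gamma>\<in>R l. \<forall>t::real. poly (face_poly (Suc j) \<gamma> (\<lambda>\<sigma>. [:- S_sum X n (Suc j) \<sigma>, 1:])) t = 0 \<longrightarrow> t \<ge> \<epsilon>"
  shows "\<epsilon> * nsq (Suc j) \<phi> \<le> 2 * (real j + 2) * nsq j (codiff j \<phi>)"
proof -
  let ?k = "Suc j"
  let ?S = "S_sum X n ?k"
  let ?F = "\<lambda>\<sigma>. (?S \<sigma> - \<epsilon>) * (norm (\<phi> \<sigma>))\<^sup>2"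
  have S_inv: "?S (act g \<sigma>) = ?S \<sigma>" if g: "g \<in> carrier G" and \<sigma>: "\<sigma> \<in> simps ?k" for g \<sigma>
  proof -
    have "lambda_bar X n ?k (delete_nth i (act g \<sigma>)) = lambda_bar X n ?k (delete_nth i \<sigma>)" if "i \<le> ?k" for i
      unfolding map_delete_nth[symmetric] lambda_bar_def lambda_min_act[OF g delete_nth_simplex[OF \<sigma> that]] ..
    then show ?thesis unfolding S_sum_alt[OF \<sigma>] S_sum_alt[OF act_simplex[OF g \<sigma>]] by (intro sum.cong refl) simp
  qed
  have inv: "invariant ?k ?F"
    unfolding invariant_def
    by (intro ballI) (simp only: S_inv cochain_norm_act[OF L2_cochain[OF \<phi>]])
  have sS: "orbit_summable ?k (\<lambda>\<sigma>. weight \<sigma> * (?S \<sigma> * (norm (\<phi> \<sigma>))\<^sup>2))"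
    by (rule S_weight_summable[OF \<phi> closed j links])
  have s\<epsilon>: "orbit_summable ?k (\<lambda>\<sigma>. \<epsilon> * (weight \<sigma> * (norm (\<phi> \<sigma>))\<^sup>2))"
    by (rule orbit_summable_cmult[OF L2_summable[OF \<phi>]])
  have F_eq: "(\<lambda>\<sigma>. weight \<sigma> * ?F \<sigma>) = (\<lambda>\<sigma>. weight \<sigma> * (?S \<sigma> * (norm (\<phi> \<sigma>))\<^sup>2) - \<epsilon> * (weight \<sigma> * (norm (\<phi> \<sigma>))\<^sup>2))"
    by (rule ext) (simp add: algebra_simps)
  have "0 \<le> orbit_sum ?k (\<lambda>\<sigma>. weight \<sigma> * ?F \<sigma>)"
  proof (rule orbit_sum_nonneg_if_face_sums_nonneg[OF l inv])
    show "orbit_summable ?k (\<lambda>\<sigma>. weight \<sigma> * ?F \<sigma>)" unfolding F_eq by (rule orbit_summable_diff[OF sS s\<epsilon>])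
    show "(\<Sum>\<sigma>\<in>ordered_faces ?k \<gamma>. ?F \<sigma>) \<ge> 0" if "\<gamma> \<in> R l" for \<gamma>
      by (rule closed_face_sum_nonneg[OF R_simplex[OF that] closed]) (rule bspec[OF roots that])
  qed
  also have "\<dots> = orbit_sum ?k (\<lambda>\<sigma>. weight \<sigma> * (?S \<sigma> * (norm (\<phi> \<sigma>))\<^sup>2)) - \<epsilon> * nsq ?k \<phi>"
    unfolding F_eq orbit_sum_diff[OF sS s\<epsilon>] orbit_sum_cmult nsq_def ..
  finally show ?thesis using S_weight_le[OF \<phi> closed j links] by simp
qed

end

section \<open>Exactness of closed cochains\<close>

context l2_cochains
begin

lemma nsq_nonneg: "nsq j \<phi> \<ge> 0"
  unfolding nsq_def by (rule orbit_sum_nonneg) simp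

lemma finite_sum_le_nsq:
  assumes \<phi>: "\<phi> \<in> L2 j" and A: "finite A" "A \<subseteq> R j"
  shows "(\<Sum>\<sigma>\<in>A. weight \<sigma> * (norm (\<phi> \<sigma>))\<^sup>2 / vol \<sigma>) \<le> nsq j \<phi>"
  unfolding nsq_def orbit_sum_def
  by (rule finite_sum_le_infsum) (use L2_summable[OF \<phi>] A in \<open>auto simp: orbit_summable_def\<close>)

text \<open>Evaluation at a simplex is bounded, as each term of the sum is at most the sum. Invariance passes
  from the representative to the other simplices of its orbit.\<close>

lemma norm_le_nsq:
  assumes "\<sigma> \<in> simps j"
  obtains b where "b \<ge> 0" "\<And>\<phi>. \<phi> \<in> L2 j \<Longrightarrow> norm (\<phi> \<sigma>) \<le> b * sqrt (nsq j \<phi>)"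
proof -
  obtain \<tau> g where \<tau>: "\<tau> \<in> R j" "g \<in> carrier G" "act g \<tau> = \<sigma>" using R_ex[OF assms] by blast
  have \<tau>s: "\<tau> \<in> simps j" by (rule R_simplex[OF \<tau>(1)])
  define c where "c = weight \<tau> / vol \<tau>"
  have c: "c > 0" unfolding c_def using weight_pos[OF \<tau>s] vol_pos[OF \<tau>s] by (rule divide_pos_pos)
  have "norm (\<phi> \<sigma>) \<le> sqrt (1 / c) * sqrt (nsq j \<phi>)" if \<phi>: "\<phi> \<in> L2 j" for \<phi>
  proof -
    have "c * (norm (\<phi> \<tau>))\<^sup>2 \<le> nsq j \<phi>"
      using finite_sum_le_nsq[OF \<phi>, of "{\<tau>}"] \<tau>(1) by (simp add: c_def)
    then have "(norm (\<phi> \<tau>))\<^sup>2 \<le> (1 / c) * nsq j \<phi>" using c by (simp add: field_simps)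
    then have "norm (\<phi> \<tau>) \<le> sqrt ((1 / c) * nsq j \<phi>)" by (rule real_le_rsqrt)
    moreover have "norm (\<phi> \<sigma>) = norm (\<phi> \<tau>)"
      using cochain_norm_act[OF L2_cochain[OF \<phi>] \<tau>(2) \<tau>s] by (simp only: \<tau>(3))
    ultimately show ?thesis by (simp only: real_sqrt_mult)
  qed
  moreover have "sqrt (1 / c) \<ge> 0" using c by simp
  ultimately show thesis using that by blast
qed

text \<open>Completeness of the space of square summable cochains, in the form needed: a series dominated
  by a geometric one converges pointwise to a square summable cochain.\<close>

lemma L2_suminf:
  assumes \<psi>: "\<And>m. \<psi> m \<in> L2 j" and r: "0 \<le> r" "r < 1" and b: "\<And>m. sqrt (nsq j (\<psi> m)) \<le> b * r ^ m"
  shows L2_summable_norm: "\<And>\<sigma>. summable (\<lambda>m. norm (\<psi> m \<sigma>))"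
    and L2_suminf_L2: "(\<lambda>\<sigma>. \<Sum>m. \<psi> m \<sigma>) \<in> L2 j"
proof -
  have b0: "b \<ge> 0" using order_trans[OF real_sqrt_ge_zero[OF nsq_nonneg] b[of 0]] by simp
  have out: "\<psi> m \<sigma> = 0" if "\<sigma> \<notin> simps j" for m \<sigma>
    by (rule cochain_outside[OF L2_cochain[OF \<psi>] that])
  have geo: "summable (\<lambda>m. c * r ^ m)" for c using r by (intro summable_mult summable_geometric) simp
  show sn: "summable (\<lambda>m. norm (\<psi> m \<sigma>))" for \<sigma>
  proof (cases "\<sigma> \<in> simps j")
    case True
    obtain c where c: "c \<ge> 0" "\<And>\<phi>. \<phi> \<in> L2 j \<Longrightarrow> norm (\<phi> \<sigma>) \<le> c * sqrt (nsq j \<phi>)"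
      using norm_le_nsq[OF True] by blast
    have "norm (\<psi> m \<sigma>) \<le> (c * b) * r ^ m" for m
    proof -
      have "norm (\<psi> m \<sigma>) \<le> c * sqrt (nsq j (\<psi> m))" by (rule c(2)[OF \<psi>])
      also have "\<dots> \<le> c * (b * r ^ m)" by (rule mult_left_mono[OF b c(1)])
      finally show ?thesis by (simp add: mult.assoc)
    qed
    then show ?thesis by (intro summable_comparison_test'[OF geo[of "c * b"], of 0]) simp
  qed (simp add: out)
  then have sm: "summable (\<lambda>m. \<psi> m \<sigma>)" for \<sigma> by (rule summable_norm_cancel)
  have C: "(\<lambda>\<sigma>. \<Sum>m. \<psi> m \<sigma>) \<in> C j"
  proof (rule cochainI)
    show "(\<Sum>m. \<psi> m \<sigma>) = 0" if "\<sigma> \<notin> simps j" for \<sigma> using out[OF that] by simp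
    show "swap_antisym (simps j) (\<lambda>\<sigma>. \<Sum>m. \<psi> m \<sigma>)"
      unfolding swap_antisym_def
    proof (intro allI impI)
      fix xs u v ys assume \<sigma>: "xs @ u # v # ys \<in> simps j"
      have "\<psi> m (xs @ v # u # ys) = - \<psi> m (xs @ u # v # ys)" for m
        using cochain_antisym[OF L2_cochain[OF \<psi>]] \<sigma> unfolding swap_antisym_def by blast
      then show "(\<Sum>m. \<psi> m (xs @ v # u # ys)) = - (\<Sum>m. \<psi> m (xs @ u # v # ys))"
        using suminf_minus[OF sm[of "xs @ u # v # ys"]] by (simp only:)
    qed
    show "(\<Sum>m. \<psi> m (act g \<sigma>)) = \<rho> g (\<Sum>m. \<psi> m \<sigma>)" if g: "g \<in> carrier G" and \<sigma>: "\<sigma> \<in> simps j" for g \<sigma>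
      unfolding bounded_linear.suminf[OF rho_bounded_linear[OF g] sm] cochain_act[OF L2_cochain[OF \<psi>] g \<sigma>] ..
  qed
  have bound: "(\<Sum>\<sigma>\<in>A. weight \<sigma> * (norm (\<Sum>m. \<psi> m \<sigma>))\<^sup>2 / vol \<sigma>) \<le> (b / (1 - r))\<^sup>2" if A: "finite A" "A \<subseteq> R j" for A
  proof -
    define w where "w \<sigma> = sqrt (weight \<sigma> / vol \<sigma>)" for \<sigma>
    have w: "(w \<sigma> * norm x)\<^sup>2 = weight \<sigma> * (norm x)\<^sup>2 / vol \<sigma>" for \<sigma> and x :: 'h
      by (simp add: w_def power_mult_distrib)
    have partial: "L2_set (\<lambda>\<sigma>. w \<sigma> * norm (\<Sum>m<N. \<psi> m \<sigma>)) A \<le> (\<Sum>m<N. b * r ^ m)" for N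
    proof (induction N)
      case (Suc N)
      have "L2_set (\<lambda>\<sigma>. w \<sigma> * norm (\<Sum>m<Suc N. \<psi> m \<sigma>)) A
          \<le> L2_set (\<lambda>\<sigma>. w \<sigma> * norm (\<Sum>m<N. \<psi> m \<sigma>) + w \<sigma> * norm (\<psi> N \<sigma>)) A"
      proof (rule L2_set_mono)
        fix \<sigma>
        have "w \<sigma> * norm (\<Sum>m<Suc N. \<psi> m \<sigma>) \<le> w \<sigma> * (norm (\<Sum>m<N. \<psi> m \<sigma>) + norm (\<psi> N \<sigma>))"
          by (intro mult_left_mono) (auto simp: w_def norm_triangle_ineq)
        then show "w \<sigma> * norm (\<Sum>m<Suc N. \<psi> m \<sigma>) \<le> w \<sigma> * norm (\<Sum>m<N. \<psi> m \<sigma>) + w \<sigma> * norm (\<psi> N \<sigma>)"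
          by (simp only: distrib_left)
      qed (simp add: w_def)
      also have "\<dots> \<le> L2_set (\<lambda>\<sigma>. w \<sigma> * norm (\<Sum>m<N. \<psi> m \<sigma>)) A + L2_set (\<lambda>\<sigma>. w \<sigma> * norm (\<psi> N \<sigma>)) A"
        by (rule L2_set_triangle_ineq)
      also have "L2_set (\<lambda>\<sigma>. w \<sigma> * norm (\<psi> N \<sigma>)) A \<le> b * r ^ N"
      proof -
        have "L2_set (\<lambda>\<sigma>. w \<sigma> * norm (\<psi> N \<sigma>)) A \<le> sqrt (nsq j (\<psi> N))"
          unfolding L2_set_def w by (rule real_sqrt_le_mono[OF finite_sum_le_nsq[OF \<psi> A]])
        then show ?thesis using b[of N] by (rule order_trans)
      qed
      finally show ?case using Suc.IH by simp
    qed (simp add: L2_set_def)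
    have "(\<lambda>N. L2_set (\<lambda>\<sigma>. w \<sigma> * norm (\<Sum>m<N. \<psi> m \<sigma>)) A) \<longlonglongrightarrow> L2_set (\<lambda>\<sigma>. w \<sigma> * norm (\<Sum>m. \<psi> m \<sigma>)) A"
      unfolding L2_set_def by (intro tendsto_intros summable_LIMSEQ sm)
    moreover have "L2_set (\<lambda>\<sigma>. w \<sigma> * norm (\<Sum>m<N. \<psi> m \<sigma>)) A \<le> b / (1 - r)" for N
    proof -
      have "(\<Sum>m<N. b * r ^ m) \<le> (\<Sum>m. b * r ^ m)"
        by (rule sum_le_suminf[OF geo]) (use b0 r in auto)
      also have "\<dots> = b / (1 - r)"
        using r by (subst suminf_mult) (auto simp: suminf_geometric summable_geometric)
      finally show ?thesis using partial[of N] by linarith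
    qed
    ultimately have "L2_set (\<lambda>\<sigma>. w \<sigma> * norm (\<Sum>m. \<psi> m \<sigma>)) A \<le> b / (1 - r)"
      by (intro LIMSEQ_le_const2) auto
    then have "(L2_set (\<lambda>\<sigma>. w \<sigma> * norm (\<Sum>m. \<psi> m \<sigma>)) A)\<^sup>2 \<le> (b / (1 - r))\<^sup>2"
      by (intro power_mono L2_set_nonneg)
    moreover have "(L2_set (\<lambda>\<sigma>. w \<sigma> * norm (\<Sum>m. \<psi> m \<sigma>)) A)\<^sup>2 = (\<Sum>\<sigma>\<in>A. weight \<sigma> * (norm (\<Sum>m. \<psi> m \<sigma>))\<^sup>2 / vol \<sigma>)"
      unfolding L2_set_def w by (intro real_sqrt_pow2 sum_nonneg) simp
    ultimately show ?thesis by simp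
  qed
  have "orbit_summable j (\<lambda>\<sigma>. weight \<sigma> * (norm (\<Sum>m. \<psi> m \<sigma>))\<^sup>2)"
    unfolding orbit_summable_def
  proof (rule nonneg_bdd_above_summable_on)
    show "bdd_above (sum (\<lambda>\<sigma>. weight \<sigma> * (norm (\<Sum>m. \<psi> m \<sigma>))\<^sup>2 / vol \<sigma>) ` {F. F \<subseteq> R j \<and> finite F})"
      by (rule bdd_aboveI2[of _ _ "(b / (1 - r))\<^sup>2"]) (use bound in auto)
  qed simp
  then show "(\<lambda>\<sigma>. \<Sum>m. \<psi> m \<sigma>) \<in> L2 j" using C by (simp add: L2_iff)
qed

lemma coboundary_diff_scale:
  "d j (\<lambda>\<sigma>. \<phi> \<sigma> - t *\<^sub>R \<psi> \<sigma>) = (\<lambda>\<sigma>. d j \<phi> \<sigma> - t *\<^sub>R d j \<psi> \<sigma>)"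
  by (rule ext)
    (simp add: coboundary_def scaleR_diff_right sum_subtractf scaleR_sum_right mult.commute)

text \<open>If the codifferential is bounded below on the closed cochains, the gradient descent
  \<open>\<phi> \<mapsto> \<phi> - t d (codiff \<phi>)\<close> contracts them, and the steps add up to a primitive.\<close>

lemma closed_imp_exact:
  assumes coercive: "\<And>\<phi>. \<phi> \<in> L2 (Suc j) \<Longrightarrow> d (Suc j) \<phi> = (\<lambda>\<sigma>. 0) \<Longrightarrow> c * nsq (Suc j) \<phi> \<le> nsq j (codiff j \<phi>)"
    and c: "c > 0" and j: "j < n" and \<phi>: "\<phi> \<in> L2 (Suc j)" and closed: "d (Suc j) \<phi> = (\<lambda>\<sigma>. 0)"
  shows "\<exists>\<psi>\<in>L2 j. d j \<psi> = \<phi>"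
proof -
  let ?k = "Suc j"
  define M where "M = (real j + 2)\<^sup>2 * (real n - real j)"
  have M: "M > 0" unfolding M_def using j by (intro mult_pos_pos) auto
  \<comment> \<open>\<open>M\<close> bounds the square of \<open>d\<close>, and \<open>t\<close> minimises the bound \<open>- 2 t (j + 2) + t\<^sup>2 M\<close> of the change
     of the norm; clipping \<open>q\<close> at \<open>0\<close> makes its square root available below.\<close>
  define t where "t = (real j + 2) / M"
  have t: "t > 0" unfolding t_def using M by simp
  define Tr where "Tr \<phi> = (\<lambda>\<sigma>. \<phi> \<sigma> - t *\<^sub>R d j (codiff j \<phi>) \<sigma>)" for \<phi>
  define q where "q = max 0 (1 - (real j + 2)\<^sup>2 / M * c)"
  have q: "0 \<le> q" "q < 1" unfolding q_def using M c by auto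
  have Tr_L2: "Tr \<phi> \<in> L2 ?k" and Tr_closed: "d ?k (Tr \<phi>) = (\<lambda>\<sigma>. 0)" and Tr_nsq: "nsq ?k (Tr \<phi>) \<le> q * nsq ?k \<phi>"
    if \<phi>: "\<phi> \<in> L2 ?k" and closed: "d ?k \<phi> = (\<lambda>\<sigma>. 0)" for \<phi>
  proof -
    let ?\<delta> = "codiff j \<phi>"
    have \<delta>: "?\<delta> \<in> L2 j" by (rule codiff_L2[OF \<phi>])
    have d\<delta>: "d j ?\<delta> \<in> L2 ?k" by (rule coboundary_L2[OF \<delta>])
    show "Tr \<phi> \<in> L2 ?k"
      using L2_add[OF \<phi> L2_scale[OF d\<delta>, of "- t"]] by (simp add: Tr_def)
    show "d ?k (Tr \<phi>) = (\<lambda>\<sigma>. 0)"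
      unfolding Tr_def coboundary_diff_scale closed coboundary_coboundary by simp
    let ?ip = "\<lambda>\<sigma>. weight \<sigma> * ip (d j ?\<delta> \<sigma>) (\<phi> \<sigma>)"
    have s_ip: "orbit_summable ?k ?ip" by (rule summable_weight_ip[OF L2_summable[OF d\<delta>] L2_summable[OF \<phi>]])
    have ip_sum: "orbit_sum ?k ?ip = (real j + 2) * nsq j ?\<delta>"
      unfolding coboundary_codiff_adjoint[OF \<delta> \<phi>] nsq_def ip_self ..
    have expand: "weight \<sigma> * (norm (Tr \<phi> \<sigma>))\<^sup>2
        = weight \<sigma> * (norm (\<phi> \<sigma>))\<^sup>2 - (2 * t) * ?ip \<sigma> + t\<^sup>2 * (weight \<sigma> * (norm (d j ?\<delta> \<sigma>))\<^sup>2)" for \<sigma>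
      unfolding Tr_def norm_diff_square ip_scaleR_right
      by (simp add: ip_commute[of "\<phi> \<sigma>"] power_mult_distrib algebra_simps)
    have "nsq ?k (Tr \<phi>) = orbit_sum ?k (\<lambda>\<sigma>. weight \<sigma> * (norm (\<phi> \<sigma>))\<^sup>2 - (2 * t) * ?ip \<sigma> + t\<^sup>2 * (weight \<sigma> * (norm (d j ?\<delta> \<sigma>))\<^sup>2))"
      unfolding nsq_def expand ..
    also have "\<dots> = nsq ?k \<phi> - (2 * t) * ((real j + 2) * nsq j ?\<delta>) + t\<^sup>2 * nsq ?k (d j ?\<delta>)"
      by (simp only: orbit_sum_add[OF orbit_summable_diff[OF L2_summable[OF \<phi>] orbit_summable_cmult[OF s_ip]]
          orbit_summable_cmult[OF L2_summable[OF d\<delta>]]]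
        orbit_sum_diff[OF L2_summable[OF \<phi>] orbit_summable_cmult[OF s_ip]] orbit_sum_cmult ip_sum nsq_def[symmetric])
    also have "\<dots> \<le> nsq ?k \<phi> - (2 * t) * ((real j + 2) * nsq j ?\<delta>) + t\<^sup>2 * (M * nsq j ?\<delta>)"
      using nsq_coboundary_le[OF \<delta>] unfolding M_def by (intro add_left_mono mult_left_mono) auto
    also have "\<dots> = nsq ?k \<phi> - (real j + 2)\<^sup>2 / M * nsq j ?\<delta>"
      unfolding t_def using M by (simp add: field_simps power2_eq_square)
    also have "\<dots> \<le> nsq ?k \<phi> - (real j + 2)\<^sup>2 / M * (c * nsq ?k \<phi>)"
      using coercive[OF \<phi> closed] M by (intro diff_left_mono mult_left_mono) auto
    also have "\<dots> = (1 - (real j + 2)\<^sup>2 / M * c) * nsq ?k \<phi>" by (simp add: algebra_simps)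
    also have "\<dots> \<le> q * nsq ?k \<phi>" unfolding q_def by (rule mult_right_mono[OF _ nsq_nonneg]) simp
    finally show "nsq ?k (Tr \<phi>) \<le> q * nsq ?k \<phi>" .
  qed
  define \<Phi> where "\<Phi> m = (Tr ^^ m) \<phi>" for m
  have \<Phi>: "\<Phi> m \<in> L2 ?k \<and> d ?k (\<Phi> m) = (\<lambda>\<sigma>. 0) \<and> nsq ?k (\<Phi> m) \<le> q ^ m * nsq ?k \<phi>" for m
  proof (induction m)
    case 0
    then show ?case using \<phi> closed by (simp add: \<Phi>_def)
  next
    case (Suc m)
    have eq: "\<Phi> (Suc m) = Tr (\<Phi> m)" by (simp add: \<Phi>_def)
    have "nsq ?k (Tr (\<Phi> m)) \<le> q * nsq ?k (\<Phi> m)" using Tr_nsq Suc by blast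
    also have "\<dots> \<le> q * (q ^ m * nsq ?k \<phi>)" using Suc q by (intro mult_left_mono) auto
    finally have "nsq ?k (Tr (\<Phi> m)) \<le> q ^ Suc m * nsq ?k \<phi>" by (simp add: mult.assoc)
    then show ?case unfolding eq using Tr_L2 Tr_closed Suc by blast
  qed
  define r where "r = sqrt q"
  have r: "0 \<le> r" "r < 1" unfolding r_def using q by auto
  have sqrt_q: "sqrt (q ^ m * x) = r ^ m * sqrt x" for m x
    by (simp add: r_def real_sqrt_mult real_sqrt_power)
  define \<psi> where "\<psi> m = codiff j (\<Phi> m)" for m
  have \<psi>: "\<psi> m \<in> L2 j" for m unfolding \<psi>_def using codiff_L2 \<Phi> by blast
  have \<psi>_bound: "sqrt (nsq j (\<psi> m)) \<le> sqrt ((real n - real j) * nsq ?k \<phi>) * r ^ m" for m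
  proof -
    have "nsq j (\<psi> m) \<le> (real n - real j) * nsq ?k (\<Phi> m)" unfolding \<psi>_def using nsq_codiff_le \<Phi> by blast
    also have "\<dots> \<le> (real n - real j) * (q ^ m * nsq ?k \<phi>)" using \<Phi>[of m] j by (intro mult_left_mono) auto
    also have "\<dots> = q ^ m * ((real n - real j) * nsq ?k \<phi>)" by simp
    finally have "sqrt (nsq j (\<psi> m)) \<le> sqrt (q ^ m * ((real n - real j) * nsq ?k \<phi>))" by (rule real_sqrt_le_mono)
    then show ?thesis unfolding sqrt_q by (simp only: mult.commute)
  qed
  let ?\<Psi> = "\<lambda>\<sigma>. \<Sum>m. \<psi> m \<sigma>"
  have \<Psi>: "?\<Psi> \<in> L2 j" by (rule L2_suminf_L2[OF \<psi> r \<psi>_bound])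
  have sm: "summable (\<lambda>m. \<psi> m \<sigma>)" for \<sigma>
    by (rule summable_norm_cancel[OF L2_summable_norm[OF \<psi> r \<psi>_bound]])
  have "d j (\<lambda>\<sigma>. t *\<^sub>R ?\<Psi> \<sigma>) \<sigma> = \<phi> \<sigma>" for \<sigma>
  proof (cases "\<sigma> \<in> simps ?k")
    case False
    then show ?thesis using cochain_outside[OF L2_cochain[OF \<phi>]] by (simp add: coboundary_def)
  next
    case True
    have "(\<lambda>m. \<Phi> m \<sigma>) \<longlonglongrightarrow> 0"
    proof -
      obtain b where b: "b \<ge> 0" "\<And>\<phi>. \<phi> \<in> L2 ?k \<Longrightarrow> norm (\<phi> \<sigma>) \<le> b * sqrt (nsq ?k \<phi>)"
        using norm_le_nsq[OF True] by blast
      have bnd: "norm (\<Phi> m \<sigma>) \<le> (b * sqrt (nsq ?k \<phi>)) * r ^ m" for m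
      proof -
        have "norm (\<Phi> m \<sigma>) \<le> b * sqrt (nsq ?k (\<Phi> m))" using b(2) \<Phi> by blast
        also have "\<dots> \<le> b * sqrt (q ^ m * nsq ?k \<phi>)"
          using \<Phi>[of m] b(1) by (intro mult_left_mono real_sqrt_le_mono) auto
        finally show ?thesis unfolding sqrt_q by (simp add: mult_ac)
      qed
      have lim: "(\<lambda>m. (b * sqrt (nsq ?k \<phi>)) * r ^ m) \<longlonglongrightarrow> 0"
        using r by (intro tendsto_mult_right_zero LIMSEQ_power_zero) simp
      show ?thesis by (rule Lim_null_comparison[OF always_eventually[OF allI[OF bnd]] lim])
    qed
    then have "(\<lambda>m. \<Phi> m \<sigma> - \<Phi> (Suc m) \<sigma>) sums (\<Phi> 0 \<sigma> - 0)" by (rule telescope_sums')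
    moreover have "\<Phi> m \<sigma> - \<Phi> (Suc m) \<sigma> = t *\<^sub>R d j (\<psi> m) \<sigma>" for m
      by (simp add: \<Phi>_def \<psi>_def Tr_def)
    moreover have "\<Phi> 0 = \<phi>" by (simp add: \<Phi>_def)
    ultimately have 1: "(\<lambda>m. t *\<^sub>R d j (\<psi> m) \<sigma>) sums \<phi> \<sigma>" by simp
    have "(\<lambda>m. t *\<^sub>R (\<Sum>i\<le>?k. (-1) ^ i *\<^sub>R \<psi> m (delete_nth i \<sigma>))) sums (t *\<^sub>R (\<Sum>i\<le>?k. (-1) ^ i *\<^sub>R ?\<Psi> (delete_nth i \<sigma>)))"
      by (intro sums_scaleR_right sums_sum summable_sums sm)
    then have 2: "(\<lambda>m. t *\<^sub>R d j (\<psi> m) \<sigma>) sums (t *\<^sub>R d j ?\<Psi> \<sigma>)"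
      unfolding coboundary_simplex[OF True] .
    have "d j (\<lambda>\<sigma>. t *\<^sub>R ?\<Psi> \<sigma>) \<sigma> = t *\<^sub>R d j ?\<Psi> \<sigma>"
      unfolding coboundary_simplex[OF True] scaleR_sum_right by (intro sum.cong refl) simp
    then show ?thesis using sums_unique2[OF 1 2] by simp
  qed
  then have "d j (\<lambda>\<sigma>. t *\<^sub>R ?\<Psi> \<sigma>) = \<phi>" by (rule ext)
  then show ?thesis using L2_scale[OF \<Psi>] by blast
qed

end

lemma (in comm_group) trivial_group_Mod_carrier: "trivial_group (G Mod carrier G)"
proof -
  have sub: "subgroup (carrier G) G" by (rule subgroup_self)
  interpret N: normal "carrier G" G by (rule subgroup_imp_normal[OF sub])
  have "carrier (G Mod carrier G) = {carrier G}"
  proof -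
    have "carrier G #> x = carrier G" if "x \<in> carrier G" for x
      by (rule coset_join2[OF that sub that])
    then show ?thesis by (auto simp: FactGroup_def RCOSETS_def)
  qed
  then show ?thesis
    using N.factorgroup_is_group by (simp add: trivial_group_def FactGroup_def)
qed

lemma (in l2_cochains) trivial_L2_cohomology:
  assumes "\<And>\<phi>. \<phi> \<in> L2 (Suc j) \<Longrightarrow> d (Suc j) \<phi> = (\<lambda>\<sigma>. 0) \<Longrightarrow> \<exists>\<psi>\<in>L2 j. d j \<psi> = \<phi>"
  shows "trivial_group (L2_cohomology G \<mu> X n a R \<rho> (Suc j))"
proof -
  let ?Z = "{\<phi> \<in> L2 (Suc j). d (Suc j) \<phi> = (\<lambda>\<sigma>. 0)}"
  let ?M = "\<lparr>carrier = ?Z, mult = (\<lambda>\<phi> \<psi> \<sigma>. \<phi> \<sigma> + \<psi> \<sigma>), one = (\<lambda>\<sigma>. 0)\<rparr> :: ('v list \<Rightarrow> 'h) monoid"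
  have d_add: "d (Suc j) (\<lambda>\<sigma>. \<phi> \<sigma> + \<psi> \<sigma>) = (\<lambda>\<sigma>. d (Suc j) \<phi> \<sigma> + d (Suc j) \<psi> \<sigma>)" for \<phi> \<psi> :: "'v list \<Rightarrow> 'h"
    using coboundary_diff_scale[of "Suc j" \<phi> "-1" \<psi>] by simp
  have d_zero: "d (Suc j) (\<lambda>\<sigma>. 0 :: 'h) = (\<lambda>\<sigma>. 0)" by (rule ext) (simp add: coboundary_def)
  interpret Z: comm_group ?M
  proof (rule comm_groupI)
    show "x \<otimes>\<^bsub>?M\<^esub> y \<in> carrier ?M" if "x \<in> carrier ?M" "y \<in> carrier ?M" for x y
      using that by (simp add: L2_add d_add)
    show "\<one>\<^bsub>?M\<^esub> \<in> carrier ?M" by (simp add: L2_zero d_zero)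
    show "\<exists>y\<in>carrier ?M. y \<otimes>\<^bsub>?M\<^esub> x = \<one>\<^bsub>?M\<^esub>" if "x \<in> carrier ?M" for x
    proof (rule bexI[of _ "\<lambda>\<sigma>. (-1) *\<^sub>R x \<sigma>"])
      have "d (Suc j) (\<lambda>\<sigma>. (-1) *\<^sub>R x \<sigma>) = (\<lambda>\<sigma>. 0)"
        using coboundary_diff_scale[of "Suc j" "\<lambda>\<sigma>. 0" 1 x] that d_zero by simp
      then show "(\<lambda>\<sigma>. (-1) *\<^sub>R x \<sigma>) \<in> carrier ?M"
        using L2_scale[of x "Suc j" "-1"] that by simp
    qed simp
  qed (auto simp: fun_eq_iff)
  have "d j ` L2 j = ?Z"
    using assms coboundary_L2 coboundary_coboundary by auto
  then have "L2_cohomology G \<mu> X n a R \<rho> (Suc j) = ?M Mod carrier ?M"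
    by (simp add: L2_cohomology_def)
  then show ?thesis using Z.trivial_group_Mod_carrier by (simp only:)
qed

theorem theorem3p4:
  fixes X :: "'v set set" and n k l :: nat and \<epsilon> :: real
    and G :: "('g, 'm) monoid_scheme" and T :: "'g topology" and \<mu> :: "'g measure"
    and a :: "'g \<Rightarrow> 'v \<Rightarrow> 'v" and R :: "nat \<Rightarrow> 'v list set"
    and \<rho> :: "'g \<Rightarrow> 'h::complex_hilbert \<Rightarrow> 'h"
  assumes "abstract_complex X" and "locally_finite_complex X" and "has_dimension X n"
    and "links_connected X n"
    and "\<forall>s\<in>X. \<exists>t\<in>X. s \<subseteq> t \<and> card t = n + 1"
    and "locally_compact_group G T" and "unimodular G T"
    and "properly_discontinuous_action G T X a"
    and "left_haar_measure G T \<mu>"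
    and "\<forall>j. orbit_representatives G X a j (R j)"
    and "1 \<le> k" and "k < n"
    and "k < l" and "l \<le> n" and "\<epsilon> > 0"
    and "\<forall>\<gamma>\<in>R l. \<forall>t::real.
           poly (face_poly k \<gamma> (\<lambda>\<sigma>. [:- S_sum X n k \<sigma>, 1:])) t = 0 \<longrightarrow> t \<ge> \<epsilon>"
    and "unitary_representation G T \<rho>"
  shows "trivial_group (L2_cohomology G \<mu> X n a R \<rho> k)"
proof -
  interpret l2_cochains X n G T \<mu> a R \<rho>
    by unfold_locales (fact assms)+
  obtain j where k: "k = Suc j" using assms(11) by (cases k) auto
  have j: "j + 1 < n" and l: "Suc j \<le> l" using assms(12,13) k by simp_all
  show ?thesis
    unfolding k
  proof (rule trivial_L2_cohomology, rule closed_imp_exact)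
    fix \<phi> assume \<phi>: "\<phi> \<in> L2 (Suc j)" "d (Suc j) \<phi> = (\<lambda>\<sigma>. 0)"
    have "\<epsilon> * nsq (Suc j) \<phi> \<le> 2 * (real j + 2) * nsq j (codiff j \<phi>)"
      by (rule nsq_le_codiff[OF \<phi> j assms(4) l assms(14) assms(16)[unfolded k]])
    then show "\<epsilon> / (2 * (real j + 2)) * nsq (Suc j) \<phi> \<le> nsq j (codiff j \<phi>)"
      by (simp add: field_simps)
  qed (use assms(15) j in auto)
qed

end
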